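(* Let $d \ge 1$ and let $A_1, A_2, \dots$ be independent $d \times d$ random matrices, each $A_i = G_i^{\rm c}$ being a complex Gaussian matrix whose entries are independent standard complex normals. Let $\mu_1 \ge \mu_2 \ge \cdots \ge \mu_d$ be the Lyapunov exponents of the product $P_N = A_N A_{N-1}\cdots A_1$. Then $$\mu_i = \tfrac12 \Psi(d-i+1) \qquad (i=1,\dots,d).$$
   Context: A standard complex normal is a complex random variable with density $\pi^{-1}e^{-|z|^2}$ on $\mathbb{C}$ (so $\langle |z|^2\rangle = 1$). $\Psi(x) = \Gamma'(x)/\Gamma(x)$ is the digamma function. Lyapunov exponents: for i.i.d. $d\times d$ random matrices $A_i$ such that the diagonal elements of $A_i^\dagger A_i$ have finite second moments, the limit $V_d := \lim_{N\to\infty}(P_N^\dagger P_N)^{1/(2N)}$, with $P_N = A_N\cdots A_1$, exists almost surely (Oseledec's multiplicative ergodic theorem) and has nonrandom positive eigenvalues, written $e^{\mu_1}\ge \cdots\ge e^{\mu_d}$; the numbers $\mu_1\ge\cdots\ge\mu_d$ are the Lyapunov exponents. *)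

theory Defs
  imports "HOL-Probability.Probability"
begin

definition ctranspose :: "complex^'n^'m \<Rightarrow> complex^'m^'n" where
  "ctranspose A = (\<chi> i j. cnj (A $ j $ i))"

definition positive_semidefinite :: "complex^'n^'n \<Rightarrow> bool" where
  "positive_semidefinite B \<longleftrightarrow>
     ctranspose B = B \<and> (\<forall>x. 0 \<le> Re (\<Sum>i\<in>UNIV. cnj (x $ i) * (B *v x) $ i))"

(* The operation (^) on the type of vectors of vectors acts componentwise,
   hence a separate power for the matrix product. *)
definition matrix_power :: "complex^'n^'n \<Rightarrow> nat \<Rightarrow> complex^'n^'n" where
  "matrix_power A m = (((**) A) ^^ m) (mat 1)"

(* B^(1/m): for positive semidefinite B and m > 0 there is exactly one positive
   semidefinite m-th root. *)
definition psd_root :: "nat \<Rightarrow> complex^'n^'n \<Rightarrow> complex^'n^'n" where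
  "psd_root m B = (THE C. positive_semidefinite C \<and> matrix_power C m = B)"

(* A N ** ... ** A 1; the matrix A 0 is not used. *)
primrec matrix_product :: "(nat \<Rightarrow> complex^'n^'n) \<Rightarrow> nat \<Rightarrow> complex^'n^'n" where
  "matrix_product A 0 = mat 1"
| "matrix_product A (Suc N) = A (Suc N) ** matrix_product A N"

(* The factorisation of the characteristic polynomial of V says that the eigenvalues
   of V, listed with multiplicity, are exp (\<mu> 1), ..., exp (\<mu> d), where d = CARD('n).
   The numbers \<mu> i do not depend on the sample point \<omega>; V may.
   Only the values \<mu> 1, ..., \<mu> d matter. *)
definition lyapunov_exponents ::
    "'a measure \<Rightarrow> (nat \<Rightarrow> 'a \<Rightarrow> complex^'n^'n) \<Rightarrow> (nat \<Rightarrow> real) \<Rightarrow> bool" where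
  "lyapunov_exponents M A \<mu> \<longleftrightarrow>
     antimono_on {1..CARD('n)} \<mu> \<and>
     (AE \<omega> in M. \<exists>V.
        (\<lambda>N. let P = matrix_product (\<lambda>k. A k \<omega>) N in psd_root (2 * N) (ctranspose P ** P))
          \<longlonglongrightarrow> V \<and>
        (\<forall>z. det (mat z - V) = (\<Prod>i=1..CARD('n). z - complex_of_real (exp (\<mu> i)))))"

definition std_complex_normal_density :: "complex \<Rightarrow> real" where
  "std_complex_normal_density z = exp (- (norm z)\<^sup>2) / pi"

definition complex_gaussian_matrix :: "'a measure \<Rightarrow> ('a \<Rightarrow> complex^'n^'n) \<Rightarrow> bool" where
  "complex_gaussian_matrix M G \<longleftrightarrow>
     prob_space.indep_vars M (\<lambda>_. borel) (\<lambda>(i, j) \<omega>. G \<omega> $ i $ j) UNIV \<and>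
     (\<forall>i j. distributed M lborel (\<lambda>\<omega>. G \<omega> $ i $ j) std_complex_normal_density)"

end

theory Submission
  imports Defs
begin

text \<open>Write \<open>d\<close> for the dimension, \<open>P\<^sub>N\<close> for the product of the first \<open>N\<close> factors, and \<open>g\<^sub>N\<^sub>,\<^sub>j\<close>
(\<open>0 \<le> j < d\<close>) for the Gram-Schmidt vectors of the columns of \<open>P\<^sub>N\<close>. The numbers
\<open>m\<^sub>j = \<Psi>(d - j) / 2\<close> enter as growth rates of the lengths of these vectors, and
the proof splits into a probabilistic part, which finds the rates, and a deterministic part, which
turns the rates into the limit of the roots.

Probability. The new factor is independent of \<open>P\<^sub>N\<close>, and the law of a complex Gaussian matrix does
not change under multiplication by a unitary matrix. Therefore the orthonormalised columns of
\<open>P\<^sub>N\<close> may be replaced by the standard basis, and \<open>|g\<^sub>N\<^sub>+\<^sub>1\<^sub>,\<^sub>j|\<^sup>2\<close> is \<open>|g\<^sub>N\<^sub>,\<^sub>j|\<^sup>2\<close> times the squared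
distance of a Gaussian vector from an independent subspace of dimension \<open>j\<close>. That distance squared
is a sum of \<open>d - j\<close> independent exponential variables, so it has the Gamma law with parameter \<open>d - j\<close>
(\<open>nn_integral_gram_schmidt_gauss_times\<close>). It follows that
\<open>E |g\<^sub>N\<^sub>,\<^sub>j|\<^sup>2\<^sup>s = (\<Gamma>(d - j + s) / \<Gamma>(d - j))\<^sup>N\<close> (\<open>moment_random_frame\<close>). The logarithm of the base has
derivative \<open>\<Psi>(d - j)\<close> at \<open>s = 0\<close>: this is where the digamma function comes from. Markov's inequality
with a small \<open>s\<close> of either sign and the Borel-Cantelli lemma give
\<open>|g\<^sub>N\<^sub>,\<^sub>j| = exp (N (m\<^sub>j + o(1)))\<close> almost surely (\<open>AE_growth_le\<close>).

Determinism. Expand \<open>P\<^sub>N x = (\<Sum>i. \<langle>u\<^sub>N\<^sub>,\<^sub>i, x\<rangle> g\<^sub>N\<^sub>,\<^sub>i)\<close>. Passing from \<open>N\<close> to \<open>N + 1\<close> changes the dual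
vectors \<open>u\<^sub>N\<^sub>,\<^sub>i\<close> by an upper unitriangular matrix, whose entry above the diagonal at \<open>(i, k)\<close> is at most
\<open>\<parallel>A\<^sub>N\<^sub>+\<^sub>1\<parallel> |g\<^sub>N\<^sub>,\<^sub>k| / |g\<^sub>N\<^sub>+\<^sub>1\<^sub>,\<^sub>i|\<close>. The rates \<open>m\<^sub>j\<close> are strictly decreasing because \<open>\<Psi>\<close> is strictly increasing,
so these entries are exponentially small and the dual vectors converge (\<open>convergent_dual\<close>).
Orthonormalise them in the order \<open>0, 1, \<dots>\<close> to get \<open>x\<^sub>N\<^sub>,\<^sub>j\<close>. Then \<open>|P\<^sub>N x\<^sub>N\<^sub>,\<^sub>j|\<close> has rate at most \<open>m\<^sub>j\<close>, and
\<open>|\<langle>x\<^sub>N\<^sub>,\<^sub>j, z\<rangle>|\<close> is at most \<open>exp (- N (m\<^sub>j - o(1))) |P\<^sub>N z|\<close> for all \<open>z\<close>. In an eigenbasis of the root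
\<open>C\<^sub>N = (P\<^sub>N\<^sup>\<dagger> P\<^sub>N)\<^sup>1\<^sup>/\<^sup>2\<^sup>N\<close> the first bound excludes components of \<open>x\<^sub>N\<^sub>,\<^sub>j\<close> along eigenvalues clearly above \<open>exp m\<^sub>j\<close>
and the second excludes those clearly below (\<open>psd_root_almost_eigenvector\<close>), so \<open>C\<^sub>N x\<^sub>N\<^sub>,\<^sub>j - exp m\<^sub>j x\<^sub>N\<^sub>,\<^sub>j\<close> tends to \<open>0\<close>.
Since \<open>x\<^sub>N\<^sub>,\<^sub>j\<close> converges, \<open>C\<^sub>N\<close> converges to the matrix that has the limits of the \<open>x\<^sub>N\<^sub>,\<^sub>j\<close> as orthonormal
eigenvectors with eigenvalues \<open>exp m\<^sub>j\<close> (\<open>tendsto_C\<close>, \<open>charpoly_V\<close>).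

With \<open>i = j + 1\<close> these are the asserted exponents. No other numbers qualify: the limit, hence its
characteristic polynomial, is unique, and the polynomial determines the decreasing list of its real
roots.\<close>

section \<open>The Hermitian product and the Gram-Schmidt process\<close>

definition cinner :: "complex^'n \<Rightarrow> complex^'n \<Rightarrow> complex" where
  "cinner x y = (\<Sum>i\<in>UNIV. cnj (x $ i) * y $ i)"

lemma cinner_add_left: "cinner (x + y) z = cinner x z + cinner y z"
  and cinner_add_right: "cinner x (y + z) = cinner x y + cinner x z"
  and cinner_diff_left: "cinner (x - y) z = cinner x z - cinner y z"
  and cinner_diff_right: "cinner x (y - z) = cinner x y - cinner x z"
  and cinner_scale_left: "cinner (c *s x) y = cnj c * cinner x y"
  and cinner_scale_right: "cinner x (c *s y) = c * cinner x y"
  and cinner_zero_left [simp]: "cinner 0 x = 0"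
  and cinner_zero_right [simp]: "cinner x 0 = 0"
  by (simp_all add: cinner_def algebra_simps sum.distrib sum_subtractf sum_distrib_left)

lemma cinner_sum_left: "cinner (\<Sum>i\<in>I. f i) x = (\<Sum>i\<in>I. cinner (f i) x)"
  by (induction I rule: infinite_finite_induct) (simp_all add: cinner_add_left)

lemma cinner_sum_right: "cinner x (\<Sum>i\<in>I. f i) = (\<Sum>i\<in>I. cinner x (f i))"
  by (induction I rule: infinite_finite_induct) (simp_all add: cinner_add_right)

lemma cinner_commute: "cinner y x = cnj (cinner x y)"
  by (simp add: cinner_def mult.commute)

lemma Re_cinner: "Re (cinner x y) = x \<bullet> y"
  by (simp add: cinner_def inner_vec_def inner_complex_def)

lemma cinner_self: "cinner x x = of_real ((norm x)\<^sup>2)"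
proof (rule complex_eqI)
  show "Re (cinner x x) = Re (complex_of_real ((norm x)\<^sup>2))"
    by (simp add: Re_cinner dot_square_norm)
  show "Im (cinner x x) = Im (complex_of_real ((norm x)\<^sup>2))"
    by (simp add: cinner_def mult.commute)
qed

lemma cinner_self_eq_0 [simp]: "cinner x x = 0 \<longleftrightarrow> x = 0"
  by (simp add: cinner_self)

lemma cinner_eq_0_commute: "cinner x y = 0 \<longleftrightarrow> cinner y x = 0"
  by (metis cinner_commute complex_cnj_zero_iff)

lemma cinner_ext:
  assumes "\<And>z. cinner x z = cinner y z"
  shows "x = y"
  using assms[of "x - y"] by (metis cinner_diff_left cinner_self_eq_0 eq_iff_diff_eq_0)

lemma norm_cscale: "norm (c *s (x :: complex^'n)) = norm c * norm x"
proof -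
  have "complex_of_real ((norm (c *s x))\<^sup>2) = c * cnj c * cinner x x"
    by (simp only: cinner_scale_left cinner_scale_right mult.assoc mult.left_commute flip: cinner_self)
  also have "\<dots> = of_real ((norm c)\<^sup>2 * (norm x)\<^sup>2)"
    by (simp only: cinner_self complex_norm_square of_real_mult)
  finally have "(norm (c *s x))\<^sup>2 = (norm c * norm x)\<^sup>2"
    by (simp only: of_real_eq_iff power_mult_distrib)
  then show ?thesis by simp
qed

lemma norm_cinner_le: "norm (cinner x y) \<le> norm x * norm y"
proof -
  define c where "c = (if cinner x y = 0 then 1 else cnj (sgn (cinner x y)))"
  have c: "norm c = 1" by (simp add: c_def norm_sgn)
  have "cnj (sgn z) * z = of_real (norm z)" for z :: complex
    by (cases "z = 0") (simp_all add: sgn_eq field_simps power2_eq_square complex_norm_square[symmetric])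
  then have "cinner x (c *s y) = of_real (norm (cinner x y))"
    by (simp add: c_def cinner_scale_right)
  then have "norm (cinner x y) = x \<bullet> (c *s y)"
    by (metis Re_cinner Re_complex_of_real)
  also have "\<dots> \<le> norm x * norm (c *s y)" by (rule norm_cauchy_schwarz)
  finally show ?thesis by (simp add: norm_cscale c)
qed

lemma cinner_ctranspose: "cinner (ctranspose A *v x) y = cinner x (A *v y)"
proof -
  have "cinner (ctranspose A *v x) y = (\<Sum>i\<in>UNIV. \<Sum>j\<in>UNIV. A $ j $ i * cnj (x $ j) * y $ i)"
    by (simp add: cinner_def ctranspose_def matrix_vector_mult_def sum_distrib_right)
  also have "\<dots> = (\<Sum>j\<in>UNIV. \<Sum>i\<in>UNIV. A $ j $ i * cnj (x $ j) * y $ i)"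
    by (rule sum.swap)
  also have "\<dots> = cinner x (A *v y)"
    by (simp add: cinner_def matrix_vector_mult_def sum_distrib_left mult.commute mult.left_commute)
  finally show ?thesis .
qed

lemma ctranspose_ctranspose [simp]: "ctranspose (ctranspose A) = A"
  by (simp add: ctranspose_def vec_eq_iff)

lemma cinner_axis_right [simp]: "cinner x (axis k 1) = cnj (x $ k)"
proof -
  have "cinner x (axis k 1) = (\<Sum>i\<in>UNIV. if i = k then cnj (x $ k) else 0)"
    unfolding cinner_def by (rule sum.cong) (auto simp: axis_def)
  then show ?thesis by simp
qed

lemma tendsto_cinner [tendsto_intros]:
  assumes "(f \<longlongrightarrow> x) F" "(g \<longlongrightarrow> y) F"
  shows "((\<lambda>n. cinner (f n) (g n)) \<longlongrightarrow> cinner x y) F"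
  unfolding cinner_def by (intro tendsto_intros assms)

lemma tendsto_cscale [tendsto_intros]:
  fixes g :: "'b \<Rightarrow> complex^'n"
  assumes "(f \<longlongrightarrow> c) F" "(g \<longlongrightarrow> y) F"
  shows "((\<lambda>n. f n *s g n) \<longlongrightarrow> c *s y) F"
  by (intro vec_tendstoI) (simp, intro tendsto_intros assms)

text \<open>The vectors are orthogonalised but not normalised, so that the recursion is total and consists of
  measurable operations; a zero vector contributes nothing because division by zero gives zero.\<close>

fun gram_schmidt :: "(nat \<Rightarrow> complex^'n) \<Rightarrow> nat \<Rightarrow> complex^'n" where
  "gram_schmidt u j = u j - (\<Sum>i<j. (cinner (gram_schmidt u i) (u j) / of_real ((norm (gram_schmidt u i))\<^sup>2)) *s gram_schmidt u i)"

declare gram_schmidt.simps [simp del]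

lemma gram_schmidt_orthogonal:
  assumes "i \<noteq> j"
  shows "cinner (gram_schmidt u i) (gram_schmidt u j) = 0"
proof -
  have less: "cinner (gram_schmidt u i) (gram_schmidt u j) = 0" if "i < j" for i j
    using that
  proof (induction j arbitrary: i rule: less_induct)
    case (less j)
    let ?c = "\<lambda>k. cinner (gram_schmidt u k) (u j) / of_real ((norm (gram_schmidt u k))\<^sup>2)"
    have "cinner (gram_schmidt u i) (gram_schmidt u k) = (if k = i then of_real ((norm (gram_schmidt u i))\<^sup>2) else 0)" if "k < j" for k
      using less.IH[of k i] less.IH[of i k] less.prems that cinner_eq_0_commute[of "gram_schmidt u i" "gram_schmidt u k"]
      by (cases k i rule: linorder_cases) (auto simp: cinner_self)
    then have "(\<Sum>k<j. ?c k * cinner (gram_schmidt u i) (gram_schmidt u k)) = (\<Sum>k<j. if k = i then ?c i * of_real ((norm (gram_schmidt u i))\<^sup>2) else 0)"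
      by (intro sum.cong) auto
    also have "\<dots> = ?c i * of_real ((norm (gram_schmidt u i))\<^sup>2)"
      using less.prems by simp
    also have "\<dots> = cinner (gram_schmidt u i) (u j)"
      by (cases "gram_schmidt u i = 0") auto
    finally show ?case
      by (simp add: gram_schmidt.simps[of u j] cinner_diff_right cinner_sum_right cinner_scale_right)
  qed
  show ?thesis
    using assms less[of i j] less[of j i] cinner_eq_0_commute[of "gram_schmidt u i" "gram_schmidt u j"]
    by (cases i j rule: linorder_cases) auto
qed

lemma gram_schmidt_cong: "(\<And>i. i \<le> j \<Longrightarrow> u i = v i) \<Longrightarrow> gram_schmidt u j = gram_schmidt v j"
proof (induction j rule: less_induct)
  case (less j)
  then show ?case
    by (simp add: gram_schmidt.simps[of u j] gram_schmidt.simps[of v j])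
qed

lemma in_span_below:
  "(i::nat) < j \<Longrightarrow> u i \<in> vec.span (u ` {..<j})"
  by (rule vec.span_base) auto

lemma span_below_mono: "(i::nat) \<le> j \<Longrightarrow> vec.span (u ` {..<i}) \<subseteq> vec.span (u ` {..<j})"
  by (intro vec.span_mono image_mono) auto

lemma gram_schmidt_minus_in_span: "u j - gram_schmidt u j \<in> vec.span (u ` {..<j})"
proof (induction j rule: less_induct)
  case (less j)
  have "gram_schmidt u i \<in> vec.span (u ` {..<j})" if "i < j" for i
  proof -
    have "u i - (u i - gram_schmidt u i) \<in> vec.span (u ` {..<j})"
      using that less.IH[OF that] span_below_mono[of i j u] in_span_below[of i j u]
      by (blast intro: vec.span_diff less_imp_le)
    then show ?thesis by simp
  qed
  then show ?case
    by (subst gram_schmidt.simps) (auto intro!: vec.span_sum vec.span_scale)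
qed

lemma span_gram_schmidt: "vec.span (gram_schmidt u ` {..<j}) = vec.span (u ` {..<j})"
proof (induction j)
  case 0
  then show ?case by simp
next
  case (Suc j)
  have ins: "f ` {..<Suc j} = insert (f j) (f ` {..<j})" for f :: "nat \<Rightarrow> complex^'n"
    by (auto simp: lessThan_Suc)
  show ?case
  proof (rule vec.span_eq[THEN iffD2], intro conjI subsetI)
    fix x assume "x \<in> gram_schmidt u ` {..<Suc j}"
    then obtain i where i: "i < Suc j" "x = gram_schmidt u i" by auto
    have "u i - (u i - gram_schmidt u i) \<in> vec.span (u ` {..<Suc j})"
      using i(1) gram_schmidt_minus_in_span[of u i] span_below_mono[of i "Suc j" u] in_span_below[of i "Suc j" u]
      by (blast intro: vec.span_diff less_imp_le)
    then show "x \<in> vec.span (u ` {..<Suc j})" using i by simp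
  next
    fix x assume "x \<in> u ` {..<Suc j}"
    then obtain i where i: "i < Suc j" "x = u i" by auto
    have sub: "vec.span (u ` {..<j}) \<subseteq> vec.span (gram_schmidt u ` {..<Suc j})"
      using Suc span_below_mono[of j "Suc j" "gram_schmidt u"] by simp
    show "x \<in> vec.span (gram_schmidt u ` {..<Suc j})"
    proof (cases "i = j")
      case True
      have "(u j - gram_schmidt u j) + gram_schmidt u j \<in> vec.span (gram_schmidt u ` {..<Suc j})"
        using sub gram_schmidt_minus_in_span[of u j] in_span_below[of j "Suc j" "gram_schmidt u"] by (intro vec.span_add) auto
      then show ?thesis using True i by simp
    next
      case False
      then show ?thesis using i sub in_span_below[of i j u] by auto
    qed
  qed
qed

lemma cinner_eq_0_span:
  assumes "\<And>y. y \<in> S \<Longrightarrow> cinner v y = 0" "y \<in> vec.span S"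
  shows "cinner v y = 0"
  using assms(2)
  by (induction rule: vec.span_induct_alt) (auto simp: cinner_add_right cinner_scale_right assms(1))

lemma cinner_gram_schmidt_span: "y \<in> vec.span (u ` {..<j}) \<Longrightarrow> cinner (gram_schmidt u j) y = 0"
  by (rule cinner_eq_0_span[of "gram_schmidt u ` {..<j}"]) (auto simp: span_gram_schmidt gram_schmidt_orthogonal)

text \<open>The Gram-Schmidt vector is the component of \<open>u j\<close> orthogonal to the span of its predecessors, which
  involves the predecessors only through their span.\<close>

lemma gram_schmidt_unique:
  assumes "u j - v \<in> vec.span (u ` {..<j})"
    and "\<And>y. y \<in> vec.span (u ` {..<j}) \<Longrightarrow> cinner v y = 0"
  shows "gram_schmidt u j = v"
proof -
  have "(u j - v) - (u j - gram_schmidt u j) \<in> vec.span (u ` {..<j})"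
    by (intro vec.span_diff assms gram_schmidt_minus_in_span)
  then have in_span: "gram_schmidt u j - v \<in> vec.span (u ` {..<j})" by simp
  have "cinner (gram_schmidt u j - v) (gram_schmidt u j - v) = 0"
    using cinner_gram_schmidt_span[OF in_span] assms(2)[OF in_span] by (simp add: cinner_diff_left)
  then show ?thesis by simp
qed

text \<open>Only the flag of spans and the leading coefficient matter: a triangular change of the family
  rescales its Gram-Schmidt vectors.\<close>

lemma gram_schmidt_change_basis:
  assumes span: "vec.span (u' ` {..<j}) = vec.span (u ` {..<j})"
    and lead: "u' j - c *s u j \<in> vec.span (u ` {..<j})"
  shows "gram_schmidt u' j = c *s gram_schmidt u j"
proof (rule gram_schmidt_unique)
  have "(u' j - c *s u j) + c *s (u j - gram_schmidt u j) \<in> vec.span (u ` {..<j})"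
    by (intro vec.span_add vec.span_scale lead gram_schmidt_minus_in_span)
  moreover have "(u' j - c *s u j) + c *s (u j - gram_schmidt u j) = u' j - c *s gram_schmidt u j"
    by (simp add: vector_ssub_ldistrib)
  ultimately show "u' j - c *s gram_schmidt u j \<in> vec.span (u' ` {..<j})" by (simp add: span)
  show "cinner (c *s gram_schmidt u j) y = 0" if "y \<in> vec.span (u' ` {..<j})" for y
    using that cinner_gram_schmidt_span[of y u j] by (simp add: span cinner_scale_left)
qed

lemma cinner_gram_schmidt_self: "cinner (gram_schmidt u j) (u j) = of_real ((norm (gram_schmidt u j))\<^sup>2)"
proof -
  have "cinner (gram_schmidt u j) (u j) = cinner (gram_schmidt u j) (gram_schmidt u j) + cinner (gram_schmidt u j) (u j - gram_schmidt u j)"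
    by (simp add: cinner_diff_right)
  then show ?thesis by (simp add: cinner_gram_schmidt_span gram_schmidt_minus_in_span cinner_self)
qed

lemma tendsto_gram_schmidt:
  assumes "\<And>i. i \<le> j \<Longrightarrow> ((\<lambda>N. u N i) \<longlongrightarrow> U i) F"
    and "\<And>i. i < j \<Longrightarrow> gram_schmidt U i \<noteq> 0"
  shows "((\<lambda>N. gram_schmidt (u N) j) \<longlongrightarrow> gram_schmidt U j) F"
  using assms
proof (induction j rule: less_induct)
  case (less j)
  have "((\<lambda>N. gram_schmidt (u N) i) \<longlongrightarrow> gram_schmidt U i) F" if "i < j" for i
    using that less.prems by (intro less.IH) auto
  then show ?case
    using less.prems by (simp add: gram_schmidt.simps[of _ j]) (intro tendsto_intros; simp)
qed

lemma orthogonal_family_span: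
  fixes v :: "nat \<Rightarrow> complex^'n"
  assumes nz: "\<And>i. i < CARD('n) \<Longrightarrow> v i \<noteq> 0"
    and orth: "\<And>i j. i < CARD('n) \<Longrightarrow> j < CARD('n) \<Longrightarrow> i \<noteq> j \<Longrightarrow> cinner (v i) (v j) = 0"
  shows "vec.span (v ` {..<CARD('n)}) = UNIV"
proof -
  let ?d = "CARD('n)"
  have inj: "inj_on v {..<?d}"
    using nz orth by (intro inj_onI) (metis cinner_self_eq_0 lessThan_iff)
  have "vec.independent (v ` {..<?d})"
  proof (rule notI)
    assume "vec.dependent (v ` {..<?d})"
    then obtain a where a: "a \<in> v ` {..<?d}" "a \<in> vec.span (v ` {..<?d} - {a})"
      unfolding vec.dependent_def by auto
    then obtain i where i: "i < ?d" "a = v i" by auto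
    have "cinner (v i) (v i) = 0"
      by (rule cinner_eq_0_span[OF _ a(2)[unfolded i(2)]]) (use i orth in auto)
    then show False using nz i by simp
  qed
  then have "UNIV \<subseteq> vec.span (v ` {..<?d})"
    using inj by (intro vec.card_ge_dim_independent) (auto simp: card_image vec_dim_card simp del: vec.dim_UNIV)
  then show ?thesis by auto
qed

lemma orthogonal_expansion:
  fixes v :: "nat \<Rightarrow> complex^'n"
  assumes nz: "\<And>i. i < CARD('n) \<Longrightarrow> v i \<noteq> 0"
    and orth: "\<And>i j. i < CARD('n) \<Longrightarrow> j < CARD('n) \<Longrightarrow> i \<noteq> j \<Longrightarrow> cinner (v i) (v j) = 0"
  shows "(\<Sum>i<CARD('n). (cinner (v i) x / of_real ((norm (v i))\<^sup>2)) *s v i) = x" (is "?y = x")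
proof -
  have *: "cinner (v k) (x - ?y) = 0" if "k < CARD('n)" for k
  proof -
    have "(\<Sum>i<CARD('n). (cinner (v i) x / of_real ((norm (v i))\<^sup>2)) * cinner (v k) (v i))
        = (\<Sum>i<CARD('n). if i = k then cinner (v k) x else 0)"
      using that nz orth by (intro sum.cong) (auto simp: cinner_self)
    then show ?thesis using that
      by (simp add: cinner_diff_right cinner_sum_right cinner_scale_right)
  qed
  have "cinner (x - ?y) (x - ?y) = 0"
    by (rule cinner_eq_0_span[of "v ` {..<CARD('n)}"])
       (use * orthogonal_family_span[of v, OF nz orth] in \<open>auto simp: cinner_eq_0_commute[of _ "v _"]\<close>)
  then show ?thesis by simp
qed

section \<open>The spectral theorem and roots of positive semidefinite matrices\<close>

definition self_adjoint :: "('a::euclidean_space \<Rightarrow> 'a) \<Rightarrow> bool" where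
  "self_adjoint f \<longleftrightarrow> linear f \<and> (\<forall>x y. f x \<bullet> y = x \<bullet> f y)"

text \<open>Maximise the quadratic form over the unit sphere of \<open>S\<close>. At a maximiser \<open>v\<close> the residual
  \<open>w = f v - l v\<close> vanishes, since otherwise moving from \<open>v\<close> in the direction \<open>w\<close> would increase the
  Rayleigh quotient to first order.\<close>

lemma self_adjoint_eigenvector:
  fixes f :: "'a::euclidean_space \<Rightarrow> 'a"
  assumes f: "self_adjoint f" and S: "subspace S" "f ` S \<subseteq> S" "\<exists>x\<in>S. x \<noteq> 0"
  obtains v l where "v \<in> S" "norm v = 1" "f v = l *\<^sub>R v"
proof -
  have lin: "linear f" and sym: "f x \<bullet> y = x \<bullet> f y" for x y
    using f by (auto simp: self_adjoint_def)
  have "continuous_on (S \<inter> sphere 0 1) (\<lambda>x. x \<bullet> f x)"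
    by (intro continuous_intros linear_continuous_on) (use lin linear_linear in blast)
  moreover have "compact (S \<inter> sphere 0 1)"
    by (intro closed_Int_compact closed_subspace S compact_sphere)
  moreover have "S \<inter> sphere 0 1 \<noteq> {}"
  proof -
    obtain x where x: "x \<in> S" "x \<noteq> 0" using S by blast
    have "x /\<^sub>R norm x \<in> S \<inter> sphere 0 1"
      using x S(1) by (auto simp: subspace_def)
    then show ?thesis by blast
  qed
  ultimately obtain v where "v \<in> S \<inter> sphere 0 1"
    and vmax: "\<forall>y\<in>S \<inter> sphere 0 1. y \<bullet> f y \<le> v \<bullet> f v"
    using continuous_attains_sup[of "S \<inter> sphere 0 1" "\<lambda>x. x \<bullet> f x"] by blast
  then have v: "v \<in> S" "norm v = 1" by auto
  define l where "l = v \<bullet> f v"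
  have le: "y \<bullet> f y \<le> l * (y \<bullet> y)" if "y \<in> S" for y
  proof (cases "y = 0")
    case False
    have "(y /\<^sub>R norm y) \<bullet> f (y /\<^sub>R norm y) \<le> l"
      unfolding l_def using that False S(1) by (intro vmax[rule_format]) (auto simp: subspace_def)
    then have "(y \<bullet> f y) / (norm y)\<^sup>2 \<le> l"
      by (simp add: linear_scale[OF lin] power2_eq_square divide_inverse mult_ac)
    then show ?thesis
      using False by (simp add: divide_le_eq dot_square_norm)
  qed (simp add: linear_0[OF lin])
  define w where "w = f v - l *\<^sub>R v"
  have wS: "w \<in> S"
    unfolding w_def using v(1) S by (intro subspace_diff subspace_scale) auto
  define K where "K = w \<bullet> f w - l * (w \<bullet> w)"
  have ineq: "2 * t * (w \<bullet> w) + t\<^sup>2 * K \<le> 0" for t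
  proof -
    have ray: "(v + t *\<^sub>R w) \<bullet> f (v + t *\<^sub>R w) \<le> l * ((v + t *\<^sub>R w) \<bullet> (v + t *\<^sub>R w))"
      using v wS S(1) by (intro le subspace_add subspace_scale) auto
    have e1: "(v + t *\<^sub>R w) \<bullet> f (v + t *\<^sub>R w) = l + 2 * t * (w \<bullet> f v) + t\<^sup>2 * (w \<bullet> f w)"
      using sym[of v w]
      by (simp add: linear_add[OF lin] linear_scale[OF lin] inner_add_left inner_add_right l_def
          power2_eq_square inner_commute algebra_simps)
    have e2: "(v + t *\<^sub>R w) \<bullet> (v + t *\<^sub>R w) = 1 + 2 * t * (w \<bullet> v) + t\<^sup>2 * (w \<bullet> w)"
      using v(2) by (simp add: inner_add_left inner_add_right power2_eq_square
          inner_commute algebra_simps norm_eq_1)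
    have e3: "w \<bullet> f v = w \<bullet> w + l * (w \<bullet> v)"
      by (simp add: w_def inner_diff_left inner_diff_right algebra_simps)
    have "2 * t * (w \<bullet> w) + t\<^sup>2 * K
        = (l + 2 * t * (w \<bullet> w + l * (w \<bullet> v)) + t\<^sup>2 * (w \<bullet> f w)) - l * (1 + 2 * t * (w \<bullet> v) + t\<^sup>2 * (w \<bullet> w))"
      unfolding K_def by (simp add: algebra_simps)
    with ray[unfolded e1 e2 e3] show ?thesis by linarith
  qed
  have "w \<bullet> w \<le> 0"
  proof (rule ccontr)
    assume "\<not> w \<bullet> w \<le> 0"
    then have pos: "w \<bullet> w > 0" by linarith
    \<comment> \<open>small enough that the quadratic term cannot compensate the linear one\<close>
    define t where "t = (w \<bullet> w) / (\<bar>K\<bar> + 1)"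
    have t: "t > 0" unfolding t_def using pos by (intro divide_pos_pos) auto
    have "t * (2 * (w \<bullet> w) + t * K) \<le> 0"
      using ineq[of t] by (simp add: power2_eq_square algebra_simps)
    then have "2 * (w \<bullet> w) + t * K \<le> 0" using t by (simp add: mult_le_0_iff)
    moreover have "t * (\<bar>K\<bar> + 1) = w \<bullet> w" by (simp add: t_def)
    moreover have "t * K \<ge> - (t * (\<bar>K\<bar> + 1))"
    proof -
      have "- (t * (\<bar>K\<bar> + 1)) = t * (- \<bar>K\<bar> - 1)" by (simp add: algebra_simps)
      also have "\<dots> \<le> t * K" using t by (intro mult_left_mono) auto
      finally show ?thesis .
    qed
    ultimately show False using pos by linarith
  qed
  then have "w = 0" using inner_ge_zero[of w] by (metis antisym inner_eq_zero_iff)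
  then have "f v = l *\<^sub>R v" by (simp add: w_def)
  then show thesis using v that by blast
qed

definition eigenbasis :: "('a::euclidean_space \<Rightarrow> 'a) \<Rightarrow> 'a set \<Rightarrow> ('a \<Rightarrow> real) \<Rightarrow> bool" where
  "eigenbasis f B l \<longleftrightarrow> finite B \<and> card B = DIM('a) \<and> pairwise orthogonal B \<and> (\<forall>b\<in>B. norm b = 1) \<and>
     span B = UNIV \<and> (\<forall>b\<in>B. f b = l b *\<^sub>R b)"

text \<open>The orthogonal complement of a set of eigenvectors is invariant, so an orthonormal set of eigenvectors
  that is too small can be enlarged by an eigenvector from its complement.\<close>

lemma self_adjoint_eigenbasis:
  fixes f :: "'a::euclidean_space \<Rightarrow> 'a"
  assumes f: "self_adjoint f"
  obtains B l where "eigenbasis f B l"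
proof -
  have lin: "linear f" and sym: "f x \<bullet> y = x \<bullet> f y" for x y
    using f by (auto simp: self_adjoint_def)
  define eb where "eb B \<longleftrightarrow> finite B \<and> pairwise orthogonal B \<and> (\<forall>b\<in>B. norm b = 1) \<and> (\<forall>b\<in>B. \<exists>l. f b = l *\<^sub>R b)" for B
  have "\<exists>B. eb B \<and> card B = k" if "k \<le> DIM('a)" for k
    using that
  proof (induction k)
    case 0
    show ?case by (rule exI[of _ "{}"]) (simp add: eb_def)
  next
    case (Suc k)
    then obtain B where B: "eb B" "card B = k" by auto
    then have "dim B < DIM('a)" using Suc.prems dim_le_card'[of B] by (auto simp: eb_def)
    then obtain x where x: "x \<noteq> 0" "\<And>y. y \<in> span B \<Longrightarrow> orthogonal x y"
      using orthogonal_to_subspace_exists[of B] by auto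
    define S where "S = {x. \<forall>b\<in>B. x \<bullet> b = 0}"
    have "f y \<in> S" if "y \<in> S" for y
      using that B(1) unfolding S_def eb_def by (auto simp: sym)
    moreover have "subspace S" by (auto simp: S_def subspace_def inner_add_left)
    moreover have "x \<in> S" using x(2) by (auto simp: S_def orthogonal_def span_base)
    ultimately obtain v l where v: "v \<in> S" "norm v = 1" "f v = l *\<^sub>R v"
      using self_adjoint_eigenvector[OF f, of S] x(1) by blast
    have "v \<notin> B" using v by (auto simp: S_def)
    moreover have "eb (insert v B)"
      using B(1) v unfolding eb_def by (auto simp: pairwise_insert S_def orthogonal_def inner_commute)
    ultimately show ?case using B by (intro exI[of _ "insert v B"]) (auto simp: eb_def)
  qed
  then obtain B where B: "eb B" "card B = DIM('a)" by blast
  then obtain l where l: "\<And>b. b \<in> B \<Longrightarrow> f b = l b *\<^sub>R b" unfolding eb_def by metis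
  have "independent B"
    using B by (intro pairwise_orthogonal_independent) (auto simp: eb_def)
  then have "UNIV \<subseteq> span B"
    using B(2) by (intro card_ge_dim_independent) auto
  then have "span B = UNIV" by blast
  then show thesis using that[of B l] B l unfolding eb_def eigenbasis_def by blast
qed

lemma self_adjoint_funpow:
  assumes "self_adjoint f"
  shows "self_adjoint (f ^^ m)"
proof (induction m)
  case 0
  then show ?case by (simp add: self_adjoint_def linear_id[unfolded id_def] id_def)
next
  case (Suc m)
  then show ?case using assms unfolding self_adjoint_def
    by (auto intro: linear_compose simp: funpow_swap1)
qed

lemma funpow_eigenvector:
  assumes "linear f" "f b = l *\<^sub>R b"
  shows "(f ^^ m) b = l ^ m *\<^sub>R b"
  by (induction m) (simp_all add: linear_scale[OF assms(1)] assms(2) mult.commute)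

lemma linear_eq_spanning:
  fixes f g :: "'a::real_vector \<Rightarrow> 'b::real_vector"
  assumes lin: "linear f" "linear g" and B: "span B = UNIV" and eq: "\<And>b. b \<in> B \<Longrightarrow> f b = g b"
  shows "f = g"
proof (rule ext)
  fix x
  show "f x = g x" by (rule linear_eq_on[OF lin _ eq, of x B]) (unfold B, rule UNIV_I)
qed

text \<open>Eigenvectors \<open>b\<close> of \<open>f\<close> and \<open>c\<close> of \<open>g\<close> with different eigenvalues are eigenvectors of the common power
  with different eigenvalues, so they are orthogonal. Hence \<open>f b\<close> and \<open>g b\<close> have the same inner product with
  every \<open>c\<close>.\<close>

lemma psd_operator_root_unique:
  fixes f g :: "'a::euclidean_space \<Rightarrow> 'a"
  assumes f: "self_adjoint f" "\<And>x. 0 \<le> x \<bullet> f x" and g: "self_adjoint g" "\<And>x. 0 \<le> x \<bullet> g x"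
    and m: "m > 0" and eq: "f ^^ m = g ^^ m"
  shows "f = g"
proof -
  obtain B l where "eigenbasis f B l" by (rule self_adjoint_eigenbasis[OF f(1)])
  then have B: "\<And>b. b \<in> B \<Longrightarrow> norm b = 1" "span B = UNIV" and l: "\<And>b. b \<in> B \<Longrightarrow> f b = l b *\<^sub>R b"
    unfolding eigenbasis_def by blast+
  obtain C k where "eigenbasis g C k" by (rule self_adjoint_eigenbasis[OF g(1)])
  then have C: "\<And>b. b \<in> C \<Longrightarrow> norm b = 1" "span C = UNIV" and k: "\<And>b. b \<in> C \<Longrightarrow> g b = k b *\<^sub>R b"
    unfolding eigenbasis_def by blast+
  have lin: "linear f" "linear g" using f g by (auto simp: self_adjoint_def)
  have l0: "l b \<ge> 0" if "b \<in> B" for b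
    using f(2)[of b] l[OF that] B(1)[OF that] by (simp add: dot_square_norm)
  have k0: "k b \<ge> 0" if "b \<in> C" for b
    using g(2)[of b] k[OF that] C(1)[OF that] by (simp add: dot_square_norm)
  have "f b = g b" if b: "b \<in> B" for b
  proof -
    have "f b \<bullet> c = g b \<bullet> c" if c: "c \<in> C" for c
    proof -
      have "l b ^ m * (b \<bullet> c) = (f ^^ m) b \<bullet> c"
        by (simp add: funpow_eigenvector[OF lin(1) l[OF b]])
      also have "\<dots> = b \<bullet> (g ^^ m) c"
        using self_adjoint_funpow[OF g(1), of m] by (simp add: eq self_adjoint_def)
      also have "\<dots> = k c ^ m * (b \<bullet> c)"
        by (simp add: funpow_eigenvector[OF lin(2) k[OF c]])
      finally have "b \<bullet> c = 0 \<or> l b ^ m = k c ^ m" by simp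
      then have "b \<bullet> c = 0 \<or> l b = k c"
        using l0[OF b] k0[OF c] m by (metis power_eq_imp_eq_base)
      moreover have "g b \<bullet> c = k c * (b \<bullet> c)"
        using g(1) k[OF c] by (simp add: self_adjoint_def)
      ultimately show ?thesis using l[OF b] by auto
    qed
    then have "orthogonal (f b - g b) c" if "c \<in> C" for c
      using that by (simp add: orthogonal_def inner_diff_left)
    then have "orthogonal (f b - g b) (f b - g b)"
      using orthogonal_to_span[of "f b - g b" C "f b - g b"] C(2) by auto
    then show ?thesis by (simp add: orthogonal_def)
  qed
  then show ?thesis using linear_eq_spanning[OF lin B(2)] by blast
qed

lemma psd_operator_root_exists:
  fixes f :: "'a::euclidean_space \<Rightarrow> 'a"
  assumes f: "self_adjoint f" "\<And>x. 0 \<le> x \<bullet> f x" and m: "m > 0"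
  obtains h where "self_adjoint h" "\<And>x. 0 \<le> x \<bullet> h x" "h ^^ m = f"
proof -
  obtain B l where "eigenbasis f B l" by (rule self_adjoint_eigenbasis[OF f(1)])
  then have fin: "finite B" and B: "pairwise orthogonal B" "\<And>b. b \<in> B \<Longrightarrow> norm b = 1"
    "span B = UNIV" and l: "\<And>b. b \<in> B \<Longrightarrow> f b = l b *\<^sub>R b"
    unfolding eigenbasis_def by blast+
  have lin: "linear f" using f by (auto simp: self_adjoint_def)
  have l0: "l b \<ge> 0" if "b \<in> B" for b
    using f(2)[of b] l[OF that] B(2)[OF that] by (simp add: dot_square_norm)
  define h where "h x = (\<Sum>b\<in>B. (root m (l b) * (x \<bullet> b)) *\<^sub>R b)" for x
  have linh: "linear h"
    unfolding h_def by (intro linearI)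
      (simp_all add: inner_add_left scaleR_add_left sum.distrib distrib_left scaleR_sum_right mult_ac)
  have hb: "h b = root m (l b) *\<^sub>R b" if "b \<in> B" for b
  proof -
    have "h b = (\<Sum>c\<in>B. if c = b then root m (l b) *\<^sub>R b else 0)"
      unfolding h_def using B(1,2) that
      by (intro sum.cong) (auto simp: pairwise_def orthogonal_def dot_square_norm)
    then show ?thesis using fin that by simp
  qed
  show thesis
  proof
    show "self_adjoint h"
      unfolding self_adjoint_def using linh
      by (auto simp: h_def inner_sum_left inner_sum_right inner_commute mult_ac intro!: sum.cong)
    have "x \<bullet> h x = (\<Sum>b\<in>B. root m (l b) * (x \<bullet> b)\<^sup>2)" for x
      by (simp add: h_def inner_sum_right power2_eq_square mult.assoc)
    then show "0 \<le> x \<bullet> h x" for x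
      using l0 m by (simp add: sum_nonneg)
    have "(h ^^ m) b = f b" if "b \<in> B" for b
      using funpow_eigenvector[OF linh hb[OF that]] l0[OF that] l[OF that] m by simp
    moreover have "linear (h ^^ m)"
      using \<open>self_adjoint h\<close> self_adjoint_funpow self_adjoint_def by blast
    ultimately show "h ^^ m = f"
      using linear_eq_spanning[OF _ lin B(3)] by blast
  qed
qed

lemma scaleR_eq_cscale: "r *\<^sub>R (x :: complex^'n) = of_real r *s x"
  by (simp add: vec_eq_iff scaleR_conv_of_real[where 'a=complex])

lemma linear_matrix_vector_mult: "linear ((*v) (C :: complex^'n^'m))"
  by (intro linearI) (simp_all add: matrix_vector_right_distrib scaleR_eq_cscale vec.scale)

lemma matrix_power_mult_vec: "matrix_power C m *v x = (((*v) C) ^^ m) x"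
  by (induction m) (simp_all add: matrix_power_def flip: matrix_vector_mul_assoc)

lemma matrix_eq_cvec: "(\<And>x. A *v x = (B :: complex^'n^'m) *v x) \<Longrightarrow> A = B"
  by (metis matrix_eq)

lemma positive_semidefinite_iff:
  "positive_semidefinite C \<longleftrightarrow> self_adjoint ((*v) C) \<and> (\<forall>x. 0 \<le> x \<bullet> (C *v x))"
proof -
  have "(\<forall>x y. (C *v x) \<bullet> y = x \<bullet> (C *v y)) \<longleftrightarrow> ctranspose C = C"
  proof
    assume "ctranspose C = C"
    then show "\<forall>x y. (C *v x) \<bullet> y = x \<bullet> (C *v y)"
      by (metis Re_cinner cinner_ctranspose)
  next
    assume *: "\<forall>x y. (C *v x) \<bullet> y = x \<bullet> (C *v y)"
    have "(ctranspose C *v x) \<bullet> y = (C *v x) \<bullet> y" for x y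
      using * by (metis Re_cinner cinner_ctranspose)
    then have "ctranspose C *v x = C *v x" for x
      using vector_eq_rdot[of "ctranspose C *v x" "C *v x"] by blast
    then show "ctranspose C = C" by (rule matrix_eq_cvec)
  qed
  then show ?thesis
    unfolding positive_semidefinite_def self_adjoint_def
    by (simp add: linear_matrix_vector_mult cinner_def[symmetric] Re_cinner)
qed

lemma ii_inner: "(\<i> *s x) \<bullet> y = - (x \<bullet> (\<i> *s y))"
  by (simp add: cinner_scale_left cinner_scale_right flip: Re_cinner)

text \<open>A complex matrix acts on the real Euclidean space underlying \<open>complex^'n\<close>, where the real spectral
  theorem supplies a root \<open>h\<close>. Conjugating \<open>h\<close> by multiplication with \<open>\<i>\<close> gives another positive semidefinite
  root, so by uniqueness \<open>h\<close> commutes with \<open>\<i>\<close>, which makes it complex linear.\<close>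

lemma psd_root_exists:
  fixes B :: "complex^'n^'n"
  assumes B: "positive_semidefinite B" and m: "m > 0"
  shows "\<exists>C. positive_semidefinite C \<and> matrix_power C m = B"
proof -
  obtain h where h: "self_adjoint h" "\<And>x. 0 \<le> x \<bullet> h x" "h ^^ m = (*v) B"
    using B m psd_operator_root_exists[of "(*v) B" m] by (auto simp: positive_semidefinite_iff)
  have linh: "linear h" using h by (simp add: self_adjoint_def)
  define h' where "h' x = - (\<i> *s h (\<i> *s x))" for x
  have ii_ii: "\<i> *s (\<i> *s x) = - x" for x :: "complex^'n"
    by (simp add: vec_eq_iff)
  have lini: "linear (\<lambda>x::complex^'n. \<i> *s x)"
    by (intro linearI) (simp_all add: vec_eq_iff algebra_simps)
  have "linear h'"
    unfolding h'_def using linear_compose_neg[OF linear_compose[OF linear_compose[OF lini linh] lini]]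
    by (simp add: o_def)
  then have "self_adjoint h'"
    using h(1) by (auto simp: self_adjoint_def h'_def ii_inner)
  moreover have "0 \<le> x \<bullet> h' x" for x
    using h(2)[of "\<i> *s x"] by (simp add: h'_def ii_inner)
  moreover have "(h' ^^ k) x = - (\<i> *s (h ^^ k) (\<i> *s x))" for k x
  proof (induction k)
    case 0 then show ?case by (simp add: ii_ii)
  next
    case (Suc k)
    have "h' ((h' ^^ k) x) = - (\<i> *s h (\<i> *s (- (\<i> *s (h ^^ k) (\<i> *s x)))))"
      by (simp add: Suc h'_def)
    also have "\<i> *s (- (\<i> *s (h ^^ k) (\<i> *s x))) = (h ^^ k) (\<i> *s x)"
      by (simp add: vec_eq_iff)
    finally show ?case by simp
  qed
  then have "h' ^^ m = (*v) B"
    using h(3) by (auto simp: fun_eq_iff vec.scale ii_ii)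
  ultimately have "h' = h"
    using h m psd_operator_root_unique[of h' h m] by simp
  then have hx: "h x = - (\<i> *s h (\<i> *s x))" for x by (simp add: fun_eq_iff h'_def)
  have hi: "h (\<i> *s x) = \<i> *s h x" for x
  proof -
    have "\<i> *s h x = - (\<i> *s (\<i> *s h (\<i> *s x)))"
      by (subst hx) (rule vec.scale_minus_right)
    then show ?thesis by (simp add: ii_ii)
  qed
  have hc: "h (c *s x) = c *s h x" for c x
  proof -
    have eq: "c *s x = Re c *\<^sub>R x + Im c *\<^sub>R (\<i> *s x)" for x :: "complex^'n"
      by (simp add: scaleR_eq_cscale vec_eq_iff complex_eq_iff)
    show ?thesis
      unfolding eq by (simp only: linear_add[OF linh] linear_scale[OF linh] hi)
  qed
  have "Vector_Spaces.linear (*s) (*s) h"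
    by (simp add: Vector_Spaces.linear_iff vec.vector_space_axioms linear_add[OF linh] hc)
  then have mat: "matrix h *v x = h x" for x by (rule matrix_works)
  then have mat': "(*v) (matrix h) = h" by blast
  then have "positive_semidefinite (matrix h)"
    using h by (simp add: positive_semidefinite_iff)
  moreover have "matrix_power (matrix h) m = B"
    by (rule matrix_eq_cvec) (simp add: matrix_power_mult_vec mat' h(3))
  ultimately show ?thesis by blast
qed

lemma psd_root_spec:
  fixes B :: "complex^'n^'n"
  assumes B: "positive_semidefinite B" and m: "m > 0"
  shows "positive_semidefinite (psd_root m B)" "matrix_power (psd_root m B) m = B"
proof -
  have "\<exists>!C. positive_semidefinite C \<and> matrix_power C m = B"
  proof (rule ex_ex1I[OF psd_root_exists[OF assms]])
    fix C D :: "complex^'n^'n"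
    assume CD: "positive_semidefinite C \<and> matrix_power C m = B"
      "positive_semidefinite D \<and> matrix_power D m = B"
    have "((*v) C) ^^ m = ((*v) D) ^^ m"
    proof
      fix x
      have "(((*v) C) ^^ m) x = B *v x" "(((*v) D) ^^ m) x = B *v x"
        using CD matrix_power_mult_vec[of C m x] matrix_power_mult_vec[of D m x] by auto
      then show "(((*v) C) ^^ m) x = (((*v) D) ^^ m) x" by (rule trans[OF _ sym])
    qed
    moreover have "self_adjoint ((*v) C)" "\<And>x. 0 \<le> x \<bullet> (C *v x)"
      "self_adjoint ((*v) D)" "\<And>x. 0 \<le> x \<bullet> (D *v x)"
      using CD unfolding positive_semidefinite_iff by blast+
    ultimately have "(*v) C = (*v) D"
      using m psd_operator_root_unique[of "(*v) C" "(*v) D" m] by blast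
    then have "C *v x = D *v x" for x by (rule fun_cong)
    then show "C = D" by (rule matrix_eq_cvec)
  qed
  from theI'[OF this] have "positive_semidefinite (psd_root m B) \<and> matrix_power (psd_root m B) m = B"
    unfolding psd_root_def .
  then show "positive_semidefinite (psd_root m B)" "matrix_power (psd_root m B) m = B"
    by auto
qed

lemma gram_inner: "x \<bullet> ((ctranspose P ** P) *v y) = (P *v x) \<bullet> (P *v y)"
proof -
  have "cinner x ((ctranspose P ** P) *v y) = cinner x (ctranspose P *v (P *v y))"
    by (simp add: matrix_vector_mul_assoc)
  also have "\<dots> = cinner (P *v x) (P *v y)"
    using cinner_ctranspose[of "ctranspose P" x "P *v y"] by simp
  finally show ?thesis by (simp flip: Re_cinner)
qed

lemma positive_semidefinite_gram: "positive_semidefinite (ctranspose P ** P)"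
proof -
  have "((ctranspose P ** P) *v x) \<bullet> y = x \<bullet> ((ctranspose P ** P) *v y)" for x y
  proof -
    have "((ctranspose P ** P) *v x) \<bullet> y = (P *v y) \<bullet> (P *v x)"
      using gram_inner[of y P x] by (simp only: inner_commute)
    then show ?thesis using gram_inner[of x P y] by (simp only: inner_commute)
  qed
  then show ?thesis
    unfolding positive_semidefinite_iff self_adjoint_def
    by (simp add: linear_matrix_vector_mult gram_inner)
qed

text \<open>Expand \<open>x\<close> in a real orthonormal eigenbasis of the root. On an eigenvector \<open>b\<close> with eigenvalue \<open>l\<close> one has
  \<open>norm (P b) = l ^ N\<close>. The upper bound then forces the coefficient \<open>x \<bullet> b\<close> to be exponentially small if \<open>l\<close> is
  larger than \<open>exp (m + 2 \<epsilon>)\<close>, and the lower bound with \<open>z = b\<close> does so if \<open>l\<close> is smaller than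
  \<open>exp (m - 2 \<epsilon>)\<close>; for the other eigenvalues \<open>l - exp m\<close> is small.\<close>

lemma psd_root_almost_eigenvector:
  fixes P :: "complex^'n^'n"
  assumes N: "N > 0" and \<epsilon>: "\<epsilon> > 0" and x: "norm x \<le> 1"
    and upper: "norm (P *v x) \<le> exp (real N * (m + \<epsilon>))"
    and lower: "\<And>z. norm (cinner x z) \<le> exp (- (real N * (m - \<epsilon>))) * norm (P *v z)"
  shows "norm (psd_root (2 * N) (ctranspose P ** P) *v x - exp m *\<^sub>R x)
    \<le> real DIM(complex^'n) * (exp (m + 2 * \<epsilon>) * exp (- (real N * \<epsilon>)) + (exp (m + 2 * \<epsilon>) - exp (m - 2 * \<epsilon>)))"
    (is "?lhs \<le> _ * ?bound")
proof -
  define C where "C = psd_root (2 * N) (ctranspose P ** P)"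
  have C: "positive_semidefinite C" "matrix_power C (2 * N) = ctranspose P ** P"
    unfolding C_def using psd_root_spec[OF positive_semidefinite_gram[of P], of "2 * N"] N
    by (simp_all only: nat_0_less_mult_iff zero_less_numeral simp_thms)
  then have sa: "self_adjoint ((*v) C)" and pos: "\<And>x. 0 \<le> x \<bullet> (C *v x)"
    unfolding positive_semidefinite_iff by blast+
  have lin: "linear ((*v) C)" by (rule linear_matrix_vector_mult)
  obtain B l where "eigenbasis ((*v) C) B l" by (rule self_adjoint_eigenbasis[OF sa])
  then have fin: "finite B" and card: "card B = DIM(complex^'n)"
    and B: "pairwise orthogonal B" "\<And>b. b \<in> B \<Longrightarrow> norm b = 1" "span B = UNIV"
    and l: "\<And>b. b \<in> B \<Longrightarrow> C *v b = l b *\<^sub>R b"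
    unfolding eigenbasis_def by blast+
  have l0: "l b \<ge> 0" if "b \<in> B" for b
    using pos[of b] l[OF that] B(2)[OF that] by (simp add: dot_square_norm)
  have expand: "(\<Sum>b\<in>B. (y \<bullet> b) *\<^sub>R b) = y" for y
    using orthonormal_basis_expand[OF B(1,2) _ fin] B(3) by auto
  have "C *v x - exp m *\<^sub>R x = (\<Sum>b\<in>B. ((l b - exp m) * (x \<bullet> b)) *\<^sub>R b)"
  proof -
    have "(C *v x) \<bullet> b = l b * (x \<bullet> b)" if "b \<in> B" for b
      using sa l[OF that] by (simp add: self_adjoint_def)
    then have "(\<Sum>b\<in>B. ((l b - exp m) * (x \<bullet> b)) *\<^sub>R b) = (\<Sum>b\<in>B. ((C *v x - exp m *\<^sub>R x) \<bullet> b) *\<^sub>R b)"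
      by (intro sum.cong) (auto simp: inner_diff_left algebra_simps)
    then show ?thesis by (simp add: expand)
  qed
  then have "?lhs \<le> (\<Sum>b\<in>B. norm (((l b - exp m) * (x \<bullet> b)) *\<^sub>R b))"
    by (simp only: C_def[symmetric] norm_sum)
  also have "\<dots> \<le> (\<Sum>b\<in>B. ?bound)"
  proof (rule sum_mono)
    fix b assume b: "b \<in> B"
    let ?s = "\<bar>x \<bullet> b\<bar>"
    have Bb: "(ctranspose P ** P) *v b = l b ^ (2 * N) *\<^sub>R b"
      using funpow_eigenvector[OF lin l[OF b], of "2 * N"] C(2) by (metis matrix_power_mult_vec)
    have "(norm (P *v b))\<^sup>2 = (l b ^ N)\<^sup>2"
      using gram_inner[of b P b] B(2)[OF b]
      by (simp add: Bb dot_square_norm power_mult[symmetric] mult.commute)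
    then have Pb: "norm (P *v b) = l b ^ N"
      using l0[OF b] by (simp add: power2_eq_iff_nonneg)
    have up: "?s * l b ^ N \<le> exp (real N * (m + \<epsilon>))" if "l b > 0"
    proof -
      have "?s * l b ^ (2 * N) = \<bar>(P *v x) \<bullet> (P *v b)\<bar>"
        using l0[OF b] by (simp add: Bb abs_mult flip: gram_inner)
      also have "\<dots> \<le> norm (P *v x) * norm (P *v b)" by (rule Cauchy_Schwarz_ineq2)
      finally have "?s * l b ^ N * l b ^ N \<le> norm (P *v x) * l b ^ N"
        by (simp add: Pb power_add mult_2 mult.assoc)
      then have "?s * l b ^ N \<le> norm (P *v x)" using that by (simp add: mult_le_cancel_right)
      then show ?thesis using upper by simp
    qed
    have lo: "?s \<le> exp (- (real N * (m - \<epsilon>))) * l b ^ N"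
      using lower[of b] abs_Re_le_cmod[of "cinner x b"] by (simp add: Re_cinner Pb)
    have s1: "?s \<le> 1" using Cauchy_Schwarz_ineq2[of x b] x B(2)[OF b] by simp
    have diff: "exp (m + 2 * \<epsilon>) - exp (m - 2 * \<epsilon>) \<ge> 0" using \<epsilon> by simp
    have "\<bar>l b - exp m\<bar> * ?s \<le> ?bound"
    proof -
      consider "l b \<ge> exp (m + 2 * \<epsilon>)" | "l b \<le> exp (m - 2 * \<epsilon>)" |
        "exp (m - 2 * \<epsilon>) < l b" "l b < exp (m + 2 * \<epsilon>)" by linarith
      then show ?thesis
      proof cases
        case 1
        have lpos: "l b > 0" using 1 by (meson exp_gt_zero less_le_trans)
        have ge: "exp m \<le> l b" using 1 \<epsilon> exp_le_cancel_iff[of m "m + 2 * \<epsilon>"] by linarith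
        \<comment> \<open>one power of the eigenvalue is spent on the factor \<open>l b\<close> itself\<close>
        obtain K where K: "N = Suc K" using N by (cases N) auto
        have "\<bar>l b - exp m\<bar> * ?s \<le> l b * ?s" using ge by (intro mult_right_mono) auto
        also have "\<dots> = (?s * l b ^ N) / l b ^ K"
          using lpos by (simp add: K)
        also have "\<dots> \<le> exp (real N * (m + \<epsilon>)) / exp (m + 2 * \<epsilon>) ^ K"
          using up[OF lpos] lpos 1 by (intro frac_le power_mono zero_less_power) auto
        also have "\<dots> = exp (m + 2 * \<epsilon>) * exp (- (real N * \<epsilon>))"
          by (simp add: K flip: exp_of_nat_mult exp_add exp_diff) (simp add: algebra_simps)
        finally show ?thesis using diff by linarith
      next
        case 2
        have le: "l b \<le> exp m" using 2 \<epsilon> exp_le_cancel_iff[of "m - 2 * \<epsilon>" m] by linarith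
        have "\<bar>l b - exp m\<bar> * ?s \<le> exp m * (exp (- (real N * (m - \<epsilon>))) * l b ^ N)"
          using le l0[OF b] lo by (intro mult_mono) auto
        also have "\<dots> \<le> exp m * (exp (- (real N * (m - \<epsilon>))) * exp (m - 2 * \<epsilon>) ^ N)"
          using 2 l0[OF b] by (intro mult_left_mono power_mono) auto
        also have "\<dots> = exp m * exp (- (real N * \<epsilon>))"
          by (simp flip: exp_of_nat_mult exp_add) (simp add: algebra_simps)
        also have "\<dots> \<le> exp (m + 2 * \<epsilon>) * exp (- (real N * \<epsilon>))" using \<epsilon> by simp
        finally show ?thesis using diff by linarith
      next
        case 3
        have "exp m \<le> exp (m + 2 * \<epsilon>)" "exp (m - 2 * \<epsilon>) \<le> exp m" using \<epsilon> by auto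
        then have "\<bar>l b - exp m\<bar> \<le> exp (m + 2 * \<epsilon>) - exp (m - 2 * \<epsilon>)" using 3 by linarith
        then have "\<bar>l b - exp m\<bar> * ?s \<le> (exp (m + 2 * \<epsilon>) - exp (m - 2 * \<epsilon>)) * 1"
          using s1 diff by (intro mult_mono) auto
        then show ?thesis by (simp add: add_increasing)
      qed
    qed
    then show "norm (((l b - exp m) * (x \<bullet> b)) *\<^sub>R b) \<le> ?bound"
      using B(2)[OF b] by (simp add: abs_mult)
  qed
  also have "\<dots> = real DIM(complex^'n) * ?bound" by (simp only: sum_constant card)
  finally show ?thesis .
qed

section \<open>Exponential growth rates\<close>

text \<open>An upper bound \<open>a\<close> for the exponential growth rate: \<open>f N\<close> is at most \<open>exp (N (a + o(1)))\<close>.\<close>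

definition growth_le :: "(nat \<Rightarrow> real) \<Rightarrow> real \<Rightarrow> bool" where
  "growth_le f a \<longleftrightarrow> (\<forall>\<epsilon>>0. \<forall>\<^sub>F N in sequentially. f N \<le> exp (real N * (a + \<epsilon>)))"

lemma growth_le_mono: "growth_le f a \<Longrightarrow> a \<le> b \<Longrightarrow> growth_le f b"
  unfolding growth_le_def
  by (elim all_forward imp_forward eventually_mono)
    (auto elim!: order_trans intro!: mult_left_mono)

lemma growth_le_dominated:
  assumes "growth_le h a" "\<And>N. f N \<le> h N"
  shows "growth_le f a"
  unfolding growth_le_def
proof (intro allI impI)
  fix \<epsilon> :: real assume "\<epsilon> > 0"
  then have "\<forall>\<^sub>F N in sequentially. h N \<le> exp (real N * (a + \<epsilon>))"
    using assms(1) by (simp add: growth_le_def)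
  then show "\<forall>\<^sub>F N in sequentially. f N \<le> exp (real N * (a + \<epsilon>))"
    by (rule eventually_mono) (rule order_trans[OF assms(2)])
qed

lemma eventually_const_le_exp:
  assumes "\<epsilon> > 0"
  shows "\<forall>\<^sub>F N in sequentially. K \<le> exp (real N * \<epsilon>)"
proof -
  obtain n where n: "K / \<epsilon> < real n" using reals_Archimedean2 by blast
  have "K \<le> exp (real N * \<epsilon>)" if "N \<ge> n" for N
  proof -
    have "K / \<epsilon> \<le> real N" using n that by linarith
    then have "K \<le> real N * \<epsilon>" using assms by (simp add: field_simps)
    then show ?thesis using exp_ge_add_one_self[of "real N * \<epsilon>"] by linarith
  qed
  then show ?thesis unfolding eventually_sequentially by blast
qed

lemma growth_le_mult_bounded:
  assumes f: "growth_le f a" "\<And>N. 0 \<le> f N" and c: "\<forall>\<^sub>F N in sequentially. c N \<le> K"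
  shows "growth_le (\<lambda>N. c N * f N) a"
  unfolding growth_le_def
proof (intro allI impI)
  fix \<epsilon> :: real assume \<epsilon>: "\<epsilon> > 0"
  have "\<forall>\<^sub>F N in sequentially. f N \<le> exp (real N * (a + \<epsilon> / 2))"
    using f(1) \<epsilon> by (simp add: growth_le_def)
  moreover have "\<forall>\<^sub>F N in sequentially. K \<le> exp (real N * (\<epsilon> / 2))"
    using \<epsilon> by (intro eventually_const_le_exp) simp
  ultimately show "\<forall>\<^sub>F N in sequentially. c N * f N \<le> exp (real N * (a + \<epsilon>))"
    using c
  proof eventually_elim
    case (elim N)
    have "c N * f N \<le> exp (real N * (\<epsilon> / 2)) * f N"
      using elim f(2) by (intro mult_right_mono) auto
    also have "\<dots> \<le> exp (real N * (\<epsilon> / 2)) * exp (real N * (a + \<epsilon> / 2))"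
      using elim by (intro mult_left_mono) auto
    also have "\<dots> = exp (real N * (a + \<epsilon>))"
      by (simp add: algebra_simps flip: exp_add)
    finally show ?case .
  qed
qed

lemma growth_le_mult_convergent:
  assumes "growth_le f a" "\<And>N. 0 \<le> f N" and "(c \<longlongrightarrow> l) sequentially"
  shows "growth_le (\<lambda>N. c N * f N) a"
proof (rule growth_le_mult_bounded[OF assms(1,2)])
  show "\<forall>\<^sub>F N in sequentially. c N \<le> l + 1"
    using order_tendstoD(2)[OF assms(3), of "l + 1"] by (auto elim: eventually_mono)
qed

lemma growth_le_sum:
  assumes "finite I" "\<And>i. i \<in> I \<Longrightarrow> growth_le (f i) a"
  shows "growth_le (\<lambda>N. \<Sum>i\<in>I. f i N) a"
  unfolding growth_le_def
proof (intro allI impI)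
  fix \<epsilon> :: real assume \<epsilon>: "\<epsilon> > 0"
  have "\<forall>\<^sub>F N in sequentially. \<forall>i\<in>I. f i N \<le> exp (real N * (a + \<epsilon> / 2))"
    using assms \<epsilon> by (intro eventually_ball_finite) (auto simp: growth_le_def)
  moreover have "\<forall>\<^sub>F N in sequentially. real (card I) \<le> exp (real N * (\<epsilon> / 2))"
    using \<epsilon> by (intro eventually_const_le_exp) simp
  ultimately show "\<forall>\<^sub>F N in sequentially. (\<Sum>i\<in>I. f i N) \<le> exp (real N * (a + \<epsilon>))"
  proof eventually_elim
    case (elim N)
    have "(\<Sum>i\<in>I. f i N) \<le> real (card I) * exp (real N * (a + \<epsilon> / 2))"
      using elim by (intro sum_bounded_above) auto
    also have "\<dots> \<le> exp (real N * (\<epsilon> / 2)) * exp (real N * (a + \<epsilon> / 2))"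
      using elim by (intro mult_right_mono) auto
    also have "\<dots> = exp (real N * (a + \<epsilon>))"
      by (simp add: algebra_simps flip: exp_add)
    finally show ?case .
  qed
qed

lemma growth_le_add:
  assumes "growth_le f a" "growth_le h a"
  shows "growth_le (\<lambda>N. f N + h N) a"
  using growth_le_sum[of "UNIV :: bool set" "\<lambda>b. if b then f else h" a] assms
  by (simp add: UNIV_bool add.commute split: if_splits)

text \<open>The total length satisfies a discrete Gronwall inequality, so it stays bounded, and the increments
  become absolutely summable.\<close>

lemma convergent_of_summable_relative_increments:
  fixes x :: "nat \<Rightarrow> nat \<Rightarrow> 'a::banach"
  assumes inc: "\<And>N i. i < d \<Longrightarrow> norm (x (Suc N) i - x N i) \<le> \<eta> N * (\<Sum>k<d. norm (x N k))"
    and \<eta>: "summable \<eta>" "\<And>N. 0 \<le> \<eta> N" and i: "i < d"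
  shows "convergent (\<lambda>N. x N i)"
proof -
  define s where "s N = (\<Sum>k<d. norm (x N k))" for N
  have s0: "s N \<ge> 0" for N by (simp add: s_def sum_nonneg)
  have step: "s (Suc N) \<le> exp (real d * \<eta> N) * s N" for N
  proof -
    have "s (Suc N) \<le> (\<Sum>k<d. norm (x N k) + \<eta> N * s N)"
      unfolding s_def
    proof (rule sum_mono)
      fix k assume "k \<in> {..<d}"
      then show "norm (x (Suc N) k) \<le> norm (x N k) + \<eta> N * (\<Sum>k<d. norm (x N k))"
        using inc[of k N] norm_triangle_sub[of "x (Suc N) k" "x N k"] by simp
    qed
    also have "\<dots> = (1 + real d * \<eta> N) * s N"
      by (simp add: sum.distrib s_def algebra_simps)
    also have "\<dots> \<le> exp (real d * \<eta> N) * s N"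
      by (intro mult_right_mono exp_ge_add_one_self s0)
    finally show ?thesis .
  qed
  have bound: "s N \<le> exp (real d * (\<Sum>n<N. \<eta> n)) * s 0" for N
  proof (induction N)
    case (Suc N)
    have "s (Suc N) \<le> exp (real d * \<eta> N) * (exp (real d * (\<Sum>n<N. \<eta> n)) * s 0)"
      using step[of N] Suc by (meson exp_ge_zero mult_left_mono order_trans)
    then show ?case by (simp add: algebra_simps exp_add)
  qed simp
  define K where "K = exp (real d * suminf \<eta>) * s 0"
  have K: "s N \<le> K" for N
  proof -
    have "(\<Sum>n<N. \<eta> n) \<le> suminf \<eta>" using \<eta> by (intro sum_le_suminf) auto
    then have "exp (real d * (\<Sum>n<N. \<eta> n)) * s 0 \<le> K"
      unfolding K_def using s0 by (intro mult_right_mono) (auto intro: mult_left_mono)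
    then show ?thesis using bound[of N] by linarith
  qed
  have "summable (\<lambda>N. x (Suc N) i - x N i)"
  proof (rule summable_comparison_test'[of "\<lambda>N. \<eta> N * K" 0])
    show "summable (\<lambda>N. \<eta> N * K)" using \<eta>(1) by (rule summable_mult2)
    show "norm (x (Suc N) i - x N i) \<le> \<eta> N * K" for N
      using inc[OF i, of N] mult_left_mono[OF K[of N] \<eta>(2)[of N]] by (simp add: s_def)
  qed
  then have "convergent (\<lambda>N. \<Sum>n<N. x (Suc n) i - x n i)"
    by (simp add: summable_iff_convergent)
  then have "convergent (\<lambda>N. x N i - x 0 i)"
    by (simp only: sum_lessThan_telescope[of "\<lambda>n. x n i"])
  then show ?thesis by (simp add: convergent_diff_const_right_iff)
qed

lemma norm_projection_coeff_le:
  "norm (cinner u v / of_real ((norm u)\<^sup>2)) \<le> norm v * inverse (norm u)"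
proof (cases "u = 0")
  case False
  have "norm (cinner u v / of_real ((norm u)\<^sup>2)) = norm (cinner u v) / (norm u)\<^sup>2"
    by (simp add: norm_divide norm_power)
  also have "\<dots> \<le> (norm u * norm v) / (norm u)\<^sup>2"
    by (intro divide_right_mono norm_cinner_le) simp
  also have "\<dots> = norm v * inverse (norm u)"
    using False by (simp add: power2_eq_square field_simps)
  finally show ?thesis .
qed simp

section \<open>Convergence of the roots for a product with separated growth rates\<close>

text \<open>The index type carries no order, so the enumeration \<open>e\<close> supplies the order in which the columns are
  orthogonalised.\<close>

definition frame :: "(nat \<Rightarrow> complex^'n^'n) \<Rightarrow> (nat \<Rightarrow> 'n) \<Rightarrow> nat \<Rightarrow> nat \<Rightarrow> complex^'n" where
  "frame A e N = gram_schmidt (\<lambda>j. matrix_product A N *v axis (e j) 1)"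

text \<open>The two growth conditions fix the eigenvalues of the limit. The strict separation of the rates, against
  factors of subexponential size, is what makes the dual vectors converge.\<close>

locale separated_growth =
  fixes A :: "nat \<Rightarrow> complex^'n^'n" and e :: "nat \<Rightarrow> 'n" and m :: "nat \<Rightarrow> real"
  assumes e: "bij_betw e {..<CARD('n)} UNIV"
    and frame_nonzero: "\<And>N j. j < CARD('n) \<Longrightarrow> frame A e N j \<noteq> 0"
    and frame_growth: "\<And>j. j < CARD('n) \<Longrightarrow> growth_le (\<lambda>N. norm (frame A e N j)) (m j)"
    and frame_decay: "\<And>j. j < CARD('n) \<Longrightarrow> growth_le (\<lambda>N. inverse (norm (frame A e N j))) (- m j)"
    and m_less: "\<And>i j. i < j \<Longrightarrow> j < CARD('n) \<Longrightarrow> m j < m i"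
    and factor_bound: "\<And>\<epsilon>. \<epsilon> > 0 \<Longrightarrow> \<forall>\<^sub>F N in sequentially. \<forall>x. norm (A N *v x) \<le> exp (real N * \<epsilon>) * norm x"
begin

abbreviation "P \<equiv> matrix_product A"
abbreviation "g \<equiv> frame A e"

definition p :: "nat \<Rightarrow> nat \<Rightarrow> complex^'n" where "p N j = P N *v axis (e j) 1"

lemma frame_eq_gram_schmidt: "g N = gram_schmidt (p N)"
  by (simp add: frame_def p_def[abs_def])

lemma p_Suc: "p (Suc N) j = A (Suc N) *v p N j"
  by (simp add: p_def matrix_vector_mul_assoc)

text \<open>The coefficient functionals of \<open>P N\<close> with respect to the frame, represented as vectors.\<close>

definition dual :: "nat \<Rightarrow> nat \<Rightarrow> complex^'n" where
  "dual N i = (1 / of_real ((norm (g N i))\<^sup>2)) *s (ctranspose (P N) *v g N i)"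

lemma cinner_dual: "cinner (dual N i) x = cinner (g N i) (P N *v x) / of_real ((norm (g N i))\<^sup>2)"
  by (simp add: dual_def cinner_scale_left cinner_ctranspose)

lemma P_expansion: "P N *v x = (\<Sum>i<CARD('n). cinner (dual N i) x *s g N i)"
  using orthogonal_expansion[of "g N" "P N *v x"] frame_nonzero
  by (simp add: cinner_dual frame_eq_gram_schmidt gram_schmidt_orthogonal)

text \<open>The matrix of the factor \<open>A (Suc N)\<close> with respect to the frames at times \<open>N\<close> and \<open>Suc N\<close>. The lengths of the
  frame vectors are not normalised away, which makes the diagonal equal to one.\<close>

definition shear :: "nat \<Rightarrow> nat \<Rightarrow> nat \<Rightarrow> complex" where
  "shear N i k = cinner (g (Suc N) i) (A (Suc N) *v g N k) / of_real ((norm (g (Suc N) i))\<^sup>2)"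

lemma shear_upper_unitriangular:
  assumes "k \<le> i" "i < CARD('n)"
  shows "shear N i k = (if k = i then 1 else 0)"
proof -
  let ?S = "\<lambda>j. vec.span (p (Suc N) ` {..<j})"
  have "p N k - g N k \<in> vec.span (p N ` {..<k})"
    unfolding frame_eq_gram_schmidt by (rule gram_schmidt_minus_in_span)
  then have "A (Suc N) *v (p N k - g N k) \<in> vec.span ((*v) (A (Suc N)) ` p N ` {..<k})"
    unfolding vec.span_image by blast
  moreover have "(*v) (A (Suc N)) ` p N ` {..<k} = p (Suc N) ` {..<k}"
    by (simp add: image_image p_Suc)
  ultimately have "A (Suc N) *v (p N k - g N k) \<in> ?S k" by simp
  then have in_span: "A (Suc N) *v (p N k - g N k) \<in> ?S i"
    using span_below_mono[OF assms(1)] by blast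
  have "cinner (g (Suc N) i) (A (Suc N) *v g N k)
      = cinner (g (Suc N) i) (p (Suc N) k) - cinner (g (Suc N) i) (A (Suc N) *v (p N k - g N k))"
    by (simp add: p_Suc matrix_vector_mult_diff_distrib flip: cinner_diff_right)
  also have "cinner (g (Suc N) i) (A (Suc N) *v (p N k - g N k)) = 0"
    using cinner_gram_schmidt_span[OF in_span] by (simp add: frame_eq_gram_schmidt)
  also have "cinner (g (Suc N) i) (p (Suc N) k) = (if k = i then of_real ((norm (g (Suc N) i))\<^sup>2) else 0)"
    using assms cinner_gram_schmidt_span[OF in_span_below[of k i "p (Suc N)"]] by (auto simp: frame_eq_gram_schmidt cinner_gram_schmidt_self)
  finally show ?thesis using frame_nonzero[OF assms(2), of "Suc N"] by (simp add: shear_def)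
qed

lemma dual_Suc:
  assumes i: "i < CARD('n)"
  shows "dual (Suc N) i - dual N i = (\<Sum>k\<in>{i<..<CARD('n)}. cnj (shear N i k) *s dual N k)"
proof (rule cinner_ext)
  fix x
  have "cinner (dual (Suc N) i) x = cinner (g (Suc N) i) (A (Suc N) *v (P N *v x)) / of_real ((norm (g (Suc N) i))\<^sup>2)"
    by (simp add: cinner_dual matrix_vector_mul_assoc)
  also have "A (Suc N) *v (P N *v x) = (\<Sum>k<CARD('n). cinner (dual N k) x *s (A (Suc N) *v g N k))"
    by (simp add: P_expansion[of N x] vec.sum vec.scale)
  finally have "cinner (dual (Suc N) i) x = (\<Sum>k<CARD('n). cinner (dual N k) x * shear N i k)"
    by (simp add: cinner_sum_right cinner_scale_right sum_divide_distrib shear_def)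
  also have "{..<CARD('n)} = {..<i} \<union> insert i {i<..<CARD('n)}" using i by auto
  also have "(\<Sum>k\<in>\<dots>. cinner (dual N k) x * shear N i k) = cinner (dual N i) x + (\<Sum>k\<in>{i<..<CARD('n)}. cinner (dual N k) x * shear N i k)"
    using i by (subst sum.union_disjoint) (auto simp: shear_upper_unitriangular)
  finally show "cinner (dual (Suc N) i - dual N i) x = cinner (\<Sum>k\<in>{i<..<CARD('n)}. cnj (shear N i k) *s dual N k) x"
    by (simp add: cinner_diff_left cinner_sum_left cinner_scale_left mult.commute)
qed

lemma norm_shear_le: "norm (shear N i k) \<le> norm (A (Suc N) *v g N k) * inverse (norm (g (Suc N) i))"
  unfolding shear_def by (rule norm_projection_coeff_le)

text \<open>The ratio of a frame vector of rate \<open>m k\<close> to one of the larger rate \<open>m i\<close> decays exponentially. A quarter of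
  the gap is lost to each of the three error terms, which leaves a quarter for the decay.\<close>

lemma summable_shear:
  assumes "i < k" "k < CARD('n)"
  shows "summable (\<lambda>N. norm (shear N i k))"
proof -
  define \<epsilon> where "\<epsilon> = (m i - m k) / 4"
  have \<epsilon>: "\<epsilon> > 0" using m_less[OF assms] by (simp add: \<epsilon>_def)
  have "\<forall>\<^sub>F N in sequentially. norm (shear N i k) \<le> exp (2 * \<epsilon> - m i) * exp (- \<epsilon>) ^ N"
  proof -
    have "\<forall>\<^sub>F N in sequentially. norm (g N k) \<le> exp (real N * (m k + \<epsilon>))"
      using frame_growth[OF assms(2)] \<epsilon> by (simp add: growth_le_def)
    moreover have "\<forall>\<^sub>F N in sequentially. inverse (norm (g (Suc N) i)) \<le> exp (real (Suc N) * (- m i + \<epsilon>))"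
      using frame_decay[of i] assms \<epsilon> unfolding growth_le_def
      by (subst eventually_sequentially_Suc) simp
    moreover have "\<forall>\<^sub>F N in sequentially. \<forall>x. norm (A (Suc N) *v x) \<le> exp (real (Suc N) * \<epsilon>) * norm x"
      using factor_bound[OF \<epsilon>] by (subst eventually_sequentially_Suc)
    ultimately show ?thesis
    proof eventually_elim
      case (elim N)
      have "norm (shear N i k) \<le> norm (A (Suc N) *v g N k) * inverse (norm (g (Suc N) i))"
        by (rule norm_shear_le)
      also have "\<dots> \<le> (exp (real (Suc N) * \<epsilon>) * exp (real N * (m k + \<epsilon>))) * exp (real (Suc N) * (- m i + \<epsilon>))"
      proof (rule mult_mono)
        have "norm (A (Suc N) *v g N k) \<le> exp (real (Suc N) * \<epsilon>) * norm (g N k)"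
          using elim by blast
        also have "\<dots> \<le> exp (real (Suc N) * \<epsilon>) * exp (real N * (m k + \<epsilon>))"
          using elim by (intro mult_left_mono) auto
        finally show "norm (A (Suc N) *v g N k) \<le> \<dots>" .
      qed (use elim in auto)
      also have "\<dots> = exp (real (Suc N) * \<epsilon> + real N * (m k + \<epsilon>) + real (Suc N) * (- m i + \<epsilon>))"
        by (simp only: exp_add)
      also have "real (Suc N) * \<epsilon> + real N * (m k + \<epsilon>) + real (Suc N) * (- m i + \<epsilon>)
          = (2 * \<epsilon> - m i) + real N * (- \<epsilon>)"
        by (simp add: \<epsilon>_def field_simps)
      also have "exp \<dots> = exp (2 * \<epsilon> - m i) * exp (- \<epsilon>) ^ N"
        by (simp only: exp_add exp_of_nat_mult)
      finally show ?case .
    qed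
  qed
  then have ev: "\<forall>\<^sub>F N in sequentially. norm (norm (shear N i k)) \<le> exp (2 * \<epsilon> - m i) * exp (- \<epsilon>) ^ N"
    by simp
  have "summable (\<lambda>N. exp (2 * \<epsilon> - m i) * exp (- \<epsilon>) ^ N)"
    using \<epsilon> by (intro summable_mult summable_geometric) simp
  with ev show ?thesis by (rule summable_comparison_test_ev)
qed

lemma convergent_dual:
  assumes i: "i < CARD('n)"
  shows "convergent (\<lambda>N. dual N i)"
proof (rule convergent_of_summable_relative_increments[where x = dual and d = "CARD('n)", OF _ _ _ i])
  define \<eta> where "\<eta> N = (\<Sum>i<CARD('n). \<Sum>k\<in>{i<..<CARD('n)}. norm (shear N i k))" for N
  show "summable \<eta>"
    unfolding \<eta>_def by (intro summable_sum summable_shear) auto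
  show "0 \<le> \<eta> N" for N by (simp add: \<eta>_def sum_nonneg)
  fix N i assume i: "i < CARD('n)"
  have "norm (dual (Suc N) i - dual N i) \<le> (\<Sum>k\<in>{i<..<CARD('n)}. norm (shear N i k) * norm (dual N k))"
    unfolding dual_Suc[OF i] by (rule order_trans[OF norm_sum]) (simp add: norm_cscale)
  also have "\<dots> \<le> (\<Sum>k\<in>{i<..<CARD('n)}. norm (shear N i k) * (\<Sum>k<CARD('n). norm (dual N k)))"
    by (intro sum_mono mult_left_mono member_le_sum) auto
  also have "\<dots> = (\<Sum>k\<in>{i<..<CARD('n)}. norm (shear N i k)) * (\<Sum>k<CARD('n). norm (dual N k))"
    by (simp add: sum_distrib_right)
  also have "\<dots> \<le> \<eta> N * (\<Sum>k<CARD('n). norm (dual N k))"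
    unfolding \<eta>_def using i
    by (intro mult_right_mono member_le_sum[of i "{..<CARD('n)}" "\<lambda>i. \<Sum>k\<in>{i<..<CARD('n)}. norm (shear N i k)"]) (auto intro: sum_nonneg)
  finally show "norm (dual (Suc N) i - dual N i) \<le> \<eta> N * (\<Sum>k<CARD('n). norm (dual N k))" .
qed

definition dual_lim :: "nat \<Rightarrow> complex^'n" where "dual_lim i = lim (\<lambda>N. dual N i)"

lemma tendsto_dual: "i < CARD('n) \<Longrightarrow> (\<lambda>N. dual N i) \<longlonglongrightarrow> dual_lim i"
  using convergent_dual unfolding dual_lim_def convergent_LIMSEQ_iff by blast

lemma dual_lim_nth:
  assumes "j \<le> i" "i < CARD('n)"
  shows "dual_lim i $ e j = (if j = i then 1 else 0)"
proof (rule LIMSEQ_unique)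
  show "(\<lambda>N. dual N i $ e j) \<longlonglongrightarrow> dual_lim i $ e j"
    by (intro tendsto_vec_nth tendsto_dual assms)
  have "cnj (dual N i $ e j) = (if j = i then 1 else 0)" for N
  proof -
    have "cnj (dual N i $ e j) = cinner (g N i) (p N j) / of_real ((norm (g N i))\<^sup>2)"
      using cinner_dual[of N i "axis (e j) 1"] by (simp add: p_def)
    then show ?thesis
      using assms cinner_gram_schmidt_span[OF in_span_below[of j i "p N"]] frame_nonzero[of i N]
      by (auto simp: frame_eq_gram_schmidt cinner_gram_schmidt_self)
  qed
  then have "dual N i $ e j = (if j = i then 1 else 0)" for N
    by (metis complex_cnj_cnj complex_cnj_one complex_cnj_zero)
  then show "(\<lambda>N. dual N i $ e j) \<longlonglongrightarrow> (if j = i then 1 else 0)" by simp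
qed

text \<open>In the coordinates given by \<open>e\<close> the limits of the dual vectors form a unitriangular array. A linear
  relation for \<open>dual_lim j\<close> in terms of its predecessors can be stripped of \<open>dual_lim 0, dual_lim 1, \<dots>\<close> in turn by looking
  at one coordinate at a time.\<close>

lemma gram_schmidt_dual_lim_nonzero:
  assumes j: "j < CARD('n)"
  shows "gram_schmidt dual_lim j \<noteq> 0"
proof
  assume "gram_schmidt dual_lim j = 0"
  then have "dual_lim j \<in> vec.span (dual_lim ` {..<j})"
    using gram_schmidt_minus_in_span[of dual_lim j] by simp
  moreover have "dual_lim j \<in> vec.span (dual_lim ` {k..<j})" if "k \<le> j" "dual_lim j \<in> vec.span (dual_lim ` {..<j})" for k
    using that
  proof (induction k)
    case 0
    then show ?case by (simp add: atLeast0LessThan)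
  next
    case (Suc k)
    then have "dual_lim j \<in> vec.span (dual_lim ` {k..<j})" by simp
    then obtain c where c: "dual_lim j - c *s dual_lim k \<in> vec.span (dual_lim ` {k..<j} - {dual_lim k})"
      using vec.span_breakdown[of "dual_lim k" "dual_lim ` {k..<j}" "dual_lim j"] Suc.prems by auto
    moreover have "dual_lim ` {k..<j} - {dual_lim k} \<subseteq> dual_lim ` {Suc k..<j}"
      by (auto simp: image_iff) (metis Suc_leI atLeastLessThan_iff le_neq_implies_less)
    ultimately have *: "dual_lim j - c *s dual_lim k \<in> vec.span (dual_lim ` {Suc k..<j})"
      using vec.span_mono by blast
    have "y $ e k = 0" if "y \<in> vec.span (dual_lim ` {Suc k..<j})" for y
      using that
    proof (induction rule: vec.span_induct_alt)
      case (step c x y)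
      then obtain i where "x = dual_lim i" "Suc k \<le> i" "i < j" by auto
      then show ?case using step dual_lim_nth[of k i] j by simp
    qed simp
    from this[OF *] have "c = 0"
      using dual_lim_nth[of k j] dual_lim_nth[of k k] j Suc.prems by simp
    then show ?case using * by simp
  qed
  ultimately have "dual_lim j = 0" by (metis atLeastLessThan_empty image_empty order_refl vec.span_empty singletonD)
  then show False using dual_lim_nth[of j j] j by simp
qed

definition w :: "nat \<Rightarrow> nat \<Rightarrow> complex^'n" where "w N = gram_schmidt (dual N)"
definition w_lim :: "nat \<Rightarrow> complex^'n" where "w_lim = gram_schmidt dual_lim"

lemma w_lim_nonzero: "j < CARD('n) \<Longrightarrow> w_lim j \<noteq> 0"
  by (simp add: w_lim_def gram_schmidt_dual_lim_nonzero)

lemma tendsto_w: "j < CARD('n) \<Longrightarrow> (\<lambda>N. w N j) \<longlonglongrightarrow> w_lim j"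
  unfolding w_def w_lim_def by (intro tendsto_gram_schmidt tendsto_dual gram_schmidt_dual_lim_nonzero) auto

text \<open>The vector \<open>w N j\<close> is orthogonal to \<open>dual N i\<close> for \<open>i < j\<close>, so only frame vectors of rate at most \<open>m j\<close> contribute
  to \<open>P N *v w N j\<close>.\<close>

lemma growth_P_w:
  assumes j: "j < CARD('n)"
  shows "growth_le (\<lambda>N. norm (P N *v w N j)) (m j)"
proof -
  have "growth_le (\<lambda>N. norm (cinner (dual N i) (w N j)) * norm (g N i)) (m j)" if i: "i < CARD('n)" for i
  proof (cases "i < j")
    case True
    have "cinner (dual N i) (w N j) = 0" for N
      using cinner_gram_schmidt_span[OF in_span_below[OF True]] cinner_eq_0_commute unfolding w_def by blast
    then show ?thesis by (simp add: growth_le_def)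
  next
    case False
    then have "m i \<le> m j" using m_less[of j i] i by (cases "i = j") auto
    then have growth: "growth_le (\<lambda>N. norm (g N i)) (m j)"
      using frame_growth[OF i] growth_le_mono by blast
    have "(\<lambda>N. norm (cinner (dual N i) (w N j))) \<longlonglongrightarrow> norm (cinner (dual_lim i) (w_lim j))"
      by (intro tendsto_intros tendsto_dual tendsto_w i j)
    from growth_le_mult_convergent[OF growth _ this] show ?thesis by simp
  qed
  then have "growth_le (\<lambda>N. \<Sum>i<CARD('n). norm (cinner (dual N i) (w N j)) * norm (g N i)) (m j)"
    by (rule growth_le_sum[rotated]) auto
  moreover have "norm (P N *v w N j) \<le> (\<Sum>i<CARD('n). norm (cinner (dual N i) (w N j)) * norm (g N i))" for N
    unfolding P_expansion[of N "w N j"] by (rule order_trans[OF norm_sum]) (simp add: norm_cscale)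
  ultimately show ?thesis by (rule growth_le_dominated)
qed

text \<open>The vector \<open>w N j\<close> is a combination with bounded coefficients of \<open>dual N i\<close> for \<open>i \<le> j\<close>. Each of these
  functionals reads off the \<open>i\<close>-th frame coordinate of \<open>P N *v z\<close>, which costs the inverse length of a frame vector of
  rate at least \<open>m j\<close>.\<close>

lemma w_dual_bound:
  assumes "j < CARD('n)"
  shows "\<exists>\<kappa>. growth_le \<kappa> (- m j) \<and> (\<forall>N. 0 \<le> \<kappa> N) \<and> (\<forall>N z. norm (cinner (w N j) z) \<le> \<kappa> N * norm (P N *v z))"
  using assms
proof (induction j rule: less_induct)
  case (less j)
  then have "\<forall>i. \<exists>\<kappa>. i < j \<longrightarrow> growth_le \<kappa> (- m i) \<and> (\<forall>N. 0 \<le> \<kappa> N) \<and> (\<forall>N z. norm (cinner (w N i) z) \<le> \<kappa> N * norm (P N *v z))"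
    by (metis less_trans)
  then obtain \<kappa> where \<kappa>: "\<And>i. i < j \<Longrightarrow> growth_le (\<kappa> i) (- m i)" "\<And>i N. i < j \<Longrightarrow> 0 \<le> \<kappa> i N"
    "\<And>i N z. i < j \<Longrightarrow> norm (cinner (w N i) z) \<le> \<kappa> i N * norm (P N *v z)"
    by metis
  define c where "c N i = cinner (w N i) (dual N j) / of_real ((norm (w N i))\<^sup>2)" for N i
  define \<kappa>' where "\<kappa>' N = inverse (norm (g N j)) + (\<Sum>i<j. norm (c N i) * \<kappa> i N)" for N
  have w: "w N j = dual N j - (\<Sum>i<j. c N i *s w N i)" for N
    unfolding w_def c_def by (subst gram_schmidt.simps) simp
  have "growth_le (\<lambda>N. norm (c N i) * \<kappa> i N) (- m j)" if i: "i < j" for i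
  proof (rule growth_le_mult_convergent)
    show "growth_le (\<kappa> i) (- m j)"
      using \<kappa>(1)[OF i] m_less[OF i less.prems] growth_le_mono by fastforce
    show "(\<lambda>N. norm (c N i)) \<longlonglongrightarrow> norm (cinner (w_lim i) (dual_lim j) / of_real ((norm (w_lim i))\<^sup>2))"
      unfolding c_def using i less.prems w_lim_nonzero
      by (intro tendsto_intros tendsto_w tendsto_dual) auto
  qed (use \<kappa>(2)[OF i] in auto)
  then have "growth_le (\<lambda>N. \<Sum>i<j. norm (c N i) * \<kappa> i N) (- m j)"
    by (rule growth_le_sum[rotated]) auto
  then have "growth_le \<kappa>' (- m j)"
    unfolding \<kappa>'_def using frame_decay[OF less.prems] by (rule growth_le_add[rotated])
  moreover have "0 \<le> \<kappa>' N" for N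
    unfolding \<kappa>'_def using \<kappa>(2) by (intro add_nonneg_nonneg sum_nonneg) auto
  moreover have "norm (cinner (w N j) z) \<le> \<kappa>' N * norm (P N *v z)" for N z
  proof -
    have "norm (cinner (dual N j) z) \<le> inverse (norm (g N j)) * norm (P N *v z)"
      unfolding cinner_dual using norm_projection_coeff_le[of "g N j" "P N *v z"] by (simp only: mult.commute)
    moreover have "norm (cinner (\<Sum>i<j. c N i *s w N i) z) \<le> (\<Sum>i<j. norm (c N i) * \<kappa> i N) * norm (P N *v z)"
    proof -
      have "norm (cinner (\<Sum>i<j. c N i *s w N i) z) \<le> (\<Sum>i<j. norm (c N i) * norm (cinner (w N i) z))"
        unfolding cinner_sum_left by (rule order_trans[OF norm_sum]) (simp add: cinner_scale_left norm_mult)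
      also have "\<dots> \<le> (\<Sum>i<j. norm (c N i) * (\<kappa> i N * norm (P N *v z)))"
        using \<kappa>(3) by (intro sum_mono mult_left_mono) auto
      finally show ?thesis by (simp add: sum_distrib_right mult.assoc)
    qed
    moreover have "norm (cinner (w N j) z) \<le> norm (cinner (dual N j) z) + norm (cinner (\<Sum>i<j. c N i *s w N i) z)"
      unfolding w cinner_diff_left by (rule norm_triangle_ineq4)
    ultimately show ?thesis by (simp add: \<kappa>'_def distrib_right)
  qed
  ultimately show ?case by blast
qed

definition x :: "nat \<Rightarrow> nat \<Rightarrow> complex^'n" where
  "x N j = (1 / of_real (norm (w N j))) *s w N j"
definition x_lim :: "nat \<Rightarrow> complex^'n" where
  "x_lim j = (1 / of_real (norm (w_lim j))) *s w_lim j"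

lemma tendsto_x: "j < CARD('n) \<Longrightarrow> (\<lambda>N. x N j) \<longlonglongrightarrow> x_lim j"
  unfolding x_def x_lim_def using w_lim_nonzero by (intro tendsto_intros tendsto_w) auto

lemma eventually_w_nonzero: "\<forall>\<^sub>F N in sequentially. \<forall>j<CARD('n). w N j \<noteq> 0"
proof -
  have "\<forall>\<^sub>F N in sequentially. \<forall>j\<in>{..<CARD('n)}. w N j \<noteq> 0"
    by (intro eventually_ball_finite ballI tendsto_imp_eventually_ne[OF tendsto_w w_lim_nonzero]) auto
  then show ?thesis by (rule eventually_mono) auto
qed

lemma x_lim_orthonormal: "i < CARD('n) \<Longrightarrow> j < CARD('n) \<Longrightarrow> cinner (x_lim i) (x_lim j) = (if i = j then 1 else 0)"
  using w_lim_nonzero gram_schmidt_orthogonal[of i j dual_lim]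
  by (auto simp: x_lim_def cinner_scale_left cinner_scale_right cinner_self w_lim_def power2_eq_square)

abbreviation "C N \<equiv> psd_root (2 * N) (ctranspose (P N) ** P N)"

text \<open>First \<open>\<epsilon>\<close> is chosen so small that the part of the error bound that does not depend on \<open>N\<close> is below
  \<open>\<delta>\<close>; the rest of the bound vanishes as \<open>N\<close> grows.\<close>

lemma C_almost_eigenvector:
  assumes j: "j < CARD('n)"
  shows "(\<lambda>N. C N *v x N j - exp (m j) *\<^sub>R x N j) \<longlonglongrightarrow> 0"
proof (rule tendstoI)
  fix \<delta> :: real assume \<delta>: "\<delta> > 0"
  define D where "D = real DIM(complex^'n)"
  have "((\<lambda>\<epsilon>. D * (exp (m j + 2 * \<epsilon>) - exp (m j - 2 * \<epsilon>))) \<longlongrightarrow> D * (exp (m j + 2 * 0) - exp (m j - 2 * 0))) (at_right 0)"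
    by (intro tendsto_intros)
  then have "\<forall>\<^sub>F \<epsilon> in at_right 0. D * (exp (m j + 2 * \<epsilon>) - exp (m j - 2 * \<epsilon>)) < \<delta>"
    using \<delta> by (intro order_tendstoD(2)) auto
  then have "\<forall>\<^sub>F \<epsilon> in at_right 0. D * (exp (m j + 2 * \<epsilon>) - exp (m j - 2 * \<epsilon>)) < \<delta> \<and> 0 < \<epsilon>"
    by (intro eventually_conj eventually_at_right_less)
  from eventually_happens'[OF trivial_limit_at_right_real this]
  obtain \<epsilon> where \<epsilon>: "\<epsilon> > 0" "D * (exp (m j + 2 * \<epsilon>) - exp (m j - 2 * \<epsilon>)) < \<delta>"
    by blast
  obtain \<kappa> where \<kappa>: "growth_le \<kappa> (- m j)" "\<And>N. 0 \<le> \<kappa> N"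
    "\<And>N z. norm (cinner (w N j) z) \<le> \<kappa> N * norm (P N *v z)"
    using w_dual_bound[OF j] by blast
  have winv: "(\<lambda>N. inverse (norm (w N j))) \<longlonglongrightarrow> inverse (norm (w_lim j))"
    using w_lim_nonzero[OF j] by (intro tendsto_intros tendsto_w j) auto
  have "growth_le (\<lambda>N. inverse (norm (w N j)) * norm (P N *v w N j)) (m j)"
    by (rule growth_le_mult_convergent[OF growth_P_w[OF j] _ winv]) simp
  then have "\<forall>\<^sub>F N in sequentially. inverse (norm (w N j)) * norm (P N *v w N j) \<le> exp (real N * (m j + \<epsilon>))"
    using \<epsilon> by (simp add: growth_le_def)
  moreover have "growth_le (\<lambda>N. inverse (norm (w N j)) * \<kappa> N) (- m j)"
    by (rule growth_le_mult_convergent[OF \<kappa>(1,2) winv])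
  then have "\<forall>\<^sub>F N in sequentially. inverse (norm (w N j)) * \<kappa> N \<le> exp (real N * (- m j + \<epsilon>))"
    using \<epsilon> by (simp add: growth_le_def)
  moreover have "((\<lambda>N. D * (exp (m j + 2 * \<epsilon>) * exp (- (real N * \<epsilon>)) + (exp (m j + 2 * \<epsilon>) - exp (m j - 2 * \<epsilon>))))
      \<longlonglongrightarrow> D * (exp (m j + 2 * \<epsilon>) * 0 + (exp (m j + 2 * \<epsilon>) - exp (m j - 2 * \<epsilon>))))"
  proof (intro tendsto_intros)
    have "(\<lambda>N. exp (- \<epsilon>) ^ N) \<longlonglongrightarrow> 0" using \<epsilon>(1) by (intro LIMSEQ_realpow_zero) auto
    then show "(\<lambda>N. exp (- (real N * \<epsilon>))) \<longlonglongrightarrow> 0" by (simp flip: exp_of_nat_mult)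
  qed
  then have "\<forall>\<^sub>F N in sequentially. D * (exp (m j + 2 * \<epsilon>) * exp (- (real N * \<epsilon>)) + (exp (m j + 2 * \<epsilon>) - exp (m j - 2 * \<epsilon>))) < \<delta>"
    using \<epsilon>(2) by (intro order_tendstoD(2)) auto
  ultimately show "\<forall>\<^sub>F N in sequentially. dist (C N *v x N j - exp (m j) *\<^sub>R x N j) 0 < \<delta>"
    using eventually_gt_at_top[of 0]
  proof eventually_elim
    case (elim N)
    have "norm (C N *v x N j - exp (m j) *\<^sub>R x N j)
      \<le> D * (exp (m j + 2 * \<epsilon>) * exp (- (real N * \<epsilon>)) + (exp (m j + 2 * \<epsilon>) - exp (m j - 2 * \<epsilon>)))"
      unfolding D_def
    proof (rule psd_root_almost_eigenvector)
      show "0 < N" "0 < \<epsilon>" by fact+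
      show "norm (x N j) \<le> 1" by (simp add: x_def norm_cscale norm_divide)
      have "norm (P N *v x N j) = inverse (norm (w N j)) * norm (P N *v w N j)"
        by (simp add: x_def vec.scale norm_cscale norm_divide inverse_eq_divide)
      then show "norm (P N *v x N j) \<le> exp (real N * (m j + \<epsilon>))" using elim by simp
      fix z
      have "norm (cinner (x N j) z) = inverse (norm (w N j)) * norm (cinner (w N j) z)"
        by (simp add: x_def cinner_scale_left norm_mult norm_divide inverse_eq_divide)
      also have "\<dots> \<le> inverse (norm (w N j)) * (\<kappa> N * norm (P N *v z))"
        by (intro mult_left_mono \<kappa>(3)) simp
      also have "\<dots> = (inverse (norm (w N j)) * \<kappa> N) * norm (P N *v z)" by simp
      also have "\<dots> \<le> exp (real N * (- m j + \<epsilon>)) * norm (P N *v z)"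
        using elim by (intro mult_right_mono) auto
      also have "real N * (- m j + \<epsilon>) = - (real N * (m j - \<epsilon>))" by (simp add: algebra_simps)
      finally show "norm (cinner (x N j) z) \<le> exp (- (real N * (m j - \<epsilon>))) * norm (P N *v z)" .
    qed
    then show ?case using elim by simp
  qed
qed

text \<open>The vectors \<open>x N j\<close> are orthonormal for large \<open>N\<close>, so \<open>y\<close> can be expanded in them before the root is
  applied. No bound on the norm of the roots is involved.\<close>

lemma tendsto_C_vec: "(\<lambda>N. C N *v y) \<longlonglongrightarrow> (\<Sum>j<CARD('n). cinner (x_lim j) y *s (exp (m j) *\<^sub>R x_lim j))"
proof (rule Lim_transform_eventually)
  show "(\<lambda>N. \<Sum>j<CARD('n). cinner (x N j) y *s ((C N *v x N j - exp (m j) *\<^sub>R x N j) + exp (m j) *\<^sub>R x N j))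
      \<longlonglongrightarrow> (\<Sum>j<CARD('n). cinner (x_lim j) y *s (exp (m j) *\<^sub>R x_lim j))"
  proof (rule tendsto_sum)
    fix j assume "j \<in> {..<CARD('n)}"
    then have "(\<lambda>N. cinner (x N j) y *s ((C N *v x N j - exp (m j) *\<^sub>R x N j) + exp (m j) *\<^sub>R x N j))
      \<longlonglongrightarrow> cinner (x_lim j) y *s (0 + exp (m j) *\<^sub>R x_lim j)"
      by (intro tendsto_intros tendsto_x C_almost_eigenvector) auto
    then show "(\<lambda>N. cinner (x N j) y *s ((C N *v x N j - exp (m j) *\<^sub>R x N j) + exp (m j) *\<^sub>R x N j))
      \<longlonglongrightarrow> cinner (x_lim j) y *s (exp (m j) *\<^sub>R x_lim j)" by simp
  qed
  show "\<forall>\<^sub>F N in sequentially. (\<Sum>j<CARD('n). cinner (x N j) y *s ((C N *v x N j - exp (m j) *\<^sub>R x N j) + exp (m j) *\<^sub>R x N j)) = C N *v y"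
    using eventually_w_nonzero
  proof eventually_elim
    case (elim N)
    have norm: "norm (x N j) = 1" if "j < CARD('n)" for j
      using elim that by (simp add: x_def norm_cscale norm_divide)
    then have "x N j \<noteq> 0" if "j < CARD('n)" for j using that by force
    then have "(\<Sum>j<CARD('n). (cinner (x N j) y / of_real ((norm (x N j))\<^sup>2)) *s x N j) = y"
      by (intro orthogonal_expansion) (auto simp: x_def cinner_scale_left cinner_scale_right w_def gram_schmidt_orthogonal)
    then have "y = (\<Sum>j<CARD('n). cinner (x N j) y *s x N j)" by (simp add: norm)
    then have "C N *v y = C N *v (\<Sum>j<CARD('n). cinner (x N j) y *s x N j)" by simp
    then show ?case by (simp add: vec.sum vec.scale)
  qed
qed

definition V :: "complex^'n^'n" where
  "V = (\<chi> a b. \<Sum>j<CARD('n). cinner (x_lim j) (axis b 1) * of_real (exp (m j)) * x_lim j $ a)"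

lemma tendsto_C: "C \<longlonglongrightarrow> V"
proof (intro vec_tendstoI)
  fix a b
  have "M $ a $ b = (M *v axis b 1) $ a" for M :: "complex^'n^'n"
    by (simp add: matrix_vector_mult_def axis_def if_distrib cong: if_cong)
  moreover have "(\<lambda>N. (C N *v axis b 1) $ a) \<longlonglongrightarrow> (\<Sum>j<CARD('n). cinner (x_lim j) (axis b 1) *s (exp (m j) *\<^sub>R x_lim j)) $ a"
    by (intro tendsto_vec_nth tendsto_C_vec)
  moreover have "(\<Sum>j<CARD('n). cinner (x_lim j) (axis b 1) *s (exp (m j) *\<^sub>R x_lim j)) $ a = V $ a $ b"
    by (simp add: V_def scaleR_eq_cscale mult.assoc)
  ultimately show "(\<lambda>N. C N $ a $ b) \<longlonglongrightarrow> V $ a $ b" by simp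
qed

text \<open>The limit is diagonal with respect to the orthonormal vectors \<open>x_lim j\<close>.\<close>

lemma charpoly_V: "det (mat z - V) = (\<Prod>j<CARD('n). z - of_real (exp (m j)))"
proof -
  define idx where "idx = the_inv_into {..<CARD('n)} e"
  have idx: "idx b < CARD('n)" "e (idx b) = b" for b
    using e the_inv_into_into[of e "{..<CARD('n)}" b "{..<CARD('n)}"] f_the_inv_into_f[of e "{..<CARD('n)}" b]
    by (auto simp: idx_def bij_betw_def)
  have bij: "bij_betw idx UNIV {..<CARD('n)}" unfolding idx_def by (rule bij_betw_the_inv_into[OF e])
  have inj: "idx a = idx b \<longleftrightarrow> a = b" for a b by (metis idx(2))
  define Q :: "complex^'n^'n" where "Q = (\<chi> a b. x_lim (idx b) $ a)"
  define D :: "complex^'n^'n" where "D = (\<chi> a b. if a = b then z - of_real (exp (m (idx a))) else 0)"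
  have "ctranspose Q ** Q = mat 1"
  proof -
    have "(ctranspose Q ** Q) $ a $ b = cinner (x_lim (idx a)) (x_lim (idx b))" for a b
      by (simp add: matrix_matrix_mult_def ctranspose_def Q_def cinner_def)
    then show ?thesis by (simp add: vec_eq_iff x_lim_orthonormal idx inj mat_def)
  qed
  then have QQ: "Q ** ctranspose Q = mat 1" by (simp add: matrix_left_right_inverse)
  have "(Q ** D ** ctranspose Q) $ a $ b = (mat z - V) $ a $ b" for a b
  proof -
    have QD: "(Q ** D) $ a $ c = Q $ a $ c * (z - of_real (exp (m (idx c))))" for c
      by (simp add: matrix_matrix_mult_def D_def if_distrib cong: if_cong)
    have "(Q ** D ** ctranspose Q) $ a $ b = (\<Sum>c\<in>UNIV. Q $ a $ c * (z - of_real (exp (m (idx c)))) * cnj (Q $ b $ c))"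
      by (simp add: matrix_matrix_mult_def[of "Q ** D"] QD ctranspose_def)
    also have "\<dots> = z * (Q ** ctranspose Q) $ a $ b - (\<Sum>c\<in>UNIV. Q $ a $ c * of_real (exp (m (idx c))) * cnj (Q $ b $ c))"
      by (simp add: matrix_matrix_mult_def ctranspose_def algebra_simps sum_subtractf sum_distrib_left)
    also have "(\<Sum>c\<in>UNIV. Q $ a $ c * of_real (exp (m (idx c))) * cnj (Q $ b $ c))
        = (\<Sum>c\<in>UNIV. cinner (x_lim (idx c)) (axis b 1) * of_real (exp (m (idx c))) * x_lim (idx c) $ a)"
      by (simp add: Q_def mult_ac)
    also have "\<dots> = (\<Sum>j<CARD('n). cinner (x_lim j) (axis b 1) * of_real (exp (m j)) * x_lim j $ a)"
      by (rule sum.reindex_bij_betw[OF bij])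
    finally show ?thesis by (simp add: QQ V_def mat_def)
  qed
  then have "mat z - V = Q ** D ** ctranspose Q" by (simp add: vec_eq_iff)
  then have "det (mat z - V) = det (Q ** ctranspose Q) * det D"
    by (simp add: det_mul mult_ac)
  also have "\<dots> = (\<Prod>a\<in>UNIV. D $ a $ a)"
    by (simp add: QQ) (rule det_diagonal, simp add: D_def)
  also have "\<dots> = (\<Prod>j<CARD('n). z - of_real (exp (m j)))"
    using prod.reindex_bij_betw[OF bij, of "\<lambda>j. z - of_real (exp (m j))"] by (simp add: D_def)
  finally show ?thesis .
qed

end

section \<open>The standard Gaussian measure\<close>

lemma nn_integral_lborel_translate:
  fixes c :: "'a::euclidean_space"
  assumes [measurable]: "h \<in> borel_measurable borel"
  shows "(\<integral>\<^sup>+y. h (c + y) \<partial>lborel) = (\<integral>\<^sup>+y. h y \<partial>lborel)"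
proof -
  have "(\<integral>\<^sup>+y. h y \<partial>lborel) = (\<integral>\<^sup>+y. h y \<partial>distr lborel borel ((+) c))"
    by (simp only: lborel_distr_plus)
  also have "\<dots> = (\<integral>\<^sup>+y. h (c + y) \<partial>lborel)"
    by (rule nn_integral_distr) auto
  finally show ?thesis by simp
qed

lemma orthogonal_transformation_borel:
  fixes f :: "'a::euclidean_space \<Rightarrow> 'a"
  assumes "orthogonal_transformation f"
  shows "f \<in> borel \<rightarrow>\<^sub>M borel"
  using orthogonal_transformation_linear[OF assms] linear_continuous_on linear_linear
  by (intro borel_measurable_continuous_onI) blast

text \<open>The image measure is again translation invariant, and translation invariant measures are
  proportional. With the unit ball \<open>K\<close>, which \<open>f\<close> preserves, evaluate the double integral of
  \<open>1\<^sub>A(x) 1\<^sub>K(x - f y)\<close> in both orders: one gives the measure of \<open>A\<close> times that of \<open>K\<close>, the other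
  the measure of the preimage of \<open>A\<close> times that of \<open>K\<close>.\<close>

lemma distr_lborel_orthogonal:
  fixes f :: "'a::euclidean_space \<Rightarrow> 'a"
  assumes f: "orthogonal_transformation f"
  shows "distr lborel borel f = lborel"
proof (rule measure_eqI)
  fix A assume "A \<in> sets (distr lborel borel f)"
  then have A [measurable]: "A \<in> sets borel" by simp
  have fm [measurable]: "f \<in> borel \<rightarrow>\<^sub>M borel" by (rule orthogonal_transformation_borel[OF f])
  have lin: "linear f" by (rule orthogonal_transformation_linear[OF f])
  have surj: "\<exists>x'. x = f x'" for x
    using orthogonal_transformation_surj[OF f] by (metis surj_def)
  let ?K = "ball (0::'a) 1"
  let ?\<mu> = "emeasure lborel"
  have [measurable]: "?K \<in> sets borel" by simp
  have K: "0 < ?\<mu> ?K" "?\<mu> ?K < \<infinity>"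
    by (simp_all add: emeasure_ball)
  have "(\<integral>\<^sup>+x. \<integral>\<^sup>+y. indicator A x * indicator ?K (x - f y) \<partial>lborel \<partial>lborel) = ?\<mu> A * ?\<mu> ?K"
  proof -
    have "(\<integral>\<^sup>+y. indicator ?K (x - f y) \<partial>lborel) = ?\<mu> ?K" for x
    proof -
      obtain x' where x': "x = f x'" using surj by blast
      have "indicator ?K (x - f y) = (indicator ?K ((- x') + y) :: ennreal)" for y
      proof -
        have "norm (x - f y) = norm (x' - y)"
          by (simp add: x' orthogonal_transformation_norm[OF f] flip: linear_diff[OF lin])
        also have "\<dots> = norm (- x' + y)" by (simp add: norm_minus_commute)
        finally show ?thesis by (simp add: indicator_def)
      qed
      then have "(\<integral>\<^sup>+y. indicator ?K (x - f y) \<partial>lborel) = (\<integral>\<^sup>+y. indicator ?K (- x' + y) \<partial>lborel)"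
        by simp
      also have "\<dots> = (\<integral>\<^sup>+y. indicator ?K y \<partial>lborel)"
        by (rule nn_integral_lborel_translate) simp
      finally show ?thesis by simp
    qed
    then show ?thesis by (simp add: nn_integral_cmult nn_integral_multc)
  qed
  moreover have "(\<integral>\<^sup>+x. \<integral>\<^sup>+y. indicator A x * indicator ?K (x - f y) \<partial>lborel \<partial>lborel) = emeasure (distr lborel borel f) A * ?\<mu> ?K"
  proof -
    have "(\<integral>\<^sup>+x. \<integral>\<^sup>+y. indicator A x * indicator ?K (x - f y) \<partial>lborel \<partial>lborel)
        = (\<integral>\<^sup>+y. \<integral>\<^sup>+x. indicator A x * indicator ?K (x - f y) \<partial>lborel \<partial>lborel)"
      by (rule lborel_pair.Fubini'[symmetric]) measurable
    also have "\<dots> = (\<integral>\<^sup>+y. \<integral>\<^sup>+x. indicator A (f y + x) * indicator ?K x \<partial>lborel \<partial>lborel)"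
    proof (rule nn_integral_cong)
      fix y
      show "(\<integral>\<^sup>+x. indicator A x * indicator ?K (x - f y) \<partial>lborel) = (\<integral>\<^sup>+x. indicator A (f y + x) * indicator ?K x \<partial>lborel)"
        using nn_integral_lborel_translate[of "\<lambda>x. indicator A x * indicator ?K (x - f y)" "f y"] by simp
    qed
    also have "\<dots> = (\<integral>\<^sup>+x. \<integral>\<^sup>+y. indicator A (f y + x) * indicator ?K x \<partial>lborel \<partial>lborel)"
      by (rule lborel_pair.Fubini') measurable
    also have "\<dots> = (\<integral>\<^sup>+x. emeasure (distr lborel borel f) A * indicator ?K x \<partial>lborel)"
    proof (rule nn_integral_cong)
      fix x
      obtain x' where x': "x = f x'" using surj by blast
      have "(\<integral>\<^sup>+y. indicator A (f y + x) \<partial>lborel) = (\<integral>\<^sup>+y. indicator A (f (x' + y)) \<partial>lborel)"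
        by (simp add: x' linear_add[OF lin] add.commute)
      also have "\<dots> = (\<integral>\<^sup>+y. indicator A (f y) \<partial>lborel)"
        by (rule nn_integral_lborel_translate) measurable
      also have "\<dots> = emeasure (distr lborel borel f) A"
        by (simp add: nn_integral_distr flip: nn_integral_indicator)
      finally show "(\<integral>\<^sup>+y. indicator A (f y + x) * indicator ?K x \<partial>lborel) = emeasure (distr lborel borel f) A * indicator ?K x"
        by (simp add: nn_integral_multc)
    qed
    also have "\<dots> = emeasure (distr lborel borel f) A * ?\<mu> ?K"
      by (rule nn_integral_cmult_indicator) simp
    finally show ?thesis .
  qed
  ultimately have "?\<mu> ?K * emeasure (distr lborel borel f) A = ?\<mu> ?K * ?\<mu> A" by (simp add: mult.commute)
  then show "emeasure (distr lborel borel f) A = ?\<mu> A"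
    using K by (auto simp: ennreal_mult_cancel_left)
qed simp

text \<open>Each real coordinate has variance \<open>1/2\<close>, so that on \<open>complex\<close> this is the standard complex normal law.\<close>

definition std_gauss :: "'a::euclidean_space measure" where
  "std_gauss = density lborel (\<lambda>x. ennreal (exp (- (norm x)\<^sup>2) / sqrt pi ^ DIM('a)))"

lemma sets_std_gauss [simp, measurable_cong]: "sets std_gauss = sets borel"
  by (simp add: std_gauss_def)

lemma space_std_gauss [simp]: "space std_gauss = UNIV"
  by (simp add: std_gauss_def)

lemma distr_std_gauss_orthogonal:
  fixes f :: "'a::euclidean_space \<Rightarrow> 'a"
  assumes f: "orthogonal_transformation f"
  shows "distr std_gauss borel f = std_gauss"
proof -
  have [measurable]: "f \<in> borel \<rightarrow>\<^sub>M borel" by (rule orthogonal_transformation_borel[OF f])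
  let ?\<phi> = "\<lambda>x::'a. ennreal (exp (- (norm x)\<^sup>2) / sqrt pi ^ DIM('a))"
  have "density (distr lborel borel f) ?\<phi> = distr (density lborel (\<lambda>x. ?\<phi> (f x))) borel f"
    by (rule density_distr) measurable
  then show ?thesis
    by (simp add: std_gauss_def distr_lborel_orthogonal[OF f] orthogonal_transformation_norm[OF f])
qed

lemma borel_measurable_vec_nth [measurable (raw)]:
  fixes f :: "'b \<Rightarrow> 'a::euclidean_space^'n"
  assumes "f \<in> borel_measurable M"
  shows "(\<lambda>x. f x $ i) \<in> borel_measurable M"
proof (rule measurable_compose[OF assms])
  show "(\<lambda>x::'a^'n. x $ i) \<in> borel_measurable borel"
    by (intro borel_measurable_continuous_onI continuous_intros)
qed

lemma borel_measurable_vec: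
  fixes f :: "'b \<Rightarrow> 'a::euclidean_space^'n"
  assumes "\<And>i. (\<lambda>x. f x $ i) \<in> borel_measurable M"
  shows "f \<in> borel_measurable M"
proof (subst borel_measurable_euclidean_space, intro ballI)
  fix B :: "'a^'n" assume "B \<in> Basis"
  then obtain i b where "B = axis i b" by (auto simp: Basis_vec_def)
  then show "(\<lambda>x. f x \<bullet> B) \<in> borel_measurable M"
    using assms[of i] by (simp add: inner_axis)
qed

lemma borel_measurable_vec_lambda [measurable (raw)]:
  fixes f :: "'b \<Rightarrow> 'n::finite \<Rightarrow> 'a::euclidean_space"
  assumes "\<And>i. (\<lambda>x. f x i) \<in> borel_measurable M"
  shows "(\<lambda>x. \<chi> i. f x i) \<in> borel_measurable M"
  by (rule borel_measurable_vec) (simp add: assms)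

lemma lborel_vec: "(lborel :: ('a::euclidean_space^'n) measure) = distr (\<Pi>\<^sub>M i\<in>UNIV. lborel) borel (\<lambda>f. \<chi> i. f i)"
proof (rule lborel_eqI)
  interpret product_sigma_finite "\<lambda>_::'n. lborel :: 'a measure" by standard
  fix l u :: "'a^'n" assume le: "\<And>b. b \<in> Basis \<Longrightarrow> l \<bullet> b \<le> u \<bullet> b"
  have le': "l $ i \<bullet> b \<le> u $ i \<bullet> b" if "b \<in> Basis" for i b
    using le[of "axis i b"] that by (auto simp: Basis_vec_def inner_axis)
  have box: "box l u = {x. \<forall>i. x $ i \<in> box (l $ i) (u $ i)}"
    by (auto simp: box_def Basis_vec_def inner_axis)
  have "emeasure (distr (\<Pi>\<^sub>M i\<in>UNIV. lborel) borel (\<lambda>f. \<chi> i. f i)) (box l u)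
      = emeasure (\<Pi>\<^sub>M i\<in>UNIV. lborel) (\<Pi>\<^sub>E i\<in>UNIV. box (l $ i) (u $ i))"
    by (subst emeasure_distr) (auto simp: box space_PiM intro!: arg_cong2[where f = emeasure])
  also have "\<dots> = (\<Prod>i\<in>UNIV. emeasure lborel (box (l $ i) (u $ i)))"
    by (rule emeasure_PiM) auto
  also have "\<dots> = (\<Prod>i\<in>UNIV. ennreal (\<Prod>b\<in>Basis. (u $ i - l $ i) \<bullet> b))"
    using le' by (simp add: emeasure_lborel_box)
  also have "\<dots> = ennreal (\<Prod>i\<in>UNIV. \<Prod>b\<in>Basis. (u $ i - l $ i) \<bullet> b)"
    using le' by (intro prod_ennreal prod_nonneg) (auto simp: inner_diff_left)
  also have "(\<Prod>i\<in>UNIV. \<Prod>b\<in>Basis. (u $ i - l $ i) \<bullet> b) = (\<Prod>(i, b)\<in>UNIV \<times> Basis. (u - l) \<bullet> axis i b)"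
    by (simp add: prod.cartesian_product inner_axis)
  also have "\<dots> = prod ((\<bullet>) (u - l)) ((\<lambda>(i, b). axis i b) ` (UNIV \<times> (Basis :: 'a set)))"
  proof (subst prod.reindex)
    show "inj_on (\<lambda>(i, b). axis i b :: 'a^'n) (UNIV \<times> Basis)"
      by (auto simp: inj_on_def axis_eq_axis nonzero_Basis)
  qed (simp add: case_prod_beta o_def)
  also have "(\<lambda>(i, b). axis i b) ` (UNIV \<times> (Basis :: 'a set)) = (Basis :: ('a^'n) set)"
    by (auto simp: Basis_vec_def)
  finally show "emeasure (distr (\<Pi>\<^sub>M i\<in>UNIV. lborel) borel (\<lambda>f. \<chi> i. f i)) (box l u) = ennreal (prod ((\<bullet>) (u - l)) Basis)" .
qed simp

text \<open>The density factorises over the coordinates because \<open>(norm x)\<^sup>2\<close> is a sum over them.\<close>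

lemma std_gauss_vec:
  "(std_gauss :: ('a::euclidean_space^'n) measure) = distr (\<Pi>\<^sub>M i\<in>UNIV. std_gauss) borel (\<lambda>f. \<chi> i. f i)"
proof -
  let ?\<phi> = "\<lambda>x::'a. ennreal (exp (- (norm x)\<^sup>2) / sqrt pi ^ DIM('a))"
  let ?\<Phi> = "\<lambda>x::'a^'n. ennreal (exp (- (norm x)\<^sup>2) / sqrt pi ^ DIM('a^'n))"
  let ?L = "\<Pi>\<^sub>M i\<in>(UNIV::'n set). lborel :: 'a measure"
  interpret L: product_sigma_finite "\<lambda>_::'n. lborel :: 'a measure" by standard
  have prod: "?\<Phi> (\<chi> i. f i) = (\<Prod>i\<in>UNIV. ?\<phi> (f i))" for f
  proof -
    have "(norm (\<chi> i. f i))\<^sup>2 = (\<Sum>i\<in>UNIV. (norm (f i))\<^sup>2)"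
      by (simp add: norm_vec_def L2_set_def sum_nonneg)
    then have "exp (- (norm (\<chi> i. f i))\<^sup>2) / sqrt pi ^ DIM('a^'n) = (\<Prod>i\<in>UNIV. exp (- (norm (f i))\<^sup>2) / sqrt pi ^ DIM('a))"
      by (simp add: prod_dividef exp_sum power_mult[symmetric] sum_negf[symmetric] mult.commute)
    then show ?thesis by (simp add: prod_ennreal)
  qed
  have sf: "sigma_finite_measure (std_gauss :: 'a measure)"
    unfolding std_gauss_def by (subst sigma_finite_measure.sigma_finite_iff_density_finite[OF sigma_finite_lborel]) auto
  interpret G: product_sigma_finite "\<lambda>_::'n. std_gauss :: 'a measure"
    using sf by (simp add: product_sigma_finite_def)
  have "density ?L (\<lambda>f. \<Prod>i\<in>UNIV. ?\<phi> (f i)) = (\<Pi>\<^sub>M i\<in>UNIV. std_gauss)"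
  proof (rule G.PiM_eqI)
    show "sets (density ?L (\<lambda>f. \<Prod>i\<in>UNIV. ?\<phi> (f i))) = sets (\<Pi>\<^sub>M i\<in>UNIV. std_gauss)"
      by (simp cong: sets_PiM_cong)
    fix X :: "'n \<Rightarrow> 'a set" assume "\<And>i. i \<in> UNIV \<Longrightarrow> X i \<in> sets std_gauss"
    then have X [measurable]: "X i \<in> sets borel" for i by simp
    have [measurable]: "Pi\<^sub>E UNIV X \<in> sets ?L" by (intro sets_PiM_I_finite) auto
    have "emeasure (density ?L (\<lambda>f. \<Prod>i\<in>UNIV. ?\<phi> (f i))) (Pi\<^sub>E UNIV X)
        = (\<integral>\<^sup>+f. (\<Prod>i\<in>UNIV. ?\<phi> (f i)) * indicator (Pi\<^sub>E UNIV X) f \<partial>?L)"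
      by (rule emeasure_density) measurable
    also have "\<dots> = (\<integral>\<^sup>+f. (\<Prod>i\<in>UNIV. ?\<phi> (f i) * indicator (X i) (f i)) \<partial>?L)"
    proof (rule nn_integral_cong)
      fix f :: "'n \<Rightarrow> 'a"
      have "indicator (Pi\<^sub>E UNIV X) f = (\<Prod>i\<in>UNIV. indicator (X i) (f i) :: ennreal)"
        by (auto simp: indicator_def prod_zero_iff intro!: prod.neutral)
      then show "(\<Prod>i\<in>UNIV. ?\<phi> (f i)) * indicator (Pi\<^sub>E UNIV X) f = (\<Prod>i\<in>UNIV. ?\<phi> (f i) * indicator (X i) (f i))"
        by (simp add: prod.distrib)
    qed
    also have "\<dots> = (\<Prod>i\<in>UNIV. \<integral>\<^sup>+x. ?\<phi> x * indicator (X i) x \<partial>lborel)"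
      by (rule L.product_nn_integral_prod) auto
    also have "\<dots> = (\<Prod>i\<in>UNIV. emeasure std_gauss (X i))"
      unfolding std_gauss_def by (intro prod.cong refl emeasure_density[symmetric]) auto
    finally show "emeasure (density ?L (\<lambda>f. \<Prod>i\<in>UNIV. ?\<phi> (f i))) (Pi\<^sub>E UNIV X) = (\<Prod>i\<in>UNIV. emeasure std_gauss (X i))" .
  qed simp
  then have "distr (\<Pi>\<^sub>M i\<in>UNIV. std_gauss) borel (\<lambda>f. \<chi> i. f i) = distr (density ?L (\<lambda>f. ?\<Phi> (\<chi> i. f i))) borel (\<lambda>f. \<chi> i. f i)"
    by (simp only: prod)
  also have "\<dots> = density (distr ?L borel (\<lambda>f. \<chi> i. f i)) ?\<Phi>"
    by (rule density_distr[symmetric]) measurable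
  finally show ?thesis by (simp add: std_gauss_def lborel_vec)
qed

lemma std_gauss_complex: "std_gauss = density lborel std_complex_normal_density"
  by (simp add: std_gauss_def std_complex_normal_density_def[abs_def])

text \<open>Write \<open>exp (- (norm z)\<^sup>2)\<close> as the integral of \<open>exp (- u)\<close> over \<open>u \<ge> (norm z)\<^sup>2\<close> and integrate over \<open>z\<close> first: the annulus
  between radii \<open>sqrt a\<close> and \<open>sqrt u\<close> has area \<open>pi * (u - a)\<close>.\<close>

lemma emeasure_std_gauss_complex_tail:
  assumes a: "0 \<le> a"
  shows "emeasure (std_gauss :: complex measure) {z. a < (norm z)\<^sup>2} = ennreal (exp (- a))"
proof -
  let ?f = "\<lambda>u::real. ennreal (exp (- u))"
  have tail: "ennreal (exp (- t)) = (\<integral>\<^sup>+u. ?f u * indicator {t..} u \<partial>lborel)" for t :: real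
  proof -
    have "(\<integral>\<^sup>+u. ?f u * indicator {t..} u \<partial>lborel) = ennreal (0 - (- exp (- t)))"
    proof (rule nn_integral_FTC_atLeast)
      show "((\<lambda>u. - exp (- u)) \<longlongrightarrow> (0::real)) at_top"
        using tendsto_minus[OF filterlim_compose[OF exp_at_bot filterlim_uminus_at_bot_at_top]] by simp
    qed (auto intro!: derivative_eq_intros)
    then show ?thesis by simp
  qed
  have annulus: "emeasure lborel {z::complex. a < (norm z)\<^sup>2 \<and> (norm z)\<^sup>2 \<le> u} = ennreal (pi * (u - a)) * indicator {a..} u" for u
  proof (cases "a \<le> u")
    case True
    have annulus_eq: "{z::complex. a < (norm z)\<^sup>2 \<and> (norm z)\<^sup>2 \<le> u} = cball 0 (sqrt u) - cball 0 (sqrt a)"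
    proof -
      have *: "(norm z)\<^sup>2 \<le> t \<longleftrightarrow> norm z \<le> sqrt t" for z :: complex and t
        using real_sqrt_le_iff[of "(norm z)\<^sup>2" t] by (simp del: real_sqrt_le_iff)
      show ?thesis
      proof (rule set_eqI)
        fix z :: complex
        have "a < (norm z)\<^sup>2 \<longleftrightarrow> \<not> norm z \<le> sqrt a" using *[of z a] by linarith
        then show "z \<in> {z. a < (norm z)\<^sup>2 \<and> (norm z)\<^sup>2 \<le> u} \<longleftrightarrow> z \<in> cball 0 (sqrt u) - cball 0 (sqrt a)"
          using *[of z u] by (simp add: conj_commute del: not_le)
      qed
    qed
    have "emeasure lborel (cball (0::complex) (sqrt u) - cball 0 (sqrt a)) = emeasure lborel (cball (0::complex) (sqrt u)) - emeasure lborel (cball (0::complex) (sqrt a))"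
    proof (rule emeasure_Diff)
      show "emeasure lborel (cball (0::complex) (sqrt a)) \<noteq> \<infinity>"
        using emeasure_lborel_cball_finite[of "0::complex" "sqrt a"] by simp
      show "cball (0::complex) (sqrt a) \<subseteq> cball 0 (sqrt u)"
        using True by (intro subset_cball) simp
    qed simp_all
    then show ?thesis using True a
      by (simp add: annulus_eq emeasure_cball unit_ball_vol_2 ennreal_minus algebra_simps)
  next
    case False
    then have empty: "{z::complex. a < (norm z)\<^sup>2 \<and> (norm z)\<^sup>2 \<le> u} = {}" by auto
    show ?thesis unfolding empty using False by simp
  qed
  have "emeasure (std_gauss :: complex measure) {z. a < (norm z)\<^sup>2}
      = (\<integral>\<^sup>+z. ennreal (exp (- (norm z)\<^sup>2) / pi) * indicator {z. a < (norm z)\<^sup>2} z \<partial>(lborel :: complex measure))"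
    unfolding std_gauss_complex std_complex_normal_density_def[abs_def] by (rule emeasure_density) measurable
  also have "\<dots> = (\<integral>\<^sup>+z. \<integral>\<^sup>+u. ennreal (1 / pi) * ?f u * indicator {z. a < (norm z)\<^sup>2 \<and> (norm z)\<^sup>2 \<le> u} z \<partial>lborel \<partial>(lborel :: complex measure))"
  proof (rule nn_integral_cong)
    fix z :: complex
    have "(\<integral>\<^sup>+u. ennreal (1 / pi) * ?f u * indicator {z. a < (norm z)\<^sup>2 \<and> (norm z)\<^sup>2 \<le> u} z \<partial>lborel)
        = (\<integral>\<^sup>+u. (ennreal (1 / pi) * indicator {z. a < (norm z)\<^sup>2} z) * (?f u * indicator {(norm z)\<^sup>2..} u) \<partial>lborel)"
      by (intro nn_integral_cong) (auto simp: indicator_def)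
    also have "\<dots> = ennreal (1 / pi) * indicator {z. a < (norm z)\<^sup>2} z * ennreal (exp (- (norm z)\<^sup>2))"
      by (subst nn_integral_cmult) (auto simp flip: tail)
    finally show "ennreal (exp (- (norm z)\<^sup>2) / pi) * indicator {z. a < (norm z)\<^sup>2} z
        = (\<integral>\<^sup>+u. ennreal (1 / pi) * ?f u * indicator {z. a < (norm z)\<^sup>2 \<and> (norm z)\<^sup>2 \<le> u} z \<partial>lborel)"
      by (simp add: divide_inverse ennreal_mult mult_ac)
  qed
  also have "\<dots> = (\<integral>\<^sup>+u. \<integral>\<^sup>+z. ennreal (1 / pi) * ?f u * indicator {z. a < (norm z)\<^sup>2 \<and> (norm z)\<^sup>2 \<le> u} z \<partial>(lborel :: complex measure) \<partial>lborel)"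
    by (rule lborel_pair.Fubini'[symmetric]) measurable
  also have "\<dots> = (\<integral>\<^sup>+u. ennreal (1 / pi) * ?f u * (ennreal (pi * (u - a)) * indicator {a..} u) \<partial>lborel)"
    by (intro nn_integral_cong) (subst nn_integral_cmult_indicator, auto simp: annulus)
  also have "\<dots> = (\<integral>\<^sup>+u. ennreal (exp (- u) * (u - a)) * indicator {a..} u \<partial>lborel)"
    by (intro nn_integral_cong) (auto simp: indicator_def simp flip: ennreal_mult)
  also have "\<dots> = (\<integral>\<^sup>+v. ennreal (exp (- (a + v)) * v) * indicator {0..} v \<partial>lborel)"
    using nn_integral_lborel_translate[of "\<lambda>u. ennreal (exp (- u) * (u - a)) * indicator {a..} u" a]
    by (simp add: indicator_def)
  also have "\<dots> = (\<integral>\<^sup>+v. ennreal (exp (- a)) * ennreal (erlang_density 1 1 v * v ^ 0) \<partial>lborel)"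
    by (intro nn_integral_cong)
      (auto simp: indicator_def erlang_density_def exp_diff exp_minus field_simps exp_add simp flip: ennreal_mult)
  also have "\<dots> = ennreal (exp (- a))"
    using nn_integral_erlang_ith_moment[of 1 1 0] by (subst nn_integral_cmult) auto
  finally show ?thesis .
qed

lemma prob_space_std_gauss_complex: "prob_space (std_gauss :: complex measure)"
proof
  have "AE z in (lborel :: complex measure). z \<noteq> 0" by (rule AE_lborel_singleton)
  then have "AE z in (std_gauss :: complex measure). z \<noteq> 0"
    unfolding std_gauss_def by (subst AE_density) auto
  then have "emeasure (std_gauss :: complex measure) UNIV = emeasure (std_gauss :: complex measure) {z. 0 < (norm z)\<^sup>2}"
    by (intro emeasure_eq_AE) auto
  then show "emeasure (std_gauss :: complex measure) (space std_gauss) = 1"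
    by (simp only: emeasure_std_gauss_complex_tail space_std_gauss) simp
qed

lemma prob_space_std_gauss_vec:
  assumes "prob_space (std_gauss :: 'a::euclidean_space measure)"
  shows "prob_space (std_gauss :: ('a^'n) measure)"
  unfolding std_gauss_vec
  by (intro prob_space.prob_space_distr prob_space_PiM assms) measurable

lemma exponential_std_gauss_complex:
  "distributed std_gauss lborel (\<lambda>z::complex. (norm z)\<^sup>2) (exponential_density 1)"
proof (rule exponential_distributedI)
  interpret prob_space "std_gauss :: complex measure" by (rule prob_space_std_gauss_complex)
  fix a :: real assume a: "0 \<le> a"
  have "prob {z. a < (norm z)\<^sup>2} = exp (- a)"
    using emeasure_std_gauss_complex_tail[OF a] by (simp add: emeasure_eq_measure)
  moreover have "prob (space std_gauss - {z. a < (norm z)\<^sup>2}) = 1 - prob {z. a < (norm z)\<^sup>2}"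
    by (rule prob_compl) measurable
  moreover have "space std_gauss - {z::complex. a < (norm z)\<^sup>2} = {z \<in> space std_gauss. (norm z)\<^sup>2 \<le> a}" by auto
  ultimately show "emeasure std_gauss {z \<in> space std_gauss. (norm (z::complex))\<^sup>2 \<le> a} = 1 - ennreal (exp (- a * 1))"
    by (simp add: emeasure_eq_measure ennreal_minus flip: ennreal_1)
qed auto

section \<open>Gram-Schmidt vectors of a Gaussian matrix\<close>

lemma borel_measurable_cnj [measurable (raw)]:
  "f \<in> borel_measurable M \<Longrightarrow> (\<lambda>x. cnj (f x)) \<in> borel_measurable M"
  by (rule measurable_compose[of f M borel cnj]) (auto intro!: borel_measurable_continuous_onI continuous_intros)

lemma borel_measurable_cinner [measurable (raw)]:
  assumes "f \<in> borel_measurable M" "g \<in> borel_measurable M"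
  shows "(\<lambda>x. cinner (f x) (g x)) \<in> borel_measurable M"
proof -
  note [measurable] = assms
  show ?thesis unfolding cinner_def by measurable
qed

lemma borel_measurable_cscale [measurable (raw)]:
  fixes f :: "'a \<Rightarrow> complex^'n"
  assumes "c \<in> borel_measurable M" "f \<in> borel_measurable M"
  shows "(\<lambda>x. c x *s f x) \<in> borel_measurable M"
proof -
  note [measurable] = assms
  show ?thesis by (rule borel_measurable_vec) simp
qed

lemma borel_measurable_gram_schmidt [measurable (raw)]:
  assumes "\<And>i. (\<lambda>x. u x i) \<in> borel_measurable M"
  shows "(\<lambda>x. gram_schmidt (u x) j) \<in> borel_measurable M"
proof (induction j rule: less_induct)
  case (less j)
  note [measurable] = assms less
  show ?case unfolding gram_schmidt.simps[of _ j] by measurable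
qed

text \<open>The Gamma law with integer parameter \<open>r \<ge> 1\<close>; the index of \<open>erlang_density\<close> is one less than the
  number of exponential summands.\<close>

definition gamma_law :: "nat \<Rightarrow> real measure" where
  "gamma_law r = density lborel (\<lambda>x. ennreal (erlang_density (r - 1) 1 x))"

lemma sets_gamma_law [simp, measurable_cong]: "sets (gamma_law r) = sets borel"
  and space_gamma_law [simp]: "space (gamma_law r) = UNIV"
  by (simp_all add: gamma_law_def)

lemma AE_gamma_law_pos: "AE t in gamma_law r. 0 < t"
proof -
  have "AE t in lborel. t \<noteq> (0::real)" by (rule AE_lborel_singleton)
  then show ?thesis
    unfolding gamma_law_def by (subst AE_density) (auto simp: erlang_density_def)
qed

lemma distr_sum_norm_std_gauss:
  fixes K :: "'n::finite set"
  assumes K: "K \<noteq> {}"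
  shows "distr std_gauss borel (\<lambda>x::complex^'n. \<Sum>k\<in>K. (norm (x $ k))\<^sup>2) = gamma_law (card K)"
proof -
  let ?P = "\<Pi>\<^sub>M i\<in>(UNIV::'n set). (std_gauss :: complex measure)"
  interpret prob_space ?P by (intro prob_space_PiM prob_space_std_gauss_complex)
  have comp: "distr ?P std_gauss (\<lambda>x. x k) = std_gauss" for k
    by (rule distr_PiM_component) (auto simp: prob_space_std_gauss_complex)
  have "indep_vars (\<lambda>_. std_gauss) (\<lambda>k x. x k) (UNIV :: 'n set)"
  proof (subst indep_vars_iff_distr_eq_PiM')
    have "distr ?P ?P (\<lambda>x. \<lambda>i\<in>UNIV. x i) = distr ?P ?P (\<lambda>x. x)"
      by (intro distr_cong) auto
    then show "distr ?P ?P (\<lambda>x. \<lambda>i\<in>UNIV. x i) = (\<Pi>\<^sub>M i\<in>UNIV. distr ?P std_gauss (\<lambda>x. x i))"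
      by (simp add: comp)
  qed auto
  then have "indep_vars (\<lambda>_. borel) (\<lambda>k x. (norm (x k))\<^sup>2) (UNIV :: 'n set)"
    by (rule indep_vars_compose2) measurable
  then have ind: "indep_vars (\<lambda>_. borel) (\<lambda>k x. (norm (x k))\<^sup>2) K"
    by (rule indep_vars_subset) simp
  have "distributed ?P lborel (\<lambda>x. (norm (x k))\<^sup>2) (exponential_density 1)" for k
  proof -
    have "distr ?P lborel (\<lambda>x. (norm (x k))\<^sup>2) = distr (distr ?P std_gauss (\<lambda>x. x k)) lborel (\<lambda>z. (norm z)\<^sup>2)"
      by (subst distr_distr) (auto simp: o_def)
    also have "\<dots> = density lborel (exponential_density 1)"
      using exponential_std_gauss_complex by (simp add: comp distributed_def)
    finally show ?thesis by (simp add: distributed_def)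
  qed
  then have "distributed ?P lborel (\<lambda>x. \<Sum>k\<in>K. (norm (x k))\<^sup>2) (erlang_density (card K - 1) 1)"
    using K ind by (intro exponential_distributed_sum) auto
  then have "distr ?P lborel (\<lambda>x. \<Sum>k\<in>K. (norm (x k))\<^sup>2) = gamma_law (card K)"
    by (simp add: distributed_def gamma_law_def)
  moreover have "distr std_gauss borel (\<lambda>x::complex^'n. \<Sum>k\<in>K. (norm (x $ k))\<^sup>2) = distr ?P lborel (\<lambda>x. \<Sum>k\<in>K. (norm (x k))\<^sup>2)"
    unfolding std_gauss_vec by (subst distr_distr) (auto simp: o_def intro!: distr_cong)
  ultimately show ?thesis by simp
qed

definition orthonormal :: "(nat \<Rightarrow> complex^'n) \<Rightarrow> nat \<Rightarrow> bool" where
  "orthonormal v j \<longleftrightarrow> (\<forall>i<j. \<forall>k<j. cinner (v i) (v k) = (if i = k then 1 else 0))"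

text \<open>As long as fewer than \<open>d\<close> vectors are present, their span is not the whole space, and the
  Gram-Schmidt step applied to a vector outside the span yields a further unit vector.\<close>

lemma orthonormal_completion:
  fixes w :: "nat \<Rightarrow> complex^'n"
  assumes "orthonormal w j" "j \<le> CARD('n)"
  shows "\<exists>v. (\<forall>i<j. v i = w i) \<and> orthonormal v CARD('n)"
  using assms(2,1)
proof (induction j arbitrary: w rule: inc_induct)
  case base
  then show ?case by blast
next
  case (step j)
  have "vec.dim (w ` {..<j}) < CARD('n)"
    using vec.dim_le_card'[of "w ` {..<j}"] card_image_le[of "{..<j}" w] step.hyps by simp
  then have "vec.span (w ` {..<j}) \<noteq> UNIV"
    by (metis less_irrefl vec.dim_span vec_dim_card)
  then obtain x where x: "x \<notin> vec.span (w ` {..<j})" by auto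
  define u where "u = w(j := x)"
  have u: "u ` {..<j} = w ` {..<j}" by (auto simp: u_def)
  define y where "y = gram_schmidt u j"
  have y: "y \<noteq> 0"
    using gram_schmidt_minus_in_span[of u j] x by (auto simp: y_def u) (simp add: u_def)
  have orth: "cinner y (w i) = 0" if "i < j" for i
    unfolding y_def by (rule cinner_gram_schmidt_span) (use that u in \<open>auto intro!: vec.span_base\<close>)
  define w' where "w' = w(j := (1 / of_real (norm y)) *s y)"
  have "orthonormal w' (Suc j)"
    unfolding orthonormal_def
  proof (intro allI impI)
    fix i k assume ik: "i < Suc j" "k < Suc j"
    have self: "cinner ((1 / of_real (norm y)) *s y) ((1 / of_real (norm y)) *s y) = 1"
      using y by (simp add: cinner_self norm_cscale norm_divide)
    have "cinner (w i) y = 0" if "i < j" for i using orth[OF that] cinner_eq_0_commute by blast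
    then show "cinner (w' i) (w' k) = (if i = k then 1 else 0)"
      using ik self orth step.prems
      by (auto simp: w'_def less_Suc_eq orthonormal_def cinner_scale_left cinner_scale_right)
  qed
  from step.IH[OF this] obtain v where "\<forall>i<Suc j. v i = w' i" "orthonormal v CARD('n)" by blast
  then show ?case by (intro exI[of _ v]) (auto simp: w'_def)
qed

lemma parseval:
  fixes v :: "nat \<Rightarrow> complex^'n"
  assumes v: "orthonormal v CARD('n)"
  shows "(\<Sum>i<CARD('n). (norm (cinner (v i) x))\<^sup>2) = (norm x)\<^sup>2"
proof -
  have self: "cinner (v i) (v i) = 1" if "i < CARD('n)" for i
    using v that by (simp add: orthonormal_def)
  have norm: "norm (v i) = 1" if "i < CARD('n)" for i
  proof -
    have "complex_of_real ((norm (v i))\<^sup>2) = of_real 1"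
      using self[OF that] cinner_self[of "v i"] by simp
    then have "(norm (v i))\<^sup>2 = 1" by (simp only: of_real_eq_iff)
    then show ?thesis using norm_ge_zero[of "v i"] by (simp add: power2_eq_1_iff)
  qed
  have "v i \<noteq> 0" if "i < CARD('n)" for i using norm[OF that] by auto
  then have "(\<Sum>i<CARD('n). (cinner (v i) x / of_real ((norm (v i))\<^sup>2)) *s v i) = x"
    using v by (intro orthogonal_expansion) (auto simp: orthonormal_def)
  then have exp: "(\<Sum>i<CARD('n). cinner (v i) x *s v i) = x" by (simp add: norm)
  have "of_real ((norm x)\<^sup>2) = cinner x (\<Sum>i<CARD('n). cinner (v i) x *s v i)"
    by (simp add: exp cinner_self)
  also have "\<dots> = (\<Sum>i<CARD('n). cinner (v i) x * cnj (cinner (v i) x))"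
    by (simp add: cinner_sum_right cinner_scale_right cinner_commute[of x])
  also have "\<dots> = of_real (\<Sum>i<CARD('n). (norm (cinner (v i) x))\<^sup>2)"
    by (simp only: of_real_sum complex_norm_square)
  finally show ?thesis by (simp only: of_real_eq_iff)
qed

lemma bij_betw_index:
  assumes e: "bij_betw e {..<CARD('n)} (UNIV :: 'n::finite set)"
  shows "\<exists>idx. bij_betw idx (UNIV :: 'n set) {..<CARD('n)} \<and> (\<forall>a. e (idx a) = a) \<and> (\<forall>i<CARD('n). idx (e i) = i)"
proof (intro exI conjI allI impI)
  show "bij_betw (the_inv_into {..<CARD('n)} e) UNIV {..<CARD('n)}"
    by (rule bij_betw_the_inv_into[OF e])
  show "e (the_inv_into {..<CARD('n)} e a) = a" for a
    using e by (intro f_the_inv_into_f) (auto simp: bij_betw_def)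
  show "the_inv_into {..<CARD('n)} e (e i) = i" if "i < CARD('n)" for i
    using e that by (intro the_inv_into_f_f) (auto simp: bij_betw_def)
qed

lemma norm_vec_square: "(norm (x :: 'a::real_normed_vector^'n))\<^sup>2 = (\<Sum>i\<in>UNIV. (norm (x $ i))\<^sup>2)"
  by (simp add: norm_vec_def L2_set_def sum_nonneg)

lemma orthogonal_transformation_coordinates:
  fixes v :: "nat \<Rightarrow> complex^'n"
  assumes v: "orthonormal v CARD('n)" and idx: "bij_betw idx (UNIV :: 'n set) {..<CARD('n)}"
  shows "orthogonal_transformation (\<lambda>x. \<chi> a. cinner (v (idx a)) x)"
  unfolding orthogonal_transformation
proof (intro conjI allI)
  show "linear (\<lambda>x. \<chi> a. cinner (v (idx a)) x)"
    by (intro linearI) (simp_all add: vec_eq_iff cinner_add_right cinner_scale_right scaleR_eq_cscale)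
  fix x
  have "(norm (\<chi> a. cinner (v (idx a)) x))\<^sup>2 = (\<Sum>a\<in>UNIV. (norm (cinner (v (idx a)) x))\<^sup>2)"
    by (simp add: norm_vec_square)
  also have "\<dots> = (norm x)\<^sup>2"
    using sum.reindex_bij_betw[OF idx, of "\<lambda>i. (norm (cinner (v i) x))\<^sup>2"] parseval[OF v] by simp
  finally show "norm (\<chi> a. cinner (v (idx a)) x) = norm x" by simp
qed

lemma orthogonal_transformation_matrix_columns:
  fixes v :: "nat \<Rightarrow> complex^'n"
  assumes v: "orthonormal v CARD('n)" and idx: "bij_betw idx (UNIV :: 'n set) {..<CARD('n)}"
  shows "orthogonal_transformation (\<lambda>a :: complex^'n^'n. \<chi> k. a *v v (idx k))"
  unfolding orthogonal_transformation
proof (intro conjI allI)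
  show "linear (\<lambda>a :: complex^'n^'n. \<chi> k. a *v v (idx k))"
    by (intro linearI)
      (simp_all add: vec_eq_iff matrix_vector_mult_def sum.distrib algebra_simps sum_distrib_left scaleR_sum_right)
  fix a :: "complex^'n^'n"
  have row: "norm ((a *v y) $ b) = norm (cinner y (\<chi> c. cnj (a $ b $ c)))" for y b
  proof -
    have "(a *v y) $ b = cnj (cinner y (\<chi> c. cnj (a $ b $ c)))"
      by (simp add: matrix_vector_mult_def cinner_def mult.commute)
    then show ?thesis by simp
  qed
  have "(norm (\<chi> k. a *v v (idx k)))\<^sup>2 = (\<Sum>k\<in>UNIV. \<Sum>b\<in>UNIV. (norm (cinner (v (idx k)) (\<chi> c. cnj (a $ b $ c))))\<^sup>2)"
    by (simp add: norm_vec_square row)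
  also have "\<dots> = (\<Sum>i<CARD('n). \<Sum>b\<in>UNIV. (norm (cinner (v i) (\<chi> c. cnj (a $ b $ c))))\<^sup>2)"
    by (rule sum.reindex_bij_betw[OF idx])
  also have "\<dots> = (\<Sum>b\<in>UNIV. \<Sum>i<CARD('n). (norm (cinner (v i) (\<chi> c. cnj (a $ b $ c))))\<^sup>2)"
    by (rule sum.swap)
  also have "\<dots> = (norm a)\<^sup>2"
    by (simp add: parseval[OF v] norm_vec_square)
  finally show "norm (\<chi> k. a *v v (idx k)) = norm a" by simp
qed

lemma norm_gram_schmidt_square:
  "(norm (gram_schmidt u j))\<^sup>2 = (norm (u j))\<^sup>2 - (\<Sum>i<j. (norm (cinner (gram_schmidt u i) (u j)))\<^sup>2 / (norm (gram_schmidt u i))\<^sup>2)"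
proof -
  have "complex_of_real ((norm (gram_schmidt u j))\<^sup>2) = cinner (gram_schmidt u j) (u j)" by (rule cinner_gram_schmidt_self[symmetric])
  also have "\<dots> = of_real ((norm (u j))\<^sup>2) - (\<Sum>i<j. cnj (cinner (gram_schmidt u i) (u j)) * cinner (gram_schmidt u i) (u j) / of_real ((norm (gram_schmidt u i))\<^sup>2))"
    by (subst gram_schmidt.simps) (simp add: cinner_diff_left cinner_sum_left cinner_scale_left cinner_self)
  also have "\<dots> = of_real ((norm (u j))\<^sup>2 - (\<Sum>i<j. (norm (cinner (gram_schmidt u i) (u j)))\<^sup>2 / (norm (gram_schmidt u i))\<^sup>2))"
    by (simp only: of_real_diff of_real_sum of_real_divide complex_norm_square mult.commute)
  finally show ?thesis by (simp only: of_real_eq_iff)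
qed

lemma orthonormal_normalized_gram_schmidt:
  assumes "\<And>i. i < j \<Longrightarrow> gram_schmidt u i \<noteq> 0"
  shows "orthonormal (\<lambda>i. (1 / of_real (norm (gram_schmidt u i))) *s gram_schmidt u i) j"
  unfolding orthonormal_def using assms
  by (auto simp: cinner_scale_left cinner_scale_right gram_schmidt_orthogonal cinner_self power2_eq_square)

text \<open>The squared distance of \<open>y\<close> from the span of \<open>j\<close> independent vectors is, in a suitable orthonormal basis, the
  sum of the squares of the last \<open>d - j\<close> coordinates. Invariance of the Gaussian law allows the use of this
  basis.\<close>

lemma distr_norm_gram_schmidt_last:
  fixes u :: "nat \<Rightarrow> complex^'n"
  assumes j: "j < CARD('n)" and nz: "\<And>i. i < j \<Longrightarrow> gram_schmidt u i \<noteq> 0"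
  shows "distr std_gauss borel (\<lambda>y. (norm (gram_schmidt (u(j := y)) j))\<^sup>2) = gamma_law (CARD('n) - j)"
proof -
  obtain e where e: "bij_betw e {..<CARD('n)} (UNIV :: 'n set)"
    using ex_bij_betw_nat_finite[of "UNIV :: 'n set"] by (auto simp: atLeast0LessThan)
  obtain idx where idx: "bij_betw idx (UNIV :: 'n set) {..<CARD('n)}"
    "\<And>a. e (idx a) = a" "\<And>i. i < CARD('n) \<Longrightarrow> idx (e i) = i"
    using bij_betw_index[OF e] by auto
  obtain v where v: "\<And>i. i < j \<Longrightarrow> v i = (1 / of_real (norm (gram_schmidt u i))) *s gram_schmidt u i" "orthonormal v CARD('n)"
    using orthonormal_completion[OF orthonormal_normalized_gram_schmidt[OF nz], of j] j by auto
  define T where "T x = (\<chi> a. cinner (v (idx a)) x)" for x :: "complex^'n"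
  have T: "orthogonal_transformation T"
    unfolding T_def by (rule orthogonal_transformation_coordinates[OF v(2) idx(1)])
  have [measurable]: "T \<in> borel \<rightarrow>\<^sub>M borel" by (rule orthogonal_transformation_borel[OF T])
  define K where "K = e ` {j..<CARD('n)}"
  have inj: "inj_on e {j..<CARD('n)}"
    using e by (auto simp: bij_betw_def elim: inj_on_subset)
  have K: "card K = CARD('n) - j" "K \<noteq> {}"
    using j inj by (auto simp: K_def card_image)
  have eq: "(norm (gram_schmidt (u(j := y)) j))\<^sup>2 = (\<Sum>k\<in>K. (norm (T y $ k))\<^sup>2)" for y
  proof -
    have same: "gram_schmidt (u(j := y)) i = gram_schmidt u i" if "i < j" for i
      using that by (intro gram_schmidt_cong) auto
    have "(norm (gram_schmidt (u(j := y)) j))\<^sup>2 = (norm y)\<^sup>2 - (\<Sum>i<j. (norm (cinner (v i) y))\<^sup>2)"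
      by (subst norm_gram_schmidt_square) (auto simp: same v(1) cinner_scale_left norm_mult norm_divide power_divide intro!: sum.cong)
    also have "(norm y)\<^sup>2 = (\<Sum>i<j. (norm (cinner (v i) y))\<^sup>2) + (\<Sum>i\<in>{j..<CARD('n)}. (norm (cinner (v i) y))\<^sup>2)"
      unfolding parseval[OF v(2), symmetric] using j by (subst sum.union_disjoint[symmetric]) (auto intro!: sum.cong)
    also have "(\<Sum>i\<in>{j..<CARD('n)}. (norm (cinner (v i) y))\<^sup>2) = (\<Sum>k\<in>K. (norm (T y $ k))\<^sup>2)"
      unfolding K_def by (subst sum.reindex[OF inj]) (simp add: T_def idx)
    finally show ?thesis by (simp only: add_diff_cancel_left')
  qed
  have "distr std_gauss borel (\<lambda>y. \<Sum>k\<in>K. (norm (T y $ k))\<^sup>2) = distr (distr std_gauss borel T) borel (\<lambda>x. \<Sum>k\<in>K. (norm (x $ k))\<^sup>2)"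
    by (subst distr_distr) (auto simp: o_def)
  then show ?thesis
    unfolding eq by (simp add: distr_std_gauss_orthogonal[OF T] distr_sum_norm_std_gauss K)
qed

text \<open>Conditionally on the other rows the law is the Gamma law by the preceding lemma, provided that the
  first \<open>j\<close> rows are linearly independent. This holds almost surely by induction, because the Gamma laws of the
  earlier Gram-Schmidt vectors have no mass at zero.\<close>

lemma distr_norm_gram_schmidt_rows:
  fixes e :: "nat \<Rightarrow> 'n::finite"
  assumes e: "inj_on e {..<CARD('n)}" and j: "j < CARD('n)"
  shows "distr std_gauss borel (\<lambda>a :: complex^'n^'n. (norm (gram_schmidt (\<lambda>k. a $ e k) j))\<^sup>2) = gamma_law (CARD('n) - j)"
  using j
proof (induction j rule: less_induct)
  case (less j)
  let ?G = "std_gauss :: (complex^'n^'n) measure" and ?g = "std_gauss :: (complex^'n) measure"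
  have pg: "prob_space ?g"
    by (intro prob_space_std_gauss_vec prob_space_std_gauss_complex)
  interpret g: prob_space ?g by (rule pg)
  interpret G: prob_space ?G by (rule prob_space_std_gauss_vec[OF pg])
  interpret product_sigma_finite "\<lambda>_::'n. ?g" by standard
  \<comment> \<open>the event that makes the first \<open>j\<close> rows linearly independent; it does not involve row \<open>j\<close>\<close>
  define good where "good a \<longleftrightarrow> (\<forall>i<j. gram_schmidt (\<lambda>k. a $ e k) i \<noteq> 0)" for a :: "complex^'n^'n"
  define h where "h a = (norm (gram_schmidt (\<lambda>k. a $ e k) j))\<^sup>2" for a :: "complex^'n^'n"
  have [measurable]: "h \<in> borel_measurable borel" "Measurable.pred borel good"
    unfolding h_def[abs_def] good_def[abs_def] by measurable
  have AE_good: "AE a in ?G. good a"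
  proof -
    have "AE a in ?G. gram_schmidt (\<lambda>k. a $ e k) i \<noteq> 0" if i: "i < j" for i
    proof -
      have "AE t in distr ?G borel (\<lambda>a. (norm (gram_schmidt (\<lambda>k. a $ e k) i))\<^sup>2). 0 < t"
        unfolding less.IH[OF i less_trans[OF i less.prems]] by (rule AE_gamma_law_pos)
      then show ?thesis by (subst (asm) AE_distr_iff) auto
    qed
    then show ?thesis unfolding good_def by (subst AE_all_countable) auto
  qed
  show ?case
  proof (rule measure_eqI)
    fix B assume "B \<in> sets (distr ?G borel (\<lambda>a. (norm (gram_schmidt (\<lambda>k. a $ e k) j))\<^sup>2))"
    then have [measurable]: "B \<in> sets borel" by simp
    let ?c = "emeasure (gamma_law (CARD('n) - j)) B"
    let ?F = "\<lambda>a. indicator B (h a) * indicator {a. good a} a :: ennreal"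
    have rows: "(\<integral>\<^sup>+a. F a \<partial>?G) = (\<integral>\<^sup>+x. \<integral>\<^sup>+y. F (vec_lambda (x(e j := y))) \<partial>?g \<partial>(\<Pi>\<^sub>M i\<in>UNIV - {e j}. ?g))"
      if [measurable]: "F \<in> borel_measurable borel" for F :: "complex^'n^'n \<Rightarrow> ennreal"
    proof -
      have "(\<integral>\<^sup>+a. F a \<partial>?G) = (\<integral>\<^sup>+x. F (\<chi> i. x i) \<partial>(\<Pi>\<^sub>M i\<in>UNIV. ?g))"
        by (subst std_gauss_vec) (rule nn_integral_distr; measurable)
      also have "UNIV = insert (e j) (UNIV - {e j})" by auto
      finally show ?thesis
        by (subst (asm) product_nn_integral_insert) auto
    qed
    have inner: "(\<integral>\<^sup>+y. ?F (vec_lambda (x(e j := y))) \<partial>?g) = (\<integral>\<^sup>+y. ?c * indicator {a. good a} (vec_lambda (x(e j := y))) \<partial>?g)" for x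
    proof -
      define u where "u k = x (e k)" for k
      have upd: "gram_schmidt (\<lambda>k. (vec_lambda (x(e j := y))) $ e k) i = gram_schmidt (u(j := y)) i" if "i \<le> j" for i y
        using that e less.prems by (intro gram_schmidt_cong) (auto simp: u_def inj_on_def)
      have same: "gram_schmidt (u(j := y)) i = gram_schmidt u i" if "i < j" for i y
        using that by (intro gram_schmidt_cong) auto
      have gram_schmidt_x: "gram_schmidt (\<lambda>k. vec_lambda (x(e j := y)) $ e k) i = gram_schmidt u i" if "i < j" for i y
        by (rule trans[OF upd[OF less_imp_le[OF that]] same[OF that]])
      have good: "good (vec_lambda (x(e j := y))) \<longleftrightarrow> (\<forall>i<j. gram_schmidt u i \<noteq> 0)" for y
        unfolding good_def by (intro iff_allI imp_cong refl) (simp only: gram_schmidt_x)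
      have h: "h (vec_lambda (x(e j := y))) = (norm (gram_schmidt (u(j := y)) j))\<^sup>2" for y
        by (simp only: h_def upd[OF order_refl])
      show ?thesis
      proof (cases "\<forall>i<j. gram_schmidt u i \<noteq> 0")
        case True
        have [measurable]: "(\<lambda>y. gram_schmidt (u(j := y)) j) \<in> borel_measurable borel"
        proof (rule borel_measurable_gram_schmidt)
          show "(\<lambda>y. (u(j := y)) i) \<in> borel_measurable borel" for i by (cases "i = j") simp_all
        qed
        have "(\<integral>\<^sup>+y. ?F (vec_lambda (x(e j := y))) \<partial>?g) = (\<integral>\<^sup>+y. indicator B ((norm (gram_schmidt (u(j := y)) j))\<^sup>2) \<partial>?g)"
          using True by (simp add: good h)
        also have "\<dots> = (\<integral>\<^sup>+t. indicator B t \<partial>distr ?g borel (\<lambda>y. (norm (gram_schmidt (u(j := y)) j))\<^sup>2))"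
          by (rule nn_integral_distr[symmetric]) simp_all
        also have "\<dots> = ?c"
          using True by (subst distr_norm_gram_schmidt_last[OF less.prems]) auto
        finally show ?thesis using True g.emeasure_space_1 by (simp add: good)
      next
        case False
        then show ?thesis by (simp add: good)
      qed
    qed
    have "emeasure (distr ?G borel h) B = (\<integral>\<^sup>+a. indicator B (h a) \<partial>?G)"
      by (simp add: nn_integral_distr flip: nn_integral_indicator)
    also have "\<dots> = (\<integral>\<^sup>+a. ?F a \<partial>?G)"
      using AE_good by (intro nn_integral_cong_AE) auto
    also have "\<dots> = (\<integral>\<^sup>+a. ?c * indicator {a. good a} a \<partial>?G)"
      by (subst (1 2) rows) (simp_all only: inner, measurable)
    also have "\<dots> = (\<integral>\<^sup>+a. ?c \<partial>?G)"
      using AE_good by (intro nn_integral_cong_AE) auto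
    also have "\<dots> = ?c" using G.emeasure_space_1 by simp
    finally show "emeasure (distr ?G borel (\<lambda>a. (norm (gram_schmidt (\<lambda>k. a $ e k) j))\<^sup>2)) B = ?c"
      by (simp add: h_def[abs_def])
  qed simp
qed

lemma borel_measurable_matrix_vector_mult [measurable (raw)]:
  fixes a :: "'b \<Rightarrow> complex^'n^'m"
  assumes "a \<in> borel_measurable M" "f \<in> borel_measurable M"
  shows "(\<lambda>x. a x *v f x) \<in> borel_measurable M"
proof -
  note [measurable] = assms
  show ?thesis unfolding matrix_vector_mult_def by measurable
qed

lemma borel_measurable_matrix_mult [measurable (raw)]:
  fixes a :: "'b \<Rightarrow> complex^'n^'m" and b :: "'b \<Rightarrow> complex^'k^'n"
  assumes "a \<in> borel_measurable M" "b \<in> borel_measurable M"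
  shows "(\<lambda>x. a x ** b x) \<in> borel_measurable M"
proof -
  note [measurable] = assms
  show ?thesis unfolding matrix_matrix_mult_def by measurable
qed

text \<open>A linear map sends the flag of \<open>p\<close> to the flag of its image, so \<open>p\<close> may be replaced by its orthonormalisation
  at the cost of the factor \<open>norm (gram_schmidt p j)\<close>.\<close>

lemma gram_schmidt_matrix_image:
  fixes A :: "complex^'n^'m" and p :: "nat \<Rightarrow> complex^'n"
  assumes nz: "\<And>i. i < j \<Longrightarrow> gram_schmidt p i \<noteq> 0"
  shows "gram_schmidt (\<lambda>k. A *v p k) j
    = of_real (norm (gram_schmidt p j)) *s gram_schmidt (\<lambda>k. A *v ((1 / of_real (norm (gram_schmidt p k))) *s gram_schmidt p k)) j"
proof (cases "gram_schmidt p j = 0")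
  case False
  let ?q = "\<lambda>k. (1 / of_real (norm (gram_schmidt p k))) *s gram_schmidt p k"
  have img: "(\<lambda>k. A *v f k) ` {..<j} = (*v) A ` f ` {..<j}" for f :: "nat \<Rightarrow> complex^'n"
    by (simp add: image_image)
  have "vec.span (?q ` {..<j}) = vec.span (gram_schmidt p ` {..<j})"
  proof -
    have "?q ` {..<j} = (\<lambda>x. (1 / of_real (norm x)) *s x) ` gram_schmidt p ` {..<j}"
      by (simp add: image_image)
    then show ?thesis using nz by (simp only:) (rule vec.span_image_scale, auto)
  qed
  then have span: "vec.span (?q ` {..<j}) = vec.span (p ` {..<j})" by (simp only: span_gram_schmidt)
  show ?thesis
  proof (rule gram_schmidt_change_basis)
    show "vec.span ((\<lambda>k. A *v p k) ` {..<j}) = vec.span ((\<lambda>k. A *v ?q k) ` {..<j})"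
      unfolding img vec.span_image by (simp only: span)
    have "A *v p j - of_real (norm (gram_schmidt p j)) *s (A *v ?q j) = A *v (p j - gram_schmidt p j)"
      using False by (simp add: vec.scale matrix_vector_mult_diff_distrib vec.scale_scale)
    also have "\<dots> \<in> (*v) A ` vec.span (?q ` {..<j})"
      unfolding span using gram_schmidt_minus_in_span[of p j] by blast
    finally show "A *v p j - of_real (norm (gram_schmidt p j)) *s (A *v ?q j) \<in> vec.span ((\<lambda>k. A *v ?q k) ` {..<j})"
      unfolding img vec.span_image .
  qed
next
  case True
  have "A *v p j \<in> vec.span ((\<lambda>k. A *v p k) ` {..<j})"
  proof -
    have "A *v p j \<in> (*v) A ` vec.span (p ` {..<j})"
      using gram_schmidt_minus_in_span[of p j] True by simp
    then show ?thesis by (simp add: vec.span_image[symmetric] image_image)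
  qed
  then have "gram_schmidt (\<lambda>k. A *v p k) j = 0" by (intro gram_schmidt_unique) auto
  then show ?thesis using True by simp
qed

text \<open>Multiplying a Gaussian matrix by the unitary matrix with columns \<open>q k\<close> does not change its law, so the
  images of the orthonormal vectors \<open>q k\<close> are distributed like the rows of a Gaussian matrix.\<close>

lemma nn_integral_gram_schmidt_gauss_times:
  fixes p :: "nat \<Rightarrow> complex^'n"
  assumes j: "j < CARD('n)" and nz: "\<And>i. i < CARD('n) \<Longrightarrow> gram_schmidt p i \<noteq> 0"
    and f [measurable]: "f \<in> borel_measurable borel"
  shows "(\<integral>\<^sup>+a. f ((norm (gram_schmidt (\<lambda>k. a *v p k) j))\<^sup>2) \<partial>(std_gauss :: (complex^'n^'n) measure))
    = (\<integral>\<^sup>+t. f ((norm (gram_schmidt p j))\<^sup>2 * t) \<partial>gamma_law (CARD('n) - j))"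
proof -
  obtain e where e: "bij_betw e {..<CARD('n)} (UNIV :: 'n set)"
    using ex_bij_betw_nat_finite[of "UNIV :: 'n set"] by (auto simp: atLeast0LessThan)
  obtain idx where idx: "bij_betw idx (UNIV :: 'n set) {..<CARD('n)}"
    "\<And>a. e (idx a) = a" "\<And>i. i < CARD('n) \<Longrightarrow> idx (e i) = i"
    using bij_betw_index[OF e] by auto
  define q where "q k = (1 / of_real (norm (gram_schmidt p k))) *s gram_schmidt p k" for k
  have q: "orthonormal q CARD('n)"
    unfolding q_def by (rule orthonormal_normalized_gram_schmidt[OF nz])
  define T where "T a = (\<chi> k. a *v q (idx k))" for a :: "complex^'n^'n"
  have T: "orthogonal_transformation T"
    unfolding T_def by (rule orthogonal_transformation_matrix_columns[OF q idx(1)])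
  have [measurable]: "T \<in> borel \<rightarrow>\<^sub>M borel" by (rule orthogonal_transformation_borel[OF T])
  let ?h = "\<lambda>a :: complex^'n^'n. (norm (gram_schmidt (\<lambda>k. a $ e k) j))\<^sup>2"
  have eq: "(norm (gram_schmidt (\<lambda>k. a *v p k) j))\<^sup>2 = (norm (gram_schmidt p j))\<^sup>2 * ?h (T a)" for a
  proof -
    have "gram_schmidt (\<lambda>k. a *v p k) j = of_real (norm (gram_schmidt p j)) *s gram_schmidt (\<lambda>k. a *v q k) j"
      unfolding q_def using j nz by (intro gram_schmidt_matrix_image) auto
    also have "gram_schmidt (\<lambda>k. a *v q k) j = gram_schmidt (\<lambda>k. T a $ e k) j"
      using j by (intro gram_schmidt_cong) (simp add: T_def idx)
    finally show ?thesis by (simp add: norm_cscale power_mult_distrib)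
  qed
  have "(\<integral>\<^sup>+a. f ((norm (gram_schmidt (\<lambda>k. a *v p k) j))\<^sup>2) \<partial>(std_gauss :: (complex^'n^'n) measure)) = (\<integral>\<^sup>+a. f ((norm (gram_schmidt p j))\<^sup>2 * ?h (T a)) \<partial>std_gauss)"
    by (simp only: eq)
  also have "\<dots> = (\<integral>\<^sup>+a. f ((norm (gram_schmidt p j))\<^sup>2 * ?h a) \<partial>distr std_gauss borel T)"
    by (rule nn_integral_distr[symmetric]) measurable
  also have "\<dots> = (\<integral>\<^sup>+t. f ((norm (gram_schmidt p j))\<^sup>2 * t) \<partial>distr std_gauss borel ?h)"
    unfolding distr_std_gauss_orthogonal[OF T] by (rule nn_integral_distr[symmetric]) measurable
  also have "distr std_gauss borel ?h = gamma_law (CARD('n) - j)"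
    using e j by (intro distr_norm_gram_schmidt_rows) (auto simp: bij_betw_def)
  finally show ?thesis .
qed

lemma (in prob_space) distr_vec_std_gauss:
  fixes X :: "'n::finite \<Rightarrow> 'a \<Rightarrow> 'b::euclidean_space"
  assumes ind: "indep_vars (\<lambda>_. borel) X UNIV" and X: "\<And>i. distr M borel (X i) = std_gauss"
  shows "distr M borel (\<lambda>\<omega>. \<chi> i. X i \<omega>) = std_gauss"
proof -
  have [measurable]: "X i \<in> borel_measurable M" for i
    using ind by (auto simp: indep_vars_def)
  have "distr M (\<Pi>\<^sub>M i\<in>UNIV. borel) (\<lambda>\<omega>. \<lambda>i\<in>UNIV. X i \<omega>) = (\<Pi>\<^sub>M i\<in>UNIV. std_gauss)"
    using ind by (subst (asm) indep_vars_iff_distr_eq_PiM') (auto simp: X)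
  then have "std_gauss = distr (distr M (\<Pi>\<^sub>M i\<in>UNIV. borel) (\<lambda>\<omega>. \<lambda>i\<in>UNIV. X i \<omega>)) borel (\<lambda>f. \<chi> i. f i)"
    unfolding std_gauss_vec by simp
  also have "\<dots> = distr M borel (\<lambda>\<omega>. \<chi> i. X i \<omega>)"
  proof (subst distr_distr)
    have "(\<lambda>f. \<chi> i. f i) \<circ> (\<lambda>\<omega>. \<lambda>i\<in>UNIV. X i \<omega>) = (\<lambda>\<omega>. \<chi> i. X i \<omega>)"
      by (simp add: fun_eq_iff vec_eq_iff)
    then show "distr M borel ((\<lambda>f. \<chi> i. f i) \<circ> (\<lambda>\<omega>. \<lambda>i\<in>UNIV. X i \<omega>)) = distr M borel (\<lambda>\<omega>. \<chi> i. X i \<omega>)"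
      by (rule arg_cong)
  qed measurable
  finally show ?thesis by simp
qed

text \<open>Matrices are vectors of rows, so independence of the entries is used twice: first within a row,
  then between the rows.\<close>

lemma (in prob_space) distr_complex_gaussian_matrix:
  assumes G: "complex_gaussian_matrix M G"
  shows "distr M borel G = (std_gauss :: (complex^'n^'n) measure)"
proof -
  have "indep_vars (\<lambda>_. borel) (\<lambda>(i, j) \<omega>. G \<omega> $ i $ j) UNIV"
    and entry: "\<And>i j. distributed M lborel (\<lambda>\<omega>. G \<omega> $ i $ j) std_complex_normal_density"
    using G by (auto simp: complex_gaussian_matrix_def)
  then have ind: "indep_vars (\<lambda>_. borel) (\<lambda>p \<omega>. G \<omega> $ fst p $ snd p) UNIV"
    by (simp add: case_prod_beta')
  have dens: "distr M borel (\<lambda>\<omega>. G \<omega> $ i $ j) = std_gauss" for i j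
  proof -
    have "distr M borel (\<lambda>\<omega>. G \<omega> $ i $ j) = distr M lborel (\<lambda>\<omega>. G \<omega> $ i $ j)"
      by (intro distr_cong) auto
    then show ?thesis using entry[of i j] by (simp add: distributed_def std_gauss_complex)
  qed
  have row: "distr M borel (\<lambda>\<omega>. \<chi> j. G \<omega> $ i $ j) = (std_gauss :: (complex^'n) measure)" for i
  proof (rule distr_vec_std_gauss[OF _ dens])
    have "indep_vars (\<lambda>j. \<Pi>\<^sub>M _\<in>{(i, j)}. borel) (\<lambda>j \<omega>. restrict (\<lambda>p. G \<omega> $ fst p $ snd p) {(i, j)}) UNIV"
      using indep_vars_restrict[OF ind, of UNIV "\<lambda>j. {(i, j)}"]
      by (simp add: disjoint_family_on_def)
    then have "indep_vars (\<lambda>_. borel) (\<lambda>j \<omega>. (restrict (\<lambda>p. G \<omega> $ fst p $ snd p) {(i, j)}) (i, j)) UNIV"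
      by (rule indep_vars_compose2[where Y = "\<lambda>j f. f (i, j)"]) (intro measurable_component_singleton; simp)
    then show "indep_vars (\<lambda>_. borel) (\<lambda>j \<omega>. G \<omega> $ i $ j) UNIV" by simp
  qed
  have "indep_vars (\<lambda>i. \<Pi>\<^sub>M _\<in>{i} \<times> UNIV. borel) (\<lambda>i \<omega>. restrict (\<lambda>p. G \<omega> $ fst p $ snd p) ({i} \<times> UNIV)) UNIV"
    using indep_vars_restrict[OF ind, of UNIV "\<lambda>i. {i} \<times> UNIV"]
    by (simp add: disjoint_family_on_def disjoint_iff)
  then have "indep_vars (\<lambda>_. borel) (\<lambda>i \<omega>. \<chi> j. (restrict (\<lambda>p. G \<omega> $ fst p $ snd p) ({i} \<times> UNIV)) (i, j)) UNIV"
    by (rule indep_vars_compose2[where Y = "\<lambda>i f. \<chi> j. f (i, j)"])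
      (intro borel_measurable_vec_lambda measurable_component_singleton; simp)
  then have "indep_vars (\<lambda>_. borel) (\<lambda>i \<omega>. \<chi> j. G \<omega> $ i $ j) UNIV" by simp
  from distr_vec_std_gauss[OF this row] show ?thesis by simp
qed

section \<open>Almost sure growth rates of a product of Gaussian matrices\<close>

lemma nn_integral_gamma_law_powr:
  assumes r: "r > 0" and s: "- real r < s"
  shows "(\<integral>\<^sup>+t. ennreal (t powr s) \<partial>gamma_law r) = ennreal (Gamma (real r + s) / Gamma (real r))"
proof -
  let ?f = "\<lambda>t::real. t powr (real r + s - 1) / exp t / fact (r - 1)"
  have "((\<lambda>t. t powr (real r + s - 1) / exp t) has_integral Gamma (real r + s)) {0..}"
    using s by (intro Gamma_integral_real) simp
  then have I: "(?f has_integral Gamma (real r + s) / fact (r - 1)) {0..}"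
    by (rule has_integral_divide)
  have "Gamma (1 + real (r - 1)) = fact (r - 1)" by (rule Gamma_fact)
  then have fact: "fact (r - 1) = Gamma (real r)" using r by simp
  have "(\<integral>\<^sup>+t. ennreal (t powr s) \<partial>gamma_law r)
      = (\<integral>\<^sup>+t. ennreal (erlang_density (r - 1) 1 t) * ennreal (t powr s) \<partial>lborel)"
    unfolding gamma_law_def by (rule nn_integral_density) measurable
  also have "\<dots> = (\<integral>\<^sup>+t. ennreal (?f t) * indicator {0..} t \<partial>lborel)"
  proof (rule nn_integral_cong)
    fix t :: real
    consider "t < 0" | "t = 0" | "t > 0" by linarith
    then show "ennreal (erlang_density (r - 1) 1 t) * ennreal (t powr s) = ennreal (?f t) * indicator {0..} t"
    proof cases
      case 3
      have "t ^ (r - 1) * t powr s = t powr (real r + s - 1)"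
        using 3 r by (simp add: powr_add[symmetric] algebra_simps flip: powr_realpow)
      then have "erlang_density (r - 1) 1 t * t powr s = ?f t"
        using 3 by (simp add: erlang_density_def exp_minus field_simps)
      then show ?thesis using 3 by (simp flip: ennreal_mult)
    qed (auto simp: erlang_density_def)
  qed
  also have "\<dots> = ennreal (Gamma (real r + s) / fact (r - 1))"
    using I by (intro nn_integral_has_integral_lebesgue') auto
  finally show ?thesis by (simp only: fact)
qed

text \<open>The logarithm of the ratio has derivative \<open>Digamma r\<close> at \<open>s = 0\<close>, so the line with the larger slope \<open>b\<close> lies above it
  just to the right of zero.\<close>

lemma Gamma_ratio_less_exp_right:
  assumes r: "r > (0::real)" and b: "Digamma r < b"
  shows "\<exists>s>0. Gamma (r + s) / Gamma r < exp (s * b)"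
proof -
  have "((\<lambda>s. s * b - ln_Gamma (r + s)) has_real_derivative b - Digamma r) (at 0)"
    using r by (auto intro!: derivative_eq_intros)
  from DERIV_pos_inc_right[OF this] b
  obtain \<delta> where \<delta>: "\<delta> > 0" "\<And>h. 0 < h \<Longrightarrow> h < \<delta> \<Longrightarrow> - ln_Gamma r < h * b - ln_Gamma (r + h)"
    by auto
  \<comment> \<open>any point strictly inside the interval of validity will do\<close>
  define s where "s = \<delta> / 2"
  have s: "s > 0" "s < \<delta>" using \<delta>(1) by (auto simp: s_def)
  have "Gamma (r + s) / Gamma r = exp (ln_Gamma (r + s) - ln_Gamma r)"
    using r s by (simp add: Gamma_real_pos_exp exp_diff)
  also have "\<dots> < exp (s * b)" using \<delta>(2)[OF s] by simp
  finally show ?thesis using s by blast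
qed

lemma Gamma_ratio_less_exp_left:
  assumes r: "r > (0::real)" and b: "b < Digamma r"
  shows "\<exists>s<0. - r < s \<and> Gamma (r + s) / Gamma r < exp (s * b)"
proof -
  have "((\<lambda>s. s * b - ln_Gamma (r + s)) has_real_derivative b - Digamma r) (at 0)"
    using r by (auto intro!: derivative_eq_intros)
  from DERIV_neg_dec_left[OF this] b
  obtain \<delta> where \<delta>: "\<delta> > 0" "\<And>h. 0 < h \<Longrightarrow> h < \<delta> \<Longrightarrow> - ln_Gamma r < (- h) * b - ln_Gamma (r + (- h))"
    by auto
  \<comment> \<open>also below \<open>r\<close>, so that \<open>r - h\<close> stays in the domain of positivity of \<open>Gamma\<close>\<close>
  define h where "h = min \<delta> r / 2"
  have h: "h > 0" "h < \<delta>" "h < r" using \<delta>(1) r by (auto simp: h_def)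
  have "Gamma (r + (- h)) / Gamma r = exp (ln_Gamma (r + (- h)) - ln_Gamma r)"
    using r h by (simp add: Gamma_real_pos_exp exp_diff)
  also have "\<dots> < exp ((- h) * b)" using \<delta>(2)[OF h(1,2)] by simp
  finally show ?thesis using h by (intro exI[of _ "- h"]) auto
qed

text \<open>Markov's inequality and the Borel-Cantelli lemma.\<close>

lemma (in prob_space) AE_eventually_less_1:
  assumes Y [measurable]: "\<And>N. Y N \<in> borel_measurable M"
    and int: "\<And>N. (\<integral>\<^sup>+\<omega>. ennreal (Y N \<omega>) \<partial>M) \<le> ennreal (K * c ^ N)"
    and c: "0 \<le> c" "c < 1" and K: "0 \<le> K"
  shows "AE \<omega> in M. \<forall>\<^sub>F N in sequentially. Y N \<omega> < 1"
proof -
  define B where "B N = {\<omega> \<in> space M. 1 \<le> Y N \<omega>}" for N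
  have [measurable]: "B N \<in> sets M" for N unfolding B_def by measurable
  have le: "measure M (B N) \<le> K * c ^ N" for N
  proof -
    have "emeasure M (B N) = (\<integral>\<^sup>+\<omega>. indicator (B N) \<omega> \<partial>M)" by simp
    also have "\<dots> \<le> (\<integral>\<^sup>+\<omega>. ennreal (Y N \<omega>) \<partial>M)"
      by (intro nn_integral_mono) (auto simp: B_def indicator_def simp flip: ennreal_1 intro: ennreal_leI)
    also have "\<dots> \<le> ennreal (K * c ^ N)" by (rule int)
    finally show ?thesis using K c by (simp add: emeasure_eq_measure)
  qed
  have "summable (\<lambda>N. measure M (B N))"
  proof (rule summable_comparison_test'[where N = 0])
    show "summable (\<lambda>N. K * c ^ N)" using c by (intro summable_mult summable_geometric) simp
    show "norm (measure M (B N)) \<le> K * c ^ N" for N using le[of N] by simp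
  qed
  then have "AE \<omega> in M. \<forall>\<^sub>F N in sequentially. \<omega> \<in> space M - B N"
    by (intro borel_cantelli_AE1) (auto simp: emeasure_eq_measure)
  then show ?thesis
    by (rule AE_mp) (intro AE_I2 impI, auto simp: B_def not_le elim: eventually_mono)
qed

lemma matrix_product_cong: "(\<And>k. k \<in> {1..N} \<Longrightarrow> f k = h k) \<Longrightarrow> matrix_product f N = matrix_product h N"
  by (induction N) auto

locale gaussian_product = prob_space M for M :: "'a measure" +
  fixes A :: "nat \<Rightarrow> 'a \<Rightarrow> complex^'n^'n" and e :: "nat \<Rightarrow> 'n"
  assumes indep: "indep_vars (\<lambda>_. borel) A {1..}"
    and gaussian: "\<And>k. k \<ge> 1 \<Longrightarrow> complex_gaussian_matrix M (A k)"
    and e: "bij_betw e {..<CARD('n)} UNIV"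
begin

definition partial_product :: "nat \<Rightarrow> 'a \<Rightarrow> complex^'n^'n" where
  "partial_product N \<omega> = matrix_product (\<lambda>k. A k \<omega>) N"

definition columns :: "complex^'n^'n \<Rightarrow> nat \<Rightarrow> complex^'n" where
  "columns a k = a *v axis (e k) 1"

definition random_frame :: "nat \<Rightarrow> nat \<Rightarrow> 'a \<Rightarrow> complex^'n" where
  "random_frame N j \<omega> = gram_schmidt (columns (partial_product N \<omega>)) j"

lemma frame_eq_random_frame: "frame (\<lambda>k. A k \<omega>) e N j = random_frame N j \<omega>"
  by (simp add: frame_def random_frame_def columns_def[abs_def] partial_product_def)

lemma A_measurable [measurable]: "A (Suc N) \<in> borel_measurable M"
  using indep by (auto simp: indep_vars_def)

lemma columns_measurable [measurable (raw)]:
  "f \<in> borel_measurable N \<Longrightarrow> (\<lambda>x. columns (f x) k) \<in> borel_measurable N"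
  unfolding columns_def by (intro borel_measurable_matrix_vector_mult borel_measurable_const)

lemma partial_product_measurable [measurable]: "partial_product N \<in> borel_measurable M"
  unfolding partial_product_def[abs_def]
  by (induction N) (simp_all add: borel_measurable_matrix_mult)

lemma random_frame_measurable [measurable]: "random_frame N j \<in> borel_measurable M"
  unfolding random_frame_def[abs_def] by measurable

lemma indep_factor_partial_product: "indep_var borel (A (Suc N)) borel (partial_product N)"
proof -
  have "(\<lambda>f. matrix_product f n) \<in> borel_measurable (\<Pi>\<^sub>M k\<in>{1..N}. (borel :: (complex^'n^'n) measure))" if "n \<le> N" for n
    using that
  proof (induction n)
    case (Suc n)
    have [measurable]: "(\<lambda>f. matrix_product f n) \<in> borel_measurable (\<Pi>\<^sub>M k\<in>{1..N}. (borel :: (complex^'n^'n) measure))"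
      using Suc by simp
    have [measurable]: "(\<lambda>f. f (Suc n)) \<in> borel_measurable (\<Pi>\<^sub>M k\<in>{1..N}. (borel :: (complex^'n^'n) measure))"
      using Suc.prems by (intro measurable_component_singleton) simp
    show ?case unfolding matrix_product.simps by (rule borel_measurable_matrix_mult) measurable
  qed simp
  then have m: "(\<lambda>f. matrix_product f N) \<in> borel_measurable (\<Pi>\<^sub>M k\<in>{1..N}. (borel :: (complex^'n^'n) measure))"
    by simp
  have "indep_var (\<Pi>\<^sub>M k\<in>{Suc N}. borel) (\<lambda>\<omega>. restrict (\<lambda>k. A k \<omega>) {Suc N}) (\<Pi>\<^sub>M k\<in>{1..N}. borel) (\<lambda>\<omega>. restrict (\<lambda>k. A k \<omega>) {1..N})"
    by (rule indep_var_restrict[OF indep]) auto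
  from indep_var_compose[OF this _ m, of "\<lambda>f. f (Suc N)" borel]
  have "indep_var borel ((\<lambda>f. f (Suc N)) \<circ> (\<lambda>\<omega>. restrict (\<lambda>k. A k \<omega>) {Suc N}))
      borel ((\<lambda>f. matrix_product f N) \<circ> (\<lambda>\<omega>. restrict (\<lambda>k. A k \<omega>) {1..N}))"
    by (simp add: measurable_component_singleton)
  moreover have "(\<lambda>f. f (Suc N)) \<circ> (\<lambda>\<omega>. restrict (\<lambda>k. A k \<omega>) {Suc N}) = A (Suc N)"
    by (simp add: fun_eq_iff)
  moreover have "(\<lambda>f. matrix_product f N) \<circ> (\<lambda>\<omega>. restrict (\<lambda>k. A k \<omega>) {1..N}) = partial_product N"
    unfolding fun_eq_iff partial_product_def o_def by (auto intro!: matrix_product_cong)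
  ultimately show ?thesis by simp
qed

text \<open>Condition on the product of the first \<open>N\<close> factors: by independence the next factor is a Gaussian matrix
  whatever that product is.\<close>

lemma nn_integral_step:
  assumes j: "j < CARD('n)" and good: "AE \<omega> in M. \<forall>i<CARD('n). random_frame N i \<omega> \<noteq> 0"
    and f [measurable]: "f \<in> borel_measurable borel"
  shows "(\<integral>\<^sup>+\<omega>. f ((norm (random_frame (Suc N) j \<omega>))\<^sup>2) \<partial>M)
    = (\<integral>\<^sup>+\<omega>. \<integral>\<^sup>+t. f ((norm (random_frame N j \<omega>))\<^sup>2 * t) \<partial>gamma_law (CARD('n) - j) \<partial>M)"
proof -
  let ?G = "std_gauss :: (complex^'n^'n) measure" and ?L = "distr M borel (partial_product N)"
  have law: "distr M borel (A (Suc N)) = ?G"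
    by (rule distr_complex_gaussian_matrix) (simp add: gaussian)
  interpret G: prob_space ?G
    unfolding law[symmetric] by (rule prob_space_distr) measurable
  interpret L: prob_space ?L by (rule prob_space_distr) measurable
  interpret pair_sigma_finite ?G ?L by standard
  define H where "H a p = f ((norm (gram_schmidt (\<lambda>k. a *v columns p k) j))\<^sup>2)" for a p :: "complex^'n^'n"
  have [measurable]: "case_prod H \<in> borel_measurable (borel \<Otimes>\<^sub>M borel)"
    unfolding H_def[abs_def] case_prod_beta' by measurable
  have frame_Suc: "random_frame (Suc N) j \<omega> = gram_schmidt (\<lambda>k. A (Suc N) \<omega> *v columns (partial_product N \<omega>) k) j" for \<omega>
    by (simp add: random_frame_def partial_product_def columns_def[abs_def] matrix_vector_mul_assoc)
  have "(\<integral>\<^sup>+\<omega>. f ((norm (random_frame (Suc N) j \<omega>))\<^sup>2) \<partial>M) = (\<integral>\<^sup>+\<omega>. case_prod H (A (Suc N) \<omega>, partial_product N \<omega>) \<partial>M)"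
    by (simp add: frame_Suc H_def)
  also have "\<dots> = (\<integral>\<^sup>+x. case_prod H x \<partial>distr M (borel \<Otimes>\<^sub>M borel) (\<lambda>\<omega>. (A (Suc N) \<omega>, partial_product N \<omega>)))"
    by (rule nn_integral_distr[symmetric]) measurable
  also have "distr M (borel \<Otimes>\<^sub>M borel) (\<lambda>\<omega>. (A (Suc N) \<omega>, partial_product N \<omega>)) = ?G \<Otimes>\<^sub>M ?L"
    using indep_factor_partial_product[of N] by (simp add: indep_var_distribution_eq law)
  also have "(\<integral>\<^sup>+x. case_prod H x \<partial>(?G \<Otimes>\<^sub>M ?L)) = (\<integral>\<^sup>+p. \<integral>\<^sup>+a. H a p \<partial>?G \<partial>?L)"
    by (subst nn_integral_snd[symmetric]) auto
  also have "\<dots> = (\<integral>\<^sup>+\<omega>. \<integral>\<^sup>+a. H a (partial_product N \<omega>) \<partial>?G \<partial>M)"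
    by (rule nn_integral_distr) measurable
  also have "\<dots> = (\<integral>\<^sup>+\<omega>. \<integral>\<^sup>+t. f ((norm (random_frame N j \<omega>))\<^sup>2 * t) \<partial>gamma_law (CARD('n) - j) \<partial>M)"
  proof (rule nn_integral_cong_AE, rule AE_mp[OF good], rule AE_I2, rule impI)
    fix \<omega> assume "\<forall>i<CARD('n). random_frame N i \<omega> \<noteq> 0"
    then show "(\<integral>\<^sup>+a. H a (partial_product N \<omega>) \<partial>?G) = (\<integral>\<^sup>+t. f ((norm (random_frame N j \<omega>))\<^sup>2 * t) \<partial>gamma_law (CARD('n) - j))"
      unfolding H_def random_frame_def by (intro nn_integral_gram_schmidt_gauss_times[OF j _ f]) auto
  qed
  finally show ?thesis .
qed

lemma random_frame_0: "j < CARD('n) \<Longrightarrow> random_frame 0 j \<omega> = axis (e j) 1"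
proof -
  assume j: "j < CARD('n)"
  have inj: "inj_on e {..<CARD('n)}" using e by (simp add: bij_betw_def)
  have "gram_schmidt (\<lambda>k. axis (e k) 1) j = (axis (e j) 1 :: complex^'n)"
  proof (rule gram_schmidt_unique)
    fix y assume "y \<in> vec.span ((\<lambda>k. axis (e k) 1 :: complex^'n) ` {..<j})"
    then show "cinner (axis (e j) 1) y = 0"
    proof (rule cinner_eq_0_span[rotated])
      fix y assume "y \<in> (\<lambda>k. axis (e k) 1 :: complex^'n) ` {..<j}"
      then obtain k where k: "k < j" "y = axis (e k) 1" by auto
      then have "e k \<noteq> e j" using inj j by (auto simp: inj_on_def)
      then have "axis (e j) 1 $ e k = (0 :: complex)" by (simp add: axis_def)
      then show "cinner (axis (e j) 1) y = 0" by (simp add: k)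
    qed
  qed (simp add: vec.span_zero)
  then show ?thesis by (simp add: random_frame_def columns_def[abs_def] partial_product_def)
qed

text \<open>Each step multiplies the squared length by a Gamma variable, which is almost surely positive.\<close>

lemma AE_random_frame_nonzero: "AE \<omega> in M. \<forall>j<CARD('n). random_frame N j \<omega> \<noteq> 0"
proof (induction N)
  case 0
  show ?case by (rule AE_I2) (simp add: random_frame_0 axis_eq_0_iff)
next
  case (Suc N)
  have "AE \<omega> in M. random_frame (Suc N) j \<omega> \<noteq> 0" if j: "j < CARD('n)" for j
  proof -
    have "(\<integral>\<^sup>+\<omega>. indicator {0} ((norm (random_frame (Suc N) j \<omega>))\<^sup>2) \<partial>M)
      = (\<integral>\<^sup>+\<omega>. \<integral>\<^sup>+t. indicator {0} ((norm (random_frame N j \<omega>))\<^sup>2 * t) \<partial>gamma_law (CARD('n) - j) \<partial>M)"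
      by (rule nn_integral_step[OF j Suc]) measurable
    also have "\<dots> = (\<integral>\<^sup>+\<omega>. 0 \<partial>M)"
    proof (rule nn_integral_cong_AE, rule AE_mp[OF Suc], rule AE_I2, rule impI)
      fix \<omega> assume "\<forall>i<CARD('n). random_frame N i \<omega> \<noteq> 0"
      then have nz: "random_frame N j \<omega> \<noteq> 0" using j by blast
      have "(\<integral>\<^sup>+t. indicator {0} ((norm (random_frame N j \<omega>))\<^sup>2 * t) \<partial>gamma_law (CARD('n) - j)) = (\<integral>\<^sup>+t. 0 \<partial>gamma_law (CARD('n) - j))"
        by (rule nn_integral_cong_AE, rule AE_mp[OF AE_gamma_law_pos]) (auto simp: nz)
      then show "(\<integral>\<^sup>+t. indicator {0} ((norm (random_frame N j \<omega>))\<^sup>2 * t) \<partial>gamma_law (CARD('n) - j)) = 0" by simp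
    qed
    finally have "(\<integral>\<^sup>+\<omega>. indicator {0} ((norm (random_frame (Suc N) j \<omega>))\<^sup>2) \<partial>M) = 0" by simp
    then have "AE \<omega> in M. indicator {0} ((norm (random_frame (Suc N) j \<omega>))\<^sup>2) = (0 :: ennreal)"
      by (subst (asm) nn_integral_0_iff_AE) measurable
    then show ?thesis by (rule AE_mp) (auto simp: indicator_def)
  qed
  then show ?case by (subst AE_all_countable) auto
qed

lemma AE_random_frames_nonzero: "AE \<omega> in M. \<forall>N. \<forall>j<CARD('n). random_frame N j \<omega> \<noteq> 0"
  by (rule AE_all_countable[THEN iffD2]) (intro allI AE_random_frame_nonzero)

text \<open>Each step multiplies the moment by that of an independent Gamma variable.\<close>

lemma moment_random_frame:
  assumes j: "j < CARD('n)" and s: "- real (CARD('n) - j) < s"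
  shows "(\<integral>\<^sup>+\<omega>. ennreal ((norm (random_frame N j \<omega>))\<^sup>2 powr s) \<partial>M)
    = ennreal ((Gamma (real (CARD('n) - j) + s) / Gamma (real (CARD('n) - j))) ^ N)"
proof (induction N)
  case 0
  have "norm (axis (e j) 1 :: complex^'n) = 1"
    by (rule norm_Basis) (auto simp: Basis_vec_def)
  then show ?case using j emeasure_space_1 by (simp add: random_frame_0)
next
  case (Suc N)
  let ?m = "Gamma (real (CARD('n) - j) + s) / Gamma (real (CARD('n) - j))"
  have m0: "0 \<le> ?m" using j s by (intro divide_nonneg_nonneg less_imp_le[OF Gamma_real_pos]) auto
  have "(\<integral>\<^sup>+\<omega>. ennreal ((norm (random_frame (Suc N) j \<omega>))\<^sup>2 powr s) \<partial>M)
    = (\<integral>\<^sup>+\<omega>. \<integral>\<^sup>+t. ennreal (((norm (random_frame N j \<omega>))\<^sup>2 * t) powr s) \<partial>gamma_law (CARD('n) - j) \<partial>M)"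
    by (rule nn_integral_step[OF j AE_random_frame_nonzero]) measurable
  also have "\<dots> = (\<integral>\<^sup>+\<omega>. ennreal ((norm (random_frame N j \<omega>))\<^sup>2 powr s) * ennreal ?m \<partial>M)"
  proof (rule nn_integral_cong)
    fix \<omega>
    have "(\<integral>\<^sup>+t. ennreal (((norm (random_frame N j \<omega>))\<^sup>2 * t) powr s) \<partial>gamma_law (CARD('n) - j))
      = (\<integral>\<^sup>+t. ennreal ((norm (random_frame N j \<omega>))\<^sup>2 powr s) * ennreal (t powr s) \<partial>gamma_law (CARD('n) - j))"
      by (rule nn_integral_cong_AE, rule AE_mp[OF AE_gamma_law_pos])
        (auto simp: powr_mult simp flip: ennreal_mult)
    also have "\<dots> = ennreal ((norm (random_frame N j \<omega>))\<^sup>2 powr s) * ennreal ?m"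
      using j s by (subst nn_integral_cmult) (auto simp: nn_integral_gamma_law_powr)
    finally show "(\<integral>\<^sup>+t. ennreal (((norm (random_frame N j \<omega>))\<^sup>2 * t) powr s) \<partial>gamma_law (CARD('n) - j))
      = ennreal ((norm (random_frame N j \<omega>))\<^sup>2 powr s) * ennreal ?m" .
  qed
  also have "\<dots> = ennreal (?m ^ N) * ennreal ?m"
    by (subst nn_integral_multc) (auto simp: Suc)
  also have "\<dots> = ennreal (?m ^ Suc N)"
    using m0 by (simp add: mult.commute flip: ennreal_mult)
  finally show ?case .
qed

text \<open>The moments of order \<open>s\<close>, after division by \<open>exp (N s b)\<close>, decay geometrically. Taking logarithms
  bounds \<open>ln\<close> of the squared length from above if \<open>s\<close> is positive and from below if \<open>s\<close> is negative.\<close>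

lemma AE_tilted_bound:
  assumes j: "j < CARD('n)" and s: "- real (CARD('n) - j) < s"
    and less: "Gamma (real (CARD('n) - j) + s) / Gamma (real (CARD('n) - j)) < exp (s * b)"
  shows "AE \<omega> in M. \<forall>\<^sub>F N in sequentially. s * (2 * ln (norm (random_frame N j \<omega>))) < real N * (s * b)"
proof -
  let ?m = "Gamma (real (CARD('n) - j) + s) / Gamma (real (CARD('n) - j))"
  define c where "c = ?m * exp (- (s * b))"
  have m0: "0 \<le> ?m" using j s by (intro divide_nonneg_nonneg less_imp_le[OF Gamma_real_pos]) auto
  have c0: "0 \<le> c" unfolding c_def by (rule mult_nonneg_nonneg[OF m0]) simp
  have "c < exp (s * b) * exp (- (s * b))"
    unfolding c_def using less by (rule mult_strict_right_mono) simp
  then have c1: "c < 1" by (simp flip: exp_add)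
  have "AE \<omega> in M. \<forall>\<^sub>F N in sequentially. (norm (random_frame N j \<omega>))\<^sup>2 powr s * exp (- (s * b)) ^ N < 1"
  proof (rule AE_eventually_less_1[OF _ _ c0 c1])
    fix N
    have "(\<integral>\<^sup>+\<omega>. ennreal ((norm (random_frame N j \<omega>))\<^sup>2 powr s * exp (- (s * b)) ^ N) \<partial>M)
      = (\<integral>\<^sup>+\<omega>. ennreal ((norm (random_frame N j \<omega>))\<^sup>2 powr s) * ennreal (exp (- (s * b)) ^ N) \<partial>M)"
      by (simp add: ennreal_mult)
    also have "\<dots> = ennreal (?m ^ N) * ennreal (exp (- (s * b)) ^ N)"
      by (subst nn_integral_multc) (auto simp: moment_random_frame[OF j s])
    also have "\<dots> = ennreal (?m ^ N * exp (- (s * b)) ^ N)"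
      by (rule ennreal_mult[symmetric]) (auto intro: zero_le_power[OF m0])
    also have "\<dots> = ennreal (1 * c ^ N)"
      by (simp only: c_def power_mult_distrib mult_1)
    finally show "(\<integral>\<^sup>+\<omega>. ennreal ((norm (random_frame N j \<omega>))\<^sup>2 powr s * exp (- (s * b)) ^ N) \<partial>M) \<le> ennreal (1 * c ^ N)"
      by simp
  qed auto
  moreover have "AE \<omega> in M. \<forall>N. random_frame N j \<omega> \<noteq> 0"
    using AE_random_frames_nonzero by eventually_elim (use j in blast)
  ultimately show ?thesis
  proof eventually_elim
    case (elim \<omega>)
    from elim(1) show ?case
    proof eventually_elim
      case (elim N)
      let ?x = "norm (random_frame N j \<omega>)"
      have pos: "?x > 0" using \<open>\<forall>N. random_frame N j \<omega> \<noteq> 0\<close> by simp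
      have "?x\<^sup>2 powr s = exp (s * (2 * ln ?x))"
        using pos by (simp add: powr_def ln_realpow)
      then have "exp (s * (2 * ln ?x)) * exp (- (real N * (s * b))) < 1"
        using elim by (simp flip: exp_of_nat_mult)
      then have "exp (s * (2 * ln ?x) + - (real N * (s * b))) < exp 0"
        by (simp only: exp_add exp_zero)
      then have "s * (2 * ln ?x) + - (real N * (s * b)) < 0" by (simp only: exp_less_cancel_iff)
      then show ?case by linarith
    qed
  qed
qed

lemma AE_growth:
  assumes j: "j < CARD('n)" and \<delta>: "\<delta> > 0"
  defines "m \<equiv> Digamma (real (CARD('n) - j)) / 2"
  shows "AE \<omega> in M. \<forall>\<^sub>F N in sequentially. norm (random_frame N j \<omega>) \<le> exp (real N * (m + \<delta>)) \<and>
    inverse (norm (random_frame N j \<omega>)) \<le> exp (real N * (- m + \<delta>))"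
proof -
  let ?r = "real (CARD('n) - j)"
  have r: "?r > 0" using j by simp
  obtain s where s: "s > 0" "Gamma (?r + s) / Gamma ?r < exp (s * (2 * (m + \<delta>)))"
    using Gamma_ratio_less_exp_right[OF r, of "2 * (m + \<delta>)"] \<delta> by (auto simp: m_def)
  obtain s' where s': "s' < 0" "- ?r < s'" "Gamma (?r + s') / Gamma ?r < exp (s' * (2 * (m - \<delta>)))"
    using Gamma_ratio_less_exp_left[OF r, of "2 * (m - \<delta>)"] \<delta> by (auto simp: m_def)
  have "- ?r < s" using s r by linarith
  from AE_tilted_bound[OF j this s(2)] AE_tilted_bound[OF j s'(2,3)]
  have "AE \<omega> in M. (\<forall>\<^sub>F N in sequentially. s * (2 * ln (norm (random_frame N j \<omega>))) < real N * (s * (2 * (m + \<delta>)))) \<and>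
    (\<forall>\<^sub>F N in sequentially. s' * (2 * ln (norm (random_frame N j \<omega>))) < real N * (s' * (2 * (m - \<delta>)))) \<and> (\<forall>N. random_frame N j \<omega> \<noteq> 0)"
    using AE_random_frames_nonzero by eventually_elim (use j in blast)
  then show ?thesis
  proof eventually_elim
    case (elim \<omega>)
    then have nz: "\<And>N. random_frame N j \<omega> \<noteq> 0" by blast
    from elim have "\<forall>\<^sub>F N in sequentially. s * (2 * ln (norm (random_frame N j \<omega>))) < real N * (s * (2 * (m + \<delta>)))"
      "\<forall>\<^sub>F N in sequentially. s' * (2 * ln (norm (random_frame N j \<omega>))) < real N * (s' * (2 * (m - \<delta>)))" by blast+
    then show ?case
    proof eventually_elim
      case (elim N)
      let ?x = "norm (random_frame N j \<omega>)"
      have pos: "?x > 0" using nz by simp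
      have "s * ln ?x < s * (real N * (m + \<delta>))" using elim(1) by (simp add: algebra_simps)
      then have "ln ?x < real N * (m + \<delta>)" using s(1) by simp
      then have 1: "?x \<le> exp (real N * (m + \<delta>))"
        using pos by (metis exp_le_cancel_iff exp_ln less_imp_le)
      have "s' * ln ?x < s' * (real N * (m - \<delta>))" using elim(2) by (simp add: algebra_simps)
      then have "real N * (m - \<delta>) < ln ?x" using s'(1) by simp
      then have "- ln ?x \<le> real N * (- m + \<delta>)" by (simp add: algebra_simps)
      then have "exp (- ln ?x) \<le> exp (real N * (- m + \<delta>))" by simp
      then have "inverse ?x \<le> exp (real N * (- m + \<delta>))" using pos by (simp add: exp_minus)
      with 1 show ?case by blast
    qed
  qed
qed

text \<open>A countable set of tolerances suffices, which allows an almost sure statement for each of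
  them.\<close>

lemma growth_leI_countable:
  assumes "\<And>n. \<forall>\<^sub>F N in sequentially. f N \<le> exp (real N * (a + inverse (real (Suc n))))"
  shows "growth_le f a"
  unfolding growth_le_def
proof (intro allI impI)
  fix \<epsilon> :: real assume "\<epsilon> > 0"
  then obtain n where n: "inverse (real (Suc n)) < \<epsilon>" using reals_Archimedean by blast
  show "\<forall>\<^sub>F N in sequentially. f N \<le> exp (real N * (a + \<epsilon>))"
    using assms[of n]
  proof eventually_elim
    case (elim N)
    have "exp (real N * (a + inverse (real (Suc n)))) \<le> exp (real N * (a + \<epsilon>))"
      using n by (simp add: mult_left_mono)
    then show ?case using elim by linarith
  qed
qed

lemma AE_growth_le:
  assumes j: "j < CARD('n)"
  shows "AE \<omega> in M. growth_le (\<lambda>N. norm (random_frame N j \<omega>)) (Digamma (real (CARD('n) - j)) / 2) \<and>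
    growth_le (\<lambda>N. inverse (norm (random_frame N j \<omega>))) (- (Digamma (real (CARD('n) - j)) / 2))"
proof -
  let ?m = "Digamma (real (CARD('n) - j)) / 2"
  have "AE \<omega> in M. \<forall>n. \<forall>\<^sub>F N in sequentially. norm (random_frame N j \<omega>) \<le> exp (real N * (?m + inverse (real (Suc n)))) \<and>
    inverse (norm (random_frame N j \<omega>)) \<le> exp (real N * (- ?m + inverse (real (Suc n))))"
    unfolding AE_all_countable by (intro allI AE_growth j) simp
  then show ?thesis
  proof eventually_elim
    case (elim \<omega>)
    show ?case
      by (intro conjI growth_leI_countable; rule eventually_mono[OF spec[OF elim]]; blast)
  qed
qed

lemma second_moment_factor: "(\<integral>\<^sup>+\<omega>. ennreal ((norm (A (Suc N) \<omega>))\<^sup>2) \<partial>M) = ennreal (real (CARD('n) * CARD('n)))"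
proof -
  have entry: "(\<integral>\<^sup>+\<omega>. ennreal ((norm (A (Suc N) \<omega> $ i $ j))\<^sup>2) \<partial>M) = 1" for i j
  proof -
    have D: "distributed M lborel (\<lambda>\<omega>. A (Suc N) \<omega> $ i $ j) std_complex_normal_density"
      using gaussian[of "Suc N"] by (simp add: complex_gaussian_matrix_def)
    have "(\<integral>\<^sup>+\<omega>. ennreal ((norm (A (Suc N) \<omega> $ i $ j))\<^sup>2) \<partial>M)
        = (\<integral>\<^sup>+z. ennreal ((norm z)\<^sup>2) \<partial>distr M lborel (\<lambda>\<omega>. A (Suc N) \<omega> $ i $ j))"
      by (rule nn_integral_distr[symmetric]) auto
    also have "\<dots> = (\<integral>\<^sup>+z. ennreal ((norm z)\<^sup>2) \<partial>(std_gauss :: complex measure))"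
      using D by (simp add: distributed_def std_gauss_complex)
    also have "\<dots> = (\<integral>\<^sup>+t. ennreal t \<partial>distr std_gauss lborel (\<lambda>z::complex. (norm z)\<^sup>2))"
      by (rule nn_integral_distr[symmetric]) auto
    also have "\<dots> = (\<integral>\<^sup>+t. ennreal t \<partial>density lborel (exponential_density 1))"
      using exponential_std_gauss_complex by (simp add: distributed_def)
    also have "\<dots> = (\<integral>\<^sup>+t. ennreal (erlang_density 0 1 t * t ^ 1) \<partial>lborel)"
      by (subst nn_integral_density) (auto simp: ennreal_mult' intro!: nn_integral_cong)
    also have "\<dots> = 1" by (subst nn_integral_erlang_ith_moment) auto
    finally show ?thesis .
  qed
  have "ennreal ((norm (A (Suc N) \<omega>))\<^sup>2) = (\<Sum>i\<in>UNIV. \<Sum>j\<in>UNIV. ennreal ((norm (A (Suc N) \<omega> $ i $ j))\<^sup>2))" for \<omega>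
    by (simp add: norm_vec_square[of "A (Suc N) \<omega>"] norm_vec_square[of "A (Suc N) \<omega> $ _"] sum_nonneg)
  then have "(\<integral>\<^sup>+\<omega>. ennreal ((norm (A (Suc N) \<omega>))\<^sup>2) \<partial>M) = (\<Sum>i\<in>(UNIV::'n set). \<Sum>j\<in>(UNIV::'n set). 1)"
    by (simp add: nn_integral_sum entry del: sum_ennreal)
  then show ?thesis by (simp add: ennreal_of_nat_eq_real_of_nat ennreal_mult)
qed

lemma norm_matrix_vector_mult_le: "norm (a *v x) \<le> norm (a :: complex^'n^'n) * norm x"
proof -
  have "norm ((a *v x) $ i) \<le> norm (a $ i) * norm x" for i
  proof -
    have "(a *v x) $ i = cinner (\<chi> j. cnj (a $ i $ j)) x"
      by (simp add: cinner_def matrix_vector_mult_def)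
    moreover have "norm (\<chi> j. cnj (a $ i $ j)) = norm (a $ i)"
      by (simp add: norm_vec_def)
    ultimately show ?thesis using norm_cinner_le[of "\<chi> j. cnj (a $ i $ j)" x] by simp
  qed
  then have "(norm (a *v x))\<^sup>2 \<le> (\<Sum>i\<in>UNIV. (norm (a $ i) * norm x)\<^sup>2)"
    unfolding norm_vec_square[of "a *v x"] by (intro sum_mono power_mono) auto
  also have "\<dots> = (norm a * norm x)\<^sup>2"
    by (simp add: power_mult_distrib norm_vec_square[of a] sum_distrib_right)
  finally show ?thesis by (rule power2_le_imp_le) simp
qed

lemma AE_factor_bound:
  assumes \<epsilon>: "\<epsilon> > 0"
  shows "AE \<omega> in M. \<forall>\<^sub>F N in sequentially. norm (A (Suc N) \<omega>) \<le> exp (real (Suc N) * \<epsilon>)"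
proof -
  let ?K = "real (CARD('n) * CARD('n))"
  have "AE \<omega> in M. \<forall>\<^sub>F N in sequentially. (norm (A (Suc N) \<omega>))\<^sup>2 * exp (- \<epsilon>) ^ N < 1"
  proof (rule AE_eventually_less_1[where K = ?K and c = "exp (- \<epsilon>)"])
    fix N
    have "(\<integral>\<^sup>+\<omega>. ennreal ((norm (A (Suc N) \<omega>))\<^sup>2 * exp (- \<epsilon>) ^ N) \<partial>M)
      = (\<integral>\<^sup>+\<omega>. ennreal ((norm (A (Suc N) \<omega>))\<^sup>2) * ennreal (exp (- \<epsilon>) ^ N) \<partial>M)"
      by (simp add: ennreal_mult)
    also have "\<dots> = ennreal ?K * ennreal (exp (- \<epsilon>) ^ N)"
      by (subst nn_integral_multc) (auto simp: second_moment_factor)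
    also have "\<dots> = ennreal (?K * exp (- \<epsilon>) ^ N)" by (simp only: ennreal_mult[symmetric] of_nat_0_le_iff zero_le_power exp_ge_zero)
    finally show "(\<integral>\<^sup>+\<omega>. ennreal ((norm (A (Suc N) \<omega>))\<^sup>2 * exp (- \<epsilon>) ^ N) \<partial>M) \<le> ennreal (?K * exp (- \<epsilon>) ^ N)" by simp
  qed (use \<epsilon> in auto)
  then show ?thesis
  proof eventually_elim
    case (elim \<omega>)
    then show ?case
    proof eventually_elim
      case (elim N)
      have "(norm (A (Suc N) \<omega>))\<^sup>2 * exp (- (real N * \<epsilon>)) < 1"
        using elim by (simp flip: exp_of_nat_mult)
      then have "(norm (A (Suc N) \<omega>))\<^sup>2 \<le> exp (real N * \<epsilon>)"
        by (simp add: exp_minus field_simps)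
      also have "\<dots> \<le> (exp (real (Suc N) * \<epsilon>))\<^sup>2"
        using \<epsilon> by (simp add: power2_eq_square algebra_simps flip: exp_add)
      finally show ?case by (rule power2_le_imp_le) simp
    qed
  qed
qed

lemma AE_separated_growth:
  "AE \<omega> in M. separated_growth (\<lambda>k. A k \<omega>) e (\<lambda>j. Digamma (real (CARD('n) - j)) / 2)"
proof -
  note AE_random_frames_nonzero
  moreover have "AE \<omega> in M. \<forall>j. j < CARD('n) \<longrightarrow> growth_le (\<lambda>N. norm (random_frame N j \<omega>)) (Digamma (real (CARD('n) - j)) / 2) \<and>
    growth_le (\<lambda>N. inverse (norm (random_frame N j \<omega>))) (- (Digamma (real (CARD('n) - j)) / 2))"
    unfolding AE_all_countable
  proof
    fix j
    show "AE \<omega> in M. j < CARD('n) \<longrightarrow> growth_le (\<lambda>N. norm (random_frame N j \<omega>)) (Digamma (real (CARD('n) - j)) / 2) \<and>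
      growth_le (\<lambda>N. inverse (norm (random_frame N j \<omega>))) (- (Digamma (real (CARD('n) - j)) / 2))"
      using AE_growth_le[of j] by (cases "j < CARD('n)") auto
  qed
  moreover have "AE \<omega> in M. \<forall>n. \<forall>\<^sub>F N in sequentially. norm (A (Suc N) \<omega>) \<le> exp (real (Suc N) * inverse (real (Suc n)))"
    unfolding AE_all_countable by (intro allI AE_factor_bound) simp
  ultimately show ?thesis
  proof eventually_elim
    case (elim \<omega>)
    show ?case
    proof
      show "bij_betw e {..<CARD('n)} UNIV" by (rule e)
      show "frame (\<lambda>k. A k \<omega>) e N j \<noteq> 0" if "j < CARD('n)" for N j
        using elim(1) that by (simp add: frame_eq_random_frame)
      show "growth_le (\<lambda>N. norm (frame (\<lambda>k. A k \<omega>) e N j)) (Digamma (real (CARD('n) - j)) / 2)" if "j < CARD('n)" for j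
        using elim(2) that by (simp add: frame_eq_random_frame)
      show "growth_le (\<lambda>N. inverse (norm (frame (\<lambda>k. A k \<omega>) e N j))) (- (Digamma (real (CARD('n) - j)) / 2))" if "j < CARD('n)" for j
        using elim(2) that by (simp add: frame_eq_random_frame)
      show "Digamma (real (CARD('n) - j)) / 2 < Digamma (real (CARD('n) - i)) / 2" if "i < j" "j < CARD('n)" for i j
        using that by (intro divide_strict_right_mono Digamma_real_strict_mono) auto
      show "\<forall>\<^sub>F N in sequentially. \<forall>x. norm (A N \<omega> *v x) \<le> exp (real N * \<epsilon>) * norm x" if "\<epsilon> > 0" for \<epsilon>
      proof -
        obtain n where n: "inverse (real (Suc n)) < \<epsilon>" using \<open>\<epsilon> > 0\<close> reals_Archimedean by blast
        have "\<forall>\<^sub>F N in sequentially. norm (A (Suc N) \<omega>) \<le> exp (real (Suc N) * inverse (real (Suc n)))"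
          using elim(3) by blast
        then have "\<forall>\<^sub>F N in sequentially. \<forall>x. norm (A (Suc N) \<omega> *v x) \<le> exp (real (Suc N) * \<epsilon>) * norm x"
        proof eventually_elim
          case (elim N)
          have "exp (real (Suc N) * inverse (real (Suc n))) \<le> exp (real (Suc N) * \<epsilon>)"
            unfolding exp_le_cancel_iff using n by (intro mult_left_mono) auto
          then have "norm (A (Suc N) \<omega>) \<le> exp (real (Suc N) * \<epsilon>)" using elim by linarith
          then show ?case
            by (intro allI order_trans[OF norm_matrix_vector_mult_le] mult_right_mono) auto
        qed
        then show ?thesis
          using eventually_sequentially_Suc[of "\<lambda>N. \<forall>x. norm (A N \<omega> *v x) \<le> exp (real N * \<epsilon>) * norm x"] by simp
      qed
    qed
  qed
qed

end

section \<open>The Lyapunov exponents\<close>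

text \<open>The smallest root on either side occurs on the other side, so the last entries agree, and their
  linear factor cancels.\<close>

lemma antimono_eq_of_root_products_eq:
  fixes a b :: "nat \<Rightarrow> real"
  assumes "antimono_on {1..n} a" "antimono_on {1..n} b"
    and "(\<Prod>i=1..n. [:- complex_of_real (a i), 1:]) = (\<Prod>i=1..n. [:- complex_of_real (b i), 1:])"
  shows "\<forall>i\<in>{1..n}. a i = b i"
  using assms
proof (induction n)
  case (Suc n)
  have last_le: "d (Suc n) \<le> c (Suc n)"
    if eq: "(\<Prod>i=1..Suc n. [:- complex_of_real (c i), 1:]) = (\<Prod>i=1..Suc n. [:- complex_of_real (d i), 1:])"
      and d: "antimono_on {1..Suc n} d" for c d :: "nat \<Rightarrow> real"
  proof -
    have "poly (\<Prod>i=1..Suc n. [:- complex_of_real (c i), 1:]) (complex_of_real (c (Suc n))) = 0"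
      by (simp add: poly_prod)
    then have "(\<Prod>i=1..Suc n. complex_of_real (c (Suc n)) - complex_of_real (d i)) = 0"
      unfolding eq by (simp add: poly_prod)
    then obtain i where "i \<in> {1..Suc n}" "c (Suc n) = d i"
      by (auto simp: prod_zero_iff simp del: prod.cl_ivl_Suc)
    then show ?thesis using d by (auto simp: monotone_on_def)
  qed
  have last: "a (Suc n) = b (Suc n)"
    using last_le[OF Suc.prems(3) Suc.prems(2)] last_le[OF Suc.prems(3)[symmetric] Suc.prems(1)] by simp
  have "(\<Prod>i=1..n. [:- complex_of_real (a i), 1:]) = (\<Prod>i=1..n. [:- complex_of_real (b i), 1:])"
  proof -
    have "(\<Prod>i=1..n. [:- complex_of_real (a i), 1:]) * [:- complex_of_real (b (Suc n)), 1:]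
        = (\<Prod>i=1..n. [:- complex_of_real (b i), 1:]) * [:- complex_of_real (b (Suc n)), 1:]"
      using Suc.prems(3) last by (simp del: mult_pCons_left mult_pCons_right)
    then show ?thesis by (subst (asm) mult_right_cancel) simp_all
  qed
  then have "\<forall>i\<in>{1..n}. a i = b i"
    using Suc.prems(1,2) by (intro Suc.IH) (auto simp: monotone_on_def)
  then show ?case using last by (auto simp: le_Suc_eq)
qed simp

theorem proposition1:
  fixes M :: "'a measure"
    and A :: "nat \<Rightarrow> 'a \<Rightarrow> complex^'n^'n"
    and \<mu> :: "nat \<Rightarrow> real"
  assumes "prob_space M"
    and "prob_space.indep_vars M (\<lambda>_. borel) A {1..}"
    and "\<And>k. k \<ge> 1 \<Longrightarrow> complex_gaussian_matrix M (A k)"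
  shows "lyapunov_exponents M A \<mu> \<longleftrightarrow>
           (\<forall>i\<in>{1..CARD('n)}. \<mu> i = 1/2 * Digamma (real (CARD('n) - i + 1)))"
proof -
  interpret prob_space M by fact
  obtain e where e: "bij_betw e {..<CARD('n)} (UNIV :: 'n set)"
    using ex_bij_betw_nat_finite[of "UNIV :: 'n set"] by (auto simp: atLeast0LessThan)
  interpret gaussian_product M A e
    using assms(2,3) e by unfold_locales auto
  define \<nu> where "\<nu> i = 1/2 * Digamma (real (CARD('n) - i + 1))" for i
  define C where "C \<omega> N = psd_root (2 * N) (ctranspose (partial_product N \<omega>) ** partial_product N \<omega>)" for \<omega> N
  have C: "(\<lambda>N. let P = matrix_product (\<lambda>k. A k \<omega>) N in psd_root (2 * N) (ctranspose P ** P)) = C \<omega>" for \<omega>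
    by (simp add: C_def partial_product_def Let_def fun_eq_iff)
  have lim: "AE \<omega> in M. \<exists>V. C \<omega> \<longlonglongrightarrow> V \<and> (\<forall>z. det (mat z - V) = (\<Prod>i=1..CARD('n). z - complex_of_real (exp (\<nu> i))))"
    using AE_separated_growth
  proof eventually_elim
    case (elim \<omega>)
    then interpret separated_growth "\<lambda>k. A k \<omega>" e "\<lambda>j. Digamma (real (CARD('n) - j)) / 2" .
    have "(\<Prod>j<CARD('n). z - complex_of_real (exp (Digamma (real (CARD('n) - j)) / 2)))
        = (\<Prod>i=1..CARD('n). z - complex_of_real (exp (\<nu> i)))" for z
      by (rule prod.reindex_bij_witness[of _ "\<lambda>i. i - 1" Suc]) (auto simp: \<nu>_def Suc_diff_Suc)
    then show ?case
      using tendsto_C charpoly_V unfolding C_def[abs_def] partial_product_def by auto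
  qed
  have \<nu>_antimono: "antimono_on {1..CARD('n)} \<nu>"
    by (auto simp: monotone_on_def \<nu>_def intro!: Digamma_real_mono)
  show ?thesis
  proof
    assume \<mu>: "lyapunov_exponents M A \<mu>"
    then have "AE \<omega> in M. \<exists>V. C \<omega> \<longlonglongrightarrow> V \<and> (\<forall>z. det (mat z - V) = (\<Prod>i=1..CARD('n). z - complex_of_real (exp (\<mu> i))))"
      unfolding lyapunov_exponents_def C by blast
    with lim have "AE \<omega> in M. \<exists>V. C \<omega> \<longlonglongrightarrow> V \<and>
        (\<forall>z. det (mat z - V) = (\<Prod>i=1..CARD('n). z - complex_of_real (exp (\<nu> i)))) \<and>
        (\<forall>z. det (mat z - V) = (\<Prod>i=1..CARD('n). z - complex_of_real (exp (\<mu> i))))"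
      by eventually_elim (metis LIMSEQ_unique)
    then have "AE \<omega> in M. \<forall>z. (\<Prod>i=1..CARD('n). z - complex_of_real (exp (\<mu> i))) = (\<Prod>i=1..CARD('n). z - complex_of_real (exp (\<nu> i)))"
      by eventually_elim metis
    then have eq: "(\<Prod>i=1..CARD('n). z - complex_of_real (exp (\<mu> i))) = (\<Prod>i=1..CARD('n). z - complex_of_real (exp (\<nu> i)))" for z
      by simp
    have "poly (\<Prod>i=1..CARD('n). [:- complex_of_real (exp (\<mu> i)), 1:]) = poly (\<Prod>i=1..CARD('n). [:- complex_of_real (exp (\<nu> i)), 1:])"
      using eq by (simp add: fun_eq_iff poly_prod)
    then have "(\<Prod>i=1..CARD('n). [:- complex_of_real (exp (\<mu> i)), 1:]) = (\<Prod>i=1..CARD('n). [:- complex_of_real (exp (\<nu> i)), 1:])"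
      by (simp only: poly_eq_poly_eq_iff)
    moreover have "antimono_on {1..CARD('n)} (\<lambda>i. exp (\<mu> i))" "antimono_on {1..CARD('n)} (\<lambda>i. exp (\<nu> i))"
      using \<mu> \<nu>_antimono by (auto simp: lyapunov_exponents_def monotone_on_def)
    ultimately have "\<forall>i\<in>{1..CARD('n)}. exp (\<mu> i) = exp (\<nu> i)"
      using antimono_eq_of_root_products_eq[of "CARD('n)" "\<lambda>i. exp (\<mu> i)" "\<lambda>i. exp (\<nu> i)"] by blast
    then show "\<forall>i\<in>{1..CARD('n)}. \<mu> i = 1/2 * Digamma (real (CARD('n) - i + 1))"
      by (simp add: \<nu>_def)
  next
    assume "\<forall>i\<in>{1..CARD('n)}. \<mu> i = 1/2 * Digamma (real (CARD('n) - i + 1))"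
    then have eq: "\<mu> i = \<nu> i" if "i \<in> {1..CARD('n)}" for i using that by (simp add: \<nu>_def)
    have "antimono_on {1..CARD('n)} \<mu>"
      using \<nu>_antimono by (simp add: monotone_on_def eq)
    moreover have "(\<Prod>i=1..CARD('n). z - complex_of_real (exp (\<mu> i))) = (\<Prod>i=1..CARD('n). z - complex_of_real (exp (\<nu> i)))" for z
      by (intro prod.cong) (auto simp: eq)
    ultimately show "lyapunov_exponents M A \<mu>"
      unfolding lyapunov_exponents_def C using lim by simp
  qed
qed

end
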